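(* Let $(M,g)$ be a smooth Riemannian manifold of dimension $n>1$ and let $(G,J)$ be the natural almost Hermitian structure of diagonal type on $T^*M$ determined by smooth functions $a_1,b_1,\lambda,\mu:[0,\infty)\to\mathbb{R}$ with $a_1>0$, $a_1+2tb_1>0$, $\lambda>0$, $\lambda+2t\mu>0$ for all $t\ge 0$. Then $(G,J)$ is Kählerian if and only if there is a constant $c$ such that $(M,g)$ has constant sectional curvature $c$, the function $b_1$ is given by $$b_1=\frac{a_1a_1'-c}{a_1-2ta_1'},$$ and $\mu=\lambda'$.
   Context: Let $(M,g)$ be an $n$-dimensional Riemannian manifold and $\pi:T^*M\to M$ its cotangent bundle. A local chart $(U,x^1,\dots,x^n)$ of $M$ induces a chart $(\pi^{-1}(U),q^1,\dots,q^n,p_1,\dots,p_n)$ of $T^*M$ with $q^i=x^i\circ\pi$ and $p=p_i\,dx^i_{\pi(p)}$. Summation convention is used. Let $\Gamma^k_{ij}$ be the Christoffel symbols of the Levi-Civita connection of $g$, $(g^{ij})$ the inverse matrix of $(g_{ij})$, $\Gamma^0_{ih}=p_k\Gamma^k_{ih}$, $g^{0i}=p_hg^{hi}$, $\partial^i=\partial/\partial p_i$ and $\delta_i=\partial/\partial q^i+\Gamma^0_{ih}\,\partial/\partial p_h$. Then $(\partial^1,\dots,\partial^n,\delta_1,\dots,\delta_n)$ is a local frame on $T^*M$. Let $t=\frac12 g^{ik}p_ip_k\in[0,\infty)$ be the energy density; functions of $t$ are regarded as functions on $T^*M$, and a prime denotes $d/dt$. The natural almost Hermitian structure $(G,J)$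 of diagonal type determined by $a_1,b_1,\lambda,\mu$ is $$J\delta_i=a_1g_{ij}\partial^j+b_1p_ip_j\partial^j,\qquad J\partial^i=-a_2g^{ij}\delta_j-b_2g^{0i}g^{0j}\delta_j,$$ $$G(\delta_i,\delta_j)=c_1g_{ij}+d_1p_ip_j,\qquad G(\partial^i,\partial^j)=c_2g^{ij}+d_2g^{0i}g^{0j},\qquad G(\partial^i,\delta_j)=0,$$ where $a_2=\frac1{a_1}$, $b_2=-\frac{b_1}{a_1(a_1+2tb_1)}$, $c_1=\lambda a_1$, $c_2=\lambda a_2$, $d_1=\lambda b_1+\mu(a_1+2tb_1)$, $d_2=\lambda b_2+\mu(a_2+2tb_2)$. The structure is Kählerian if $J$ is integrable (its Nijenhuis tensor vanishes) and the $2$-form $\phi(X,Y)=G(X,JY)$ is closed. The formula for $b_1$ is understood to include that its denominator vanishes nowhere. All objects are smooth. *)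

theory Defs
  imports "HOL-Analysis.Analysis"
begin

section \<open>Smooth functions\<close>

text \<open>Used only for open sets and for the half-line \<open>{0..}\<close>, where the derivative within
  the set is uniquely determined (one-sided at \<open>0\<close>).\<close>

primrec C_k_on ::
  "nat \<Rightarrow> 'a::euclidean_space set \<Rightarrow> ('a \<Rightarrow> 'b::real_normed_vector) \<Rightarrow> bool" where
  "C_k_on 0 S f \<longleftrightarrow> continuous_on S f"
| "C_k_on (Suc k) S f \<longleftrightarrow> f differentiable_on S \<and>
     (\<forall>v. C_k_on k S (\<lambda>x. frechet_derivative f (at x within S) v))"

definition smooth_on :: "'a::euclidean_space set \<Rightarrow> ('a \<Rightarrow> 'b::real_normed_vector) \<Rightarrow> bool" where
  "smooth_on S f \<longleftrightarrow> (\<forall>k. C_k_on k S f)"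

definition halfline_deriv :: "(real \<Rightarrow> real) \<Rightarrow> real \<Rightarrow> real" where
  "halfline_deriv f t = vector_derivative f (at t within {0..})"


section \<open>Smooth manifolds\<close>

text \<open>A chart is a pair of a domain and a coordinate map; the values of the map outside the
  domain are irrelevant.\<close>

type_synonym ('m, 'e) chart = "'m set \<times> ('m \<Rightarrow> 'e)"

abbreviation chart_dom :: "('m, 'e) chart \<Rightarrow> 'm set" where
  "chart_dom \<kappa> \<equiv> fst \<kappa>"

abbreviation chart_map :: "('m, 'e) chart \<Rightarrow> 'm \<Rightarrow> 'e" where
  "chart_map \<kappa> \<equiv> snd \<kappa>"

definition chart_image :: "('m, 'e) chart \<Rightarrow> 'e set" where
  "chart_image \<kappa> = chart_map \<kappa> ` chart_dom \<kappa>"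

definition chart_inv :: "('m, 'e) chart \<Rightarrow> 'e \<Rightarrow> 'm" where
  "chart_inv \<kappa> = inv_into (chart_dom \<kappa>) (chart_map \<kappa>)"

text \<open>The atlas need not be maximal. Manifolds are nonempty but not necessarily connected.\<close>

definition smooth_manifold :: "'m topology \<Rightarrow> ('m, 'e::euclidean_space) chart set \<Rightarrow> bool" where
  "smooth_manifold X A \<longleftrightarrow>
     topspace X \<noteq> {} \<and> Hausdorff_space X \<and> second_countable X \<and>
     (\<Union>\<kappa>\<in>A. chart_dom \<kappa>) = topspace X \<and>
     (\<forall>\<kappa>\<in>A. openin X (chart_dom \<kappa>) \<and> open (chart_image \<kappa>) \<and>
        homeomorphic_map (subtopology X (chart_dom \<kappa>)) (top_of_set (chart_image \<kappa>))
          (chart_map \<kappa>)) \<and>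
     (\<forall>\<kappa>\<in>A. \<forall>\<kappa>'\<in>A. smooth_on (chart_map \<kappa> ` (chart_dom \<kappa> \<inter> chart_dom \<kappa>'))
        (chart_map \<kappa>' \<circ> chart_inv \<kappa>))"

definition carrier_of :: "('m, 'e) chart set \<Rightarrow> 'm set" where
  "carrier_of A = (\<Union>\<kappa>\<in>A. chart_dom \<kappa>)"

definition smooth_near :: "('m, 'e::euclidean_space) chart set \<Rightarrow> 'm \<Rightarrow> ('m \<Rightarrow> real) \<Rightarrow> bool" where
  "smooth_near A x f \<longleftrightarrow> (\<exists>\<kappa>\<in>A. x \<in> chart_dom \<kappa> \<and>
     (\<exists>W. open W \<and> chart_map \<kappa> x \<in> W \<and> W \<subseteq> chart_image \<kappa> \<and> smooth_on W (f \<circ> chart_inv \<kappa>)))"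


section \<open>Tangent vectors and tensors\<close>

text \<open>A tangent vector at \<open>x\<close> is a derivation of the functions that are smooth near \<open>x\<close>,
  normalised to be \<open>0\<close> on all other functions; vectors are added and scaled pointwise.
  \<open>coord_vec A \<kappa> x w\<close> is the vector at \<open>x\<close> whose coordinate vector in the chart \<open>\<kappa>\<close> is \<open>w\<close>.\<close>

type_synonym 'm tvec = "('m \<Rightarrow> real) \<Rightarrow> real"

definition coord_vec ::
  "('m, 'e::euclidean_space) chart set \<Rightarrow> ('m, 'e) chart \<Rightarrow> 'm \<Rightarrow> 'e \<Rightarrow> 'm tvec" where
  "coord_vec A \<kappa> x w = (\<lambda>f. if smooth_near A x f
     then frechet_derivative (f \<circ> chart_inv \<kappa>) (at (chart_map \<kappa> x)) w else 0)"

definition tangent_space :: "('m, 'e::euclidean_space) chart set \<Rightarrow> 'm \<Rightarrow> 'm tvec set" where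
  "tangent_space A x = {coord_vec A \<kappa> x w |\<kappa> w. \<kappa> \<in> A \<and> x \<in> chart_dom \<kappa>}"

definition tvec_coords :: "('m, 'e::euclidean_space) chart \<Rightarrow> 'm tvec \<Rightarrow> 'e" where
  "tvec_coords \<kappa> v = (\<Sum>b\<in>Basis. v (\<lambda>x. chart_map \<kappa> x \<bullet> b) *\<^sub>R b)"

definition functional_on :: "'m tvec set \<Rightarrow> ('m tvec \<Rightarrow> real) \<Rightarrow> bool" where
  "functional_on T p \<longleftrightarrow>
     (\<forall>u\<in>T. \<forall>v\<in>T. \<forall>r s. p (\<lambda>f. r * u f + s * v f) = r * p u + s * p v)"

definition bilinear_form_on :: "'m tvec set \<Rightarrow> ('m tvec \<Rightarrow> 'm tvec \<Rightarrow> real) \<Rightarrow> bool" where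
  "bilinear_form_on T B \<longleftrightarrow>
     (\<forall>u\<in>T. functional_on T (\<lambda>v. B u v) \<and> functional_on T (\<lambda>v. B v u))"

definition endomorphism_on :: "'m tvec set \<Rightarrow> ('m tvec \<Rightarrow> 'm tvec) \<Rightarrow> bool" where
  "endomorphism_on T L \<longleftrightarrow> (\<forall>u\<in>T. L u \<in> T) \<and>
     (\<forall>u\<in>T. \<forall>v\<in>T. \<forall>r s. L (\<lambda>f. r * u f + s * v f) = (\<lambda>f. r * L u f + s * L v f))"


section \<open>Riemannian metrics and curvature\<close>

type_synonym 'm metric_field = "'m \<Rightarrow> 'm tvec \<Rightarrow> 'm tvec \<Rightarrow> real"

text \<open>In this section \<open>q\<close> ranges over the coordinate domain \<open>chart_image \<kappa>\<close>.\<close>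

definition metric_matrix ::
  "('m, real^'n) chart set \<Rightarrow> 'm metric_field \<Rightarrow> ('m, real^'n) chart \<Rightarrow> real^'n \<Rightarrow> real^'n^'n" where
  "metric_matrix A g \<kappa> q = (\<chi> i j. g (chart_inv \<kappa> q)
     (coord_vec A \<kappa> (chart_inv \<kappa> q) (axis i 1)) (coord_vec A \<kappa> (chart_inv \<kappa> q) (axis j 1)))"

definition riemannian_metric :: "('m, real^'n) chart set \<Rightarrow> 'm metric_field \<Rightarrow> bool" where
  "riemannian_metric A g \<longleftrightarrow>
     (\<forall>x\<in>carrier_of A.
        bilinear_form_on (tangent_space A x) (g x) \<and>
        (\<forall>u\<in>tangent_space A x. \<forall>v\<in>tangent_space A x. g x u v = g x v u) \<and>
        (\<forall>u\<in>tangent_space A x. u \<noteq> (\<lambda>f. 0) \<longrightarrow> g x u u > 0)) \<and>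
     (\<forall>\<kappa>\<in>A. smooth_on (chart_image \<kappa>) (metric_matrix A g \<kappa>))"

definition inverse_metric_matrix ::
  "('m, real^'n) chart set \<Rightarrow> 'm metric_field \<Rightarrow> ('m, real^'n) chart \<Rightarrow> real^'n \<Rightarrow> real^'n^'n" where
  "inverse_metric_matrix A g \<kappa> q = matrix_inv (metric_matrix A g \<kappa> q)"

definition partial_deriv :: "'n::finite \<Rightarrow> (real^'n \<Rightarrow> real) \<Rightarrow> real^'n \<Rightarrow> real" where
  "partial_deriv i F q = frechet_derivative F (at q) (axis i 1)"

text \<open>\<open>christoffel A g \<kappa> q k i j\<close> is \<open>\<Gamma>\<^sup>k\<^sub>i\<^sub>j\<close>.\<close>

definition christoffel :: "('m, real^'n) chart set \<Rightarrow> 'm metric_field \<Rightarrow> ('m, real^'n) chart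
    \<Rightarrow> real^'n \<Rightarrow> 'n \<Rightarrow> 'n \<Rightarrow> 'n \<Rightarrow> real" where
  "christoffel A g \<kappa> q k i j = (1/2) * (\<Sum>l\<in>UNIV. inverse_metric_matrix A g \<kappa> q $ k $ l *
     (partial_deriv i (\<lambda>y. metric_matrix A g \<kappa> y $ j $ l) q
      + partial_deriv j (\<lambda>y. metric_matrix A g \<kappa> y $ i $ l) q
      - partial_deriv l (\<lambda>y. metric_matrix A g \<kappa> y $ i $ j) q))"

text \<open>\<open>riemann_tensor A g \<kappa> q l k i j\<close> is the \<open>l\<close>-th component of \<open>R(\<partial>\<^sub>i, \<partial>\<^sub>j) \<partial>\<^sub>k\<close>, where
  \<open>R(X, Y) Z = \<nabla>\<^sub>X \<nabla>\<^sub>Y Z - \<nabla>\<^sub>Y \<nabla>\<^sub>X Z - \<nabla>\<^bsub>[X, Y]\<^esub> Z\<close>.\<close>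

definition riemann_tensor :: "('m, real^'n) chart set \<Rightarrow> 'm metric_field \<Rightarrow> ('m, real^'n) chart
    \<Rightarrow> real^'n \<Rightarrow> 'n \<Rightarrow> 'n \<Rightarrow> 'n \<Rightarrow> 'n \<Rightarrow> real" where
  "riemann_tensor A g \<kappa> q l k i j =
     partial_deriv i (\<lambda>y. christoffel A g \<kappa> y l j k) q
     - partial_deriv j (\<lambda>y. christoffel A g \<kappa> y l i k) q
     + (\<Sum>m\<in>UNIV. christoffel A g \<kappa> q l i m * christoffel A g \<kappa> q m j k)
     - (\<Sum>m\<in>UNIV. christoffel A g \<kappa> q l j m * christoffel A g \<kappa> q m i k)"

definition curvature_vec :: "('m, real^'n) chart set \<Rightarrow> 'm metric_field \<Rightarrow> ('m, real^'n) chart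
    \<Rightarrow> 'm \<Rightarrow> 'm tvec \<Rightarrow> 'm tvec \<Rightarrow> 'm tvec \<Rightarrow> 'm tvec" where
  "curvature_vec A g \<kappa> x u v w = coord_vec A \<kappa> x (\<chi> l. \<Sum>k\<in>UNIV. \<Sum>i\<in>UNIV. \<Sum>j\<in>UNIV.
     riemann_tensor A g \<kappa> (chart_map \<kappa> x) l k i j *
       tvec_coords \<kappa> u $ i * tvec_coords \<kappa> v $ j * tvec_coords \<kappa> w $ k)"

definition sectional_curvature :: "('m, real^'n) chart set \<Rightarrow> 'm metric_field
    \<Rightarrow> ('m, real^'n) chart \<Rightarrow> 'm \<Rightarrow> 'm tvec \<Rightarrow> 'm tvec \<Rightarrow> real" where
  "sectional_curvature A g \<kappa> x u v =
     g x (curvature_vec A g \<kappa> x u v v) u / (g x u u * g x v v - (g x u v)\<^sup>2)"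

definition linearly_independent :: "'m tvec \<Rightarrow> 'm tvec \<Rightarrow> bool" where
  "linearly_independent u v \<longleftrightarrow> (\<forall>r s. (\<lambda>f. r * u f + s * v f) = (\<lambda>f. 0) \<longrightarrow> r = 0 \<and> s = 0)"

definition constant_sectional_curvature ::
  "('m, real^'n) chart set \<Rightarrow> 'm metric_field \<Rightarrow> real \<Rightarrow> bool" where
  "constant_sectional_curvature A g c \<longleftrightarrow>
     (\<forall>\<kappa>\<in>A. \<forall>x\<in>chart_dom \<kappa>. \<forall>u\<in>tangent_space A x. \<forall>v\<in>tangent_space A x.
        linearly_independent u v \<longrightarrow> sectional_curvature A g \<kappa> x u v = c)"


section \<open>The cotangent bundle\<close>

text \<open>Covectors are extended by \<open>0\<close> outside the tangent space, so that equality of covectors is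
  equality of functions.\<close>

definition cotangent_space ::
  "('m, 'e::euclidean_space) chart set \<Rightarrow> 'm \<Rightarrow> ('m tvec \<Rightarrow> real) set" where
  "cotangent_space A x =
     {p. functional_on (tangent_space A x) p \<and> (\<forall>v. v \<notin> tangent_space A x \<longrightarrow> p v = 0)}"

type_synonym 'm covec = "'m \<times> ('m tvec \<Rightarrow> real)"

definition cotangent_bundle :: "('m, 'e::euclidean_space) chart set \<Rightarrow> 'm covec set" where
  "cotangent_bundle A = (SIGMA x:carrier_of A. cotangent_space A x)"

text \<open>The coordinates of \<open>(x, p)\<close> in the induced chart are \<open>q\<^sup>i = x\<^sup>i(x)\<close> and
  \<open>p\<^sub>i = p(\<partial>/\<partial>x\<^sup>i)\<close>, i.e. \<open>p = p\<^sub>i dx\<^sup>i\<close>.\<close>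

definition fibre_coords ::
  "('m, real^'n) chart set \<Rightarrow> ('m, real^'n) chart \<Rightarrow> 'm covec \<Rightarrow> real^'n" where
  "fibre_coords A \<kappa> P = (\<chi> i. snd P (coord_vec A \<kappa> (fst P) (axis i 1)))"

definition induced_chart ::
  "('m, real^'n) chart set \<Rightarrow> ('m, real^'n) chart \<Rightarrow> ('m covec, (real^'n) \<times> (real^'n)) chart" where
  "induced_chart A \<kappa> =
     ({P \<in> cotangent_bundle A. fst P \<in> chart_dom \<kappa>},
      (\<lambda>P. (chart_map \<kappa> (fst P), fibre_coords A \<kappa> P)))"

definition cotangent_atlas ::
  "('m, real^'n) chart set \<Rightarrow> ('m covec, (real^'n) \<times> (real^'n)) chart set" where
  "cotangent_atlas A = induced_chart A ` A"

text \<open>\<open>\<partial>/\<partial>q\<^sup>i\<close>, \<open>\<partial>\<^sup>i = \<partial>/\<partial>p\<^sub>i\<close> and \<open>\<delta>\<^sub>i = \<partial>/\<partial>q\<^sup>i + \<Gamma>\<^sup>0\<^sub>i\<^sub>h \<partial>/\<partial>p\<^sub>h\<close> at a covector \<open>P\<close>.\<close>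

definition d_q :: "('m, real^'n) chart set \<Rightarrow> ('m, real^'n) chart \<Rightarrow> 'm covec \<Rightarrow> 'n
    \<Rightarrow> 'm covec tvec" where
  "d_q A \<kappa> P i = coord_vec (cotangent_atlas A) (induced_chart A \<kappa>) P (axis i 1, 0)"

definition d_p :: "('m, real^'n) chart set \<Rightarrow> ('m, real^'n) chart \<Rightarrow> 'm covec \<Rightarrow> 'n
    \<Rightarrow> 'm covec tvec" where
  "d_p A \<kappa> P i = coord_vec (cotangent_atlas A) (induced_chart A \<kappa>) P (0, axis i 1)"

definition Gamma0 :: "('m, real^'n) chart set \<Rightarrow> 'm metric_field \<Rightarrow> ('m, real^'n) chart
    \<Rightarrow> 'm covec \<Rightarrow> 'n \<Rightarrow> 'n \<Rightarrow> real" where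
  "Gamma0 A g \<kappa> P i h =
     (\<Sum>k\<in>UNIV. fibre_coords A \<kappa> P $ k * christoffel A g \<kappa> (chart_map \<kappa> (fst P)) k i h)"

definition delta :: "('m, real^'n) chart set \<Rightarrow> 'm metric_field \<Rightarrow> ('m, real^'n) chart
    \<Rightarrow> 'm covec \<Rightarrow> 'n \<Rightarrow> 'm covec tvec" where
  "delta A g \<kappa> P i = (\<lambda>f. d_q A \<kappa> P i f + (\<Sum>h\<in>UNIV. Gamma0 A g \<kappa> P i h * d_p A \<kappa> P h f))"

definition energy_density :: "('m, real^'n) chart set \<Rightarrow> 'm metric_field \<Rightarrow> ('m, real^'n) chart
    \<Rightarrow> 'm covec \<Rightarrow> real" where
  "energy_density A g \<kappa> P = (1/2) * (\<Sum>i\<in>UNIV. \<Sum>k\<in>UNIV.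
     inverse_metric_matrix A g \<kappa> (chart_map \<kappa> (fst P)) $ i $ k *
       fibre_coords A \<kappa> P $ i * fibre_coords A \<kappa> P $ k)"


section \<open>Natural almost Hermitian structures of diagonal type\<close>

text \<open>The tensor fields \<open>G\<close> and \<open>J\<close> on the cotangent bundle are determined, on all tangent
  vectors, by the following values on the frame \<open>(\<partial>\<^sup>i, \<delta>\<^sub>i)\<close> of every induced chart. Below,
  \<open>gl\<close>, \<open>gu\<close>, \<open>p\<close> and \<open>g0\<close> stand for \<open>g\<^sub>i\<^sub>j\<close>, \<open>g\<^sup>i\<^sup>j\<close>, \<open>p\<^sub>i\<close> and \<open>g\<^sup>0\<^sup>i\<close>.\<close>

definition natural_diagonal_structure ::
  "('m, real^'n) chart set \<Rightarrow> 'm metric_field \<Rightarrow>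
   (real \<Rightarrow> real) \<Rightarrow> (real \<Rightarrow> real) \<Rightarrow> (real \<Rightarrow> real) \<Rightarrow> (real \<Rightarrow> real) \<Rightarrow>
   'm covec metric_field \<Rightarrow> ('m covec \<Rightarrow> 'm covec tvec \<Rightarrow> 'm covec tvec) \<Rightarrow> bool" where
  "natural_diagonal_structure A g a1 b1 lam mu G J \<longleftrightarrow>
     (\<forall>P\<in>cotangent_bundle A.
        bilinear_form_on (tangent_space (cotangent_atlas A) P) (G P) \<and>
        endomorphism_on (tangent_space (cotangent_atlas A) P) (J P)) \<and>
     (\<forall>\<kappa>\<in>A. \<forall>P\<in>chart_dom (induced_chart A \<kappa>).
        let q = chart_map \<kappa> (fst P);
            p = (\<lambda>i. fibre_coords A \<kappa> P $ i);
            gl = (\<lambda>i j. metric_matrix A g \<kappa> q $ i $ j);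
            gu = (\<lambda>i j. inverse_metric_matrix A g \<kappa> q $ i $ j);
            g0 = (\<lambda>i. \<Sum>h\<in>UNIV. p h * gu h i);
            t = energy_density A g \<kappa> P;
            A1 = a1 t; B1 = b1 t; L = lam t; M = mu t;
            A2 = 1 / A1; B2 = - B1 / (A1 * (A1 + 2 * t * B1));
            C1 = L * A1; C2 = L * A2;
            D1 = L * B1 + M * (A1 + 2 * t * B1);
            D2 = L * B2 + M * (A2 + 2 * t * B2)
        in \<forall>i.
          J P (delta A g \<kappa> P i) =
            (\<lambda>f. \<Sum>j\<in>UNIV. (A1 * gl i j + B1 * p i * p j) * d_p A \<kappa> P j f) \<and>
          J P (d_p A \<kappa> P i) =
            (\<lambda>f. \<Sum>j\<in>UNIV. (- A2 * gu i j - B2 * g0 i * g0 j) * delta A g \<kappa> P j f) \<and>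
          (\<forall>j. G P (delta A g \<kappa> P i) (delta A g \<kappa> P j) = C1 * gl i j + D1 * p i * p j \<and>
               G P (d_p A \<kappa> P i) (d_p A \<kappa> P j) = C2 * gu i j + D2 * g0 i * g0 j \<and>
               G P (d_p A \<kappa> P i) (delta A g \<kappa> P j) = 0 \<and>
               G P (delta A g \<kappa> P j) (d_p A \<kappa> P i) = 0))"


section \<open>Kaehlerian structures\<close>

text \<open>Here \<open>B\<close> is the atlas of an arbitrary manifold, and vector fields on the domain of a chart
  are identified with their coordinate expressions on the image of the chart.\<close>

definition endo_in_chart :: "('m, 'e::euclidean_space) chart set \<Rightarrow> ('m \<Rightarrow> 'm tvec \<Rightarrow> 'm tvec)
    \<Rightarrow> ('m, 'e) chart \<Rightarrow> 'e \<Rightarrow> 'e \<Rightarrow> 'e" where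
  "endo_in_chart B J \<kappa> z w =
     tvec_coords \<kappa> (J (chart_inv \<kappa> z) (coord_vec B \<kappa> (chart_inv \<kappa> z) w))"

definition form_in_chart :: "('m, 'e::euclidean_space) chart set \<Rightarrow> ('m \<Rightarrow> 'm tvec \<Rightarrow> 'm tvec \<Rightarrow> real)
    \<Rightarrow> ('m, 'e) chart \<Rightarrow> 'e \<Rightarrow> 'e \<Rightarrow> 'e \<Rightarrow> real" where
  "form_in_chart B \<omega> \<kappa> z u v =
     \<omega> (chart_inv \<kappa> z) (coord_vec B \<kappa> (chart_inv \<kappa> z) u) (coord_vec B \<kappa> (chart_inv \<kappa> z) v)"

definition lie_bracket :: "('e::euclidean_space \<Rightarrow> 'e) \<Rightarrow> ('e \<Rightarrow> 'e) \<Rightarrow> 'e \<Rightarrow> 'e" where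
  "lie_bracket X Y z = frechet_derivative Y (at z) (X z) - frechet_derivative X (at z) (Y z)"

definition nijenhuis :: "('e::euclidean_space \<Rightarrow> 'e \<Rightarrow> 'e) \<Rightarrow> ('e \<Rightarrow> 'e) \<Rightarrow> ('e \<Rightarrow> 'e) \<Rightarrow> 'e \<Rightarrow> 'e" where
  "nijenhuis J X Y z =
     lie_bracket (\<lambda>y. J y (X y)) (\<lambda>y. J y (Y y)) z
     - J z (lie_bracket (\<lambda>y. J y (X y)) Y z)
     - J z (lie_bracket X (\<lambda>y. J y (Y y)) z)
     - lie_bracket X Y z"

definition integrable_acs ::
  "('m, 'e::euclidean_space) chart set \<Rightarrow> ('m \<Rightarrow> 'm tvec \<Rightarrow> 'm tvec) \<Rightarrow> bool" where
  "integrable_acs B J \<longleftrightarrow>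
     (\<forall>\<kappa>\<in>B. \<forall>X Y. smooth_on (chart_image \<kappa>) X \<longrightarrow> smooth_on (chart_image \<kappa>) Y \<longrightarrow>
        (\<forall>z\<in>chart_image \<kappa>. nijenhuis (endo_in_chart B J \<kappa>) X Y z = 0))"

definition exterior_deriv2 :: "('e::euclidean_space \<Rightarrow> 'e \<Rightarrow> 'e \<Rightarrow> real) \<Rightarrow> 'e \<Rightarrow> 'e \<Rightarrow> 'e \<Rightarrow> 'e \<Rightarrow> real" where
  "exterior_deriv2 \<omega> z u v w =
     frechet_derivative (\<lambda>y. \<omega> y v w) (at z) u
     - frechet_derivative (\<lambda>y. \<omega> y u w) (at z) v
     + frechet_derivative (\<lambda>y. \<omega> y u v) (at z) w"

definition closed_2form ::
  "('m, 'e::euclidean_space) chart set \<Rightarrow> ('m \<Rightarrow> 'm tvec \<Rightarrow> 'm tvec \<Rightarrow> real) \<Rightarrow> bool" where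
  "closed_2form B \<omega> \<longleftrightarrow> (\<forall>\<kappa>\<in>B. \<forall>z\<in>chart_image \<kappa>. \<forall>u v w.
     exterior_deriv2 (form_in_chart B \<omega> \<kappa>) z u v w = 0)"

definition fundamental_form ::
  "'m metric_field \<Rightarrow> ('m \<Rightarrow> 'm tvec \<Rightarrow> 'm tvec) \<Rightarrow> 'm \<Rightarrow> 'm tvec \<Rightarrow> 'm tvec \<Rightarrow> real" where
  "fundamental_form G J x u v = G x u (J x v)"

text \<open>For a structure \<open>(G, J)\<close> that is already almost Hermitian.\<close>

definition kaehlerian ::
  "('m, 'e::euclidean_space) chart set \<Rightarrow> 'm metric_field \<Rightarrow> ('m \<Rightarrow> 'm tvec \<Rightarrow> 'm tvec) \<Rightarrow> bool" where
  "kaehlerian B G J \<longleftrightarrow> integrable_acs B J \<and> closed_2form B (fundamental_form G J)"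

end

theory Submission
  imports Defs
begin

text \<open>Everything is computed in an induced chart, with index-free notation.

  The vectors \<open>\<delta>\<^sub>i\<close> and \<open>J \<delta>\<^sub>i\<close> form a frame and the Nijenhuis tensor is conjugate linear, so \<open>J\<close> is
  integrable iff \<open>N(\<delta>\<^sub>i, \<delta>\<^sub>j) = 0\<close>. The horizontal part of \<open>N(\<delta>\<^sub>i, \<delta>\<^sub>j)\<close> is always zero, and its
  vertical part vanishes iff \<open>F(t) (p\<^sub>i g\<^sub>j\<^sub>h - p\<^sub>j g\<^sub>i\<^sub>h) = p\<^sub>k R\<^sup>k\<^sub>h\<^sub>i\<^sub>j\<close> with
  \<open>F = (a\<^sub>1 + 2 t b\<^sub>1) a\<^sub>1' - a\<^sub>1 b\<^sub>1\<close>. Since the right-hand side is linear in \<open>p\<close>, \<open>F\<close> is a constant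
  \<open>c\<close>, the curvature is the constant \<open>c\<close>, and \<open>F = c\<close> is the formula for \<open>b\<^sub>1\<close>.

  The fundamental form is \<open>\<phi> = \<lambda> dp\<^sub>i \<and> dq\<^sup>i + \<mu> dt \<and> p\<^sub>i dq\<^sup>i\<close>, whence
  \<open>d\<phi> = (\<lambda>' - \<mu>) dt \<and> dp\<^sub>i \<and> dq\<^sup>i\<close>, and for \<open>n > 1\<close> the last three-form vanishes only where \<open>dt\<close> does.\<close>

section \<open>Calculus\<close>

text \<open>The coefficient functions live on a closed half-line and have only one-sided derivatives
  at 0. Their compositions with t are still differentiable on the whole bundle, zero section
  included, because t never becomes negative. At p = 0, however, the conditions degenerate: both
  sides of the curvature identity vanish, and so does dt. Nothing is learned there about
  \<open>F\<close> or about \<mu> - \<lambda>' at t = 0, and these values are recovered from t > 0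
  by continuity. Dimension n > 1 supplies, for each p, a nonzero vector on which p (or dt) vanishes;
  it isolates the coefficient to be computed.

  The constant c is the value of \<open>F\<close>, an expression in the coefficients alone, so the
  same c serves every chart and every component of M.

  Division by zero yields 0, so the formula for b1 matches \<open>F\<close> = c only together with a
  nonvanishing denominator. That \<open>F\<close> = c forces this is not algebra but a consequence
  of a linear differential equation.

  The difference \<lambda>' - \<mu> arises because d(\<mu> dt \<and> \<theta>) = - \<mu> dt \<and>
  d\<theta> for the tautological form \<theta>: the derivative of \<mu> drops out against dt \<and>
  dt.\<close>

lemma C_k_on_cong:
  "(\<And>x. x \<in> S \<Longrightarrow> f x = g x) \<Longrightarrow> C_k_on k S f \<longleftrightarrow> C_k_on k S g"
proof (induction k arbitrary: f g)
  case 0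
  then show ?case by (simp cong: continuous_on_cong)
next
  case (Suc k)
  have deriv: "(f has_derivative D) (at x within S) \<longleftrightarrow> (g has_derivative D) (at x within S)"
    if "x \<in> S" for x D
    using Suc.prems that
    by (metis has_derivative_transform)
  \<comment> \<open>\<open>frechet_derivative\<close> is a choice among all derivatives, so equal
    sets of derivatives give equal values, even where derivatives are missing or not unique.\<close>
  have "frechet_derivative f (at x within S) = frechet_derivative g (at x within S)"
    if "x \<in> S" for x
    using deriv[OF that] by (simp add: frechet_derivative_def)
  then have "C_k_on k S (\<lambda>x. frechet_derivative f (at x within S) v) \<longleftrightarrow>
      C_k_on k S (\<lambda>x. frechet_derivative g (at x within S) v)" for v
    by (intro Suc.IH) simp
  moreover have "f differentiable_on S \<longleftrightarrow> g differentiable_on S"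
    using deriv by (simp add: differentiable_on_def differentiable_def)
  ultimately show ?case by simp
qed

lemma C_k_on_const: "open S \<Longrightarrow> C_k_on k S (\<lambda>x. c)"
proof (induction k arbitrary: c)
  case (Suc k)
  have "frechet_derivative (\<lambda>x. c) (at x within S) v = 0" if "x \<in> S" for x v
    using that Suc.prems by (simp add: at_within_open[of x S])
  then have "C_k_on k S (\<lambda>x. frechet_derivative (\<lambda>x. c) (at x within S) v)" for v
    using C_k_on_cong[of S "\<lambda>x. frechet_derivative (\<lambda>x. c) (at x within S) v" "\<lambda>_. 0" k]
      Suc.IH[OF Suc.prems] by simp
  then show ?case by (simp add: differentiable_on_const)
qed simp

lemma smooth_on_const: "open S \<Longrightarrow> smooth_on S (\<lambda>x. c)"
  by (simp add: smooth_on_def C_k_on_const)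

lemma smooth_on_cong: "(\<And>x. x \<in> S \<Longrightarrow> f x = g x) \<Longrightarrow> smooth_on S f \<longleftrightarrow> smooth_on S g"
  by (simp add: smooth_on_def C_k_on_cong[of S f g])

lemma smooth_on_bounded_linear:
  assumes "open S" "bounded_linear f" shows "smooth_on S f"
  unfolding smooth_on_def
proof
  fix k
  have d: "(f has_derivative f) (at x within S)" for x
    by (rule bounded_linear_imp_has_derivative[OF assms(2)])
  have "frechet_derivative f (at x within S) v = f v" if "x \<in> S" for x v
    using frechet_derivative_at[of f f x] bounded_linear_imp_has_derivative[OF assms(2)] that
      assms(1) by (metis at_within_open)
  then have "C_k_on k S (\<lambda>x. frechet_derivative f (at x within S) v)" for v k
    using C_k_on_cong[of S "\<lambda>x. frechet_derivative f (at x within S) v" "\<lambda>_. f v" k]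
      C_k_on_const[OF assms(1)] by simp
  moreover have "f differentiable_on S"
    using d by (auto simp: differentiable_on_def differentiable_def)
  ultimately show "C_k_on k S f"
    by (cases k) (auto intro: linear_continuous_on assms)
qed

lemma smooth_on_open_differentiable:
  assumes "smooth_on S f" "open S" "x \<in> S"
  shows "f differentiable (at x)"
  using assms C_k_on.simps(2)[of 0 S f] unfolding smooth_on_def differentiable_on_def
  by (metis at_within_open)

lemma smooth_on_open_differentiable2:
  assumes "smooth_on S f" "open S" "x \<in> S"
  shows "(\<lambda>y. frechet_derivative f (at y) v) differentiable (at x)"
proof -
  have "C_k_on (Suc (Suc 0)) S f" using assms(1) by (auto simp: smooth_on_def)
  then have "(\<lambda>y. frechet_derivative f (at y within S) v) differentiable_on S"
    by (auto simp del: C_k_on.simps(1) simp: C_k_on.simps(2))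
  then have "(\<lambda>y. frechet_derivative f (at y within S) v) differentiable (at x)"
    using assms(3) at_within_open[OF assms(3,2)] unfolding differentiable_on_def by metis
  moreover have "\<forall>\<^sub>F y in nhds x. frechet_derivative f (at y within S) v = frechet_derivative f (at y) v"
    using eventually_nhds_in_open[OF assms(2,3)]
    by eventually_elim (simp add: at_within_open[OF _ assms(2)])
  ultimately show ?thesis
    using assms unfolding differentiable_def
    by (metis (no_types, lifting) at_within_open has_derivative_transform_within_open)
qed

lemma smooth_on_halfline:
  fixes f :: "real \<Rightarrow> real"
  assumes "smooth_on {0..} f"
  shows "t \<ge> 0 \<Longrightarrow> (f has_real_derivative halfline_deriv f t) (at t within {0..})"
    and "continuous_on {0..} (halfline_deriv f)"
proof -
  have "C_k_on (Suc 0) {0..} f" using assms by (auto simp: smooth_on_def)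
  then have d: "f differentiable_on {0..}"
    and c: "continuous_on {0..} (\<lambda>x. frechet_derivative f (at x within {0..}) 1)"
    by auto
  \<comment> \<open>Nontriviality of the filter makes derivatives within the half-line unique; the
    right neighbourhoods give it also at the endpoint 0.\<close>
  have nb: "at t within {0..} \<noteq> bot" if "t \<ge> 0" for t :: real
  proof -
    have "at_right t \<le> at t within {0..}" using that by (intro at_le) auto
    then show ?thesis by (metis bot.extremum_uniqueI trivial_limit_at_right_real)
  qed
  have e: "(f has_vector_derivative frechet_derivative f (at t within {0..}) 1) (at t within {0..})"
    if "t \<ge> 0" for t
  proof -
    have D: "(f has_derivative frechet_derivative f (at t within {0..})) (at t within {0..})"
      using d that by (simp add: differentiable_on_def frechet_derivative_works)
    have lin: "frechet_derivative f (at t within {0..}) h =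
        h *\<^sub>R frechet_derivative f (at t within {0..}) 1" for h
      using linear_scale[OF has_derivative_linear[OF D], of h 1] by simp
    show ?thesis
      unfolding has_vector_derivative_def by (rule has_derivative_eq_rhs[OF D], rule ext, rule lin)
  qed
  then have h: "halfline_deriv f t = frechet_derivative f (at t within {0..}) 1" if "t \<ge> 0" for t
    unfolding halfline_deriv_def using nb that by (intro vector_derivative_within) auto
  show "t \<ge> 0 \<Longrightarrow> (f has_real_derivative halfline_deriv f t) (at t within {0..})"
    using e h by (simp add: has_real_derivative_iff_has_vector_derivative)
  show "continuous_on {0..} (halfline_deriv f)"
    using c h continuous_on_cong[of "{0..}" "{0..}" "halfline_deriv f"] by (metis atLeast_iff)
qed

text \<open>Integrating factor: \<open>h s * exp (- u s)\<close> with \<open>u\<close> a primitive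
  of \<open>k\<close> has derivative zero, so \<open>h\<close> keeps the sign of \<open>h 0\<close>.
  It will keep the denominator in the formula for b1 away from zero.\<close>

lemma linear_ode_positive:
  fixes h k :: "real \<Rightarrow> real"
  assumes deriv: "\<And>s. s \<ge> 0 \<Longrightarrow> (h has_real_derivative k s * h s) (at s within {0..})"
    and cont: "continuous_on {0..} k" and "h 0 > 0" and "t \<ge> 0"
  shows "h t > 0"
proof -
  define u where "u s = integral {0..s} k" for s
  have "(u has_real_derivative k s) (at s within {0..t})" if "s \<in> {0..t}" for s
    unfolding u_def has_real_derivative_iff_has_vector_derivative
    using that cont by (intro integral_has_vector_derivative)
      (auto intro: continuous_on_subset)
  moreover have "(h has_real_derivative k s * h s) (at s within {0..t})" if "s \<in> {0..t}" for s
    using deriv[of s] that by (auto intro: DERIV_subset)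
  ultimately have "((\<lambda>s. h s * exp (- u s)) has_real_derivative 0) (at s within {0..t})"
    if "s \<in> {0..t}" for s
    using that by (auto intro!: derivative_eq_intros)
  then have "((\<lambda>s. h s * exp (- u s)) has_derivative (\<lambda>_. 0)) (at s within {0..t})"
    if "s \<in> {0..t}" for s
    using that unfolding has_field_derivative_def by (simp add: lambda_zero)
  then have "\<exists>c. \<forall>s\<in>{0..t}. h s * exp (- u s) = c"
    by (intro has_derivative_zero_constant) auto
  then have "h t * exp (- u t) = h 0 * exp (- u 0)"
    using \<open>t \<ge> 0\<close> by force
  then show ?thesis using \<open>h 0 > 0\<close>
    by (metis exp_gt_zero mult_pos_pos zero_less_mult_pos2)
qed

section \<open>Determinants and inverse matrices depending on a parameter\<close>

lemma det_differentiable: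
  fixes M :: "'a::real_normed_vector \<Rightarrow> real^'n^'n"
  assumes "\<And>i j. (\<lambda>y. M y $ i $ j) differentiable (at x)"
  shows "(\<lambda>y. det (M y)) differentiable (at x)"
proof -
  obtain D where D: "\<And>i j. ((\<lambda>y. M y $ i $ j) has_derivative D i j) (at x)"
    using assms unfolding differentiable_def by metis
  have "(\<lambda>y. \<Prod>i\<in>UNIV. M y $ i $ (p i)) differentiable (at x)" for p :: "'n \<Rightarrow> 'n"
    unfolding differentiable_def
    using has_derivative_prod[of UNIV "\<lambda>i y. M y $ i $ p i" "\<lambda>i. D i (p i)"] D by blast
  then show ?thesis
    unfolding det_def by (intro differentiable_sum) (auto intro!: derivative_intros)
qed

lemma vec_nth_differentiable:
  "M differentiable F \<Longrightarrow> (\<lambda>y. M y $ i) differentiable F"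
  unfolding differentiable_def
  using bounded_linear.has_derivative[OF bounded_linear_vec_nth] by blast

lemma vec_lambda_differentiable:
  fixes f :: "'a::real_normed_vector \<Rightarrow> 'i::finite \<Rightarrow> 'b::euclidean_space"
  assumes "\<And>i. (\<lambda>y. f y i) differentiable (at x)"
  shows "(\<lambda>y. \<chi> i. f y i) differentiable (at x)"
  unfolding differentiable_componentwise_within[where f="\<lambda>y. \<chi> i. f y i"]
proof
  fix b :: "'b^'i" assume "b \<in> Basis"
  then obtain i c where "b = axis i c" by (auto simp: Basis_vec_def)
  then have "(\<lambda>y. (\<chi> i. f y i) \<bullet> b) = (\<lambda>y. f y i \<bullet> c)"
    by (simp add: inner_axis)
  then show "(\<lambda>y. (\<chi> i. f y i) \<bullet> b) differentiable (at x)"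
    using assms[of i] by (auto intro: differentiable_inner)
qed

lemma matrix_inv_inverse:
  assumes "invertible A"
  shows "A ** matrix_inv A = mat 1" "matrix_inv A ** A = mat 1"
  using someI_ex[OF assms[unfolded invertible_def]] by (auto simp: matrix_inv_def)

lemma matrix_inv_cramer:
  fixes A :: "real^'n^'n"
  assumes "invertible A"
  shows "matrix_inv A $ k $ l = det (\<chi> i j. if j = k then axis l 1 $ i else A $ i $ j) / det A"
proof -
  have "A *v (matrix_inv A *v axis l 1) = axis l 1"
    using assms by (simp add: matrix_inv_inverse matrix_vector_mul_assoc)
  then have "matrix_inv A *v axis l 1 =
      (\<chi> k. det (\<chi> i j. if j = k then axis l 1 $ i else A $ i $ j) / det A)"
    using assms by (subst (asm) cramer) (auto simp: invertible_det_nz)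
  then show ?thesis
    by (metis (no_types, lifting) column_def matrix_vector_mul_component matrix_vector_mult_basis vec_lambda_beta)
qed

text \<open>By Cramer's rule the entries of the inverse are quotients of determinants in the entries
  of \<open>M\<close>. Invertibility on an open set makes this identity hold near
  \<open>x\<close>.\<close>

lemma matrix_inv_differentiable:
  fixes M :: "'a::real_normed_vector \<Rightarrow> real^'n^'n"
  assumes M: "M differentiable (at x)" and S: "open S" "x \<in> S" "\<And>y. y \<in> S \<Longrightarrow> invertible (M y)"
  shows "(\<lambda>y. matrix_inv (M y)) differentiable (at x)"
proof -
  have entry: "(\<lambda>y. M y $ i $ j) differentiable (at x)" for i j
    by (intro vec_nth_differentiable M)
  have "(\<lambda>y. \<chi> k l. det (\<chi> i j. if j = k then axis l 1 $ i else M y $ i $ j) / det (M y))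
      differentiable (at x)"
  proof (intro vec_lambda_differentiable differentiable_divide det_differentiable)
    show "(\<lambda>y. (\<chi> i j. if j = k then axis l 1 $ i else M y $ i $ j) $ i $ j) differentiable (at x)"
      for k l i j :: 'n
      by (cases "j = k") (simp_all add: entry)
  qed (use S in \<open>auto simp: entry invertible_det_nz\<close>)
  moreover have "(\<chi> k l. det (\<chi> i j. if j = k then axis l 1 $ i else M y $ i $ j) / det (M y)) =
      matrix_inv (M y)" if "y \<in> S" for y
    using matrix_inv_cramer[OF S(3)[OF that]] by (simp add: vec_eq_iff)
  ultimately show ?thesis
    using S(1,2) unfolding differentiable_def
    by (metis (no_types, lifting) has_derivative_transform_within_open)
qed

text \<open>The mean value theorem in direction \<open>u\<close> turns the second difference into
  \<open>s\<close> times a difference of values of \<open>f' _ u\<close>; differentiability of that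
  function at the single point \<open>z\<close> then gives the limit.\<close>

lemma second_difference_limit:
  fixes f :: "'a::real_inner \<Rightarrow> real"
  assumes S: "open S" "z \<in> S"
    and f: "\<And>y. y \<in> S \<Longrightarrow> (f has_derivative f' y) (at y)"
    and f': "((\<lambda>y. f' y u) has_derivative f'') (at z)"
  shows "((\<lambda>s. (f (z + s *\<^sub>R u + s *\<^sub>R v) - f (z + s *\<^sub>R u) - f (z + s *\<^sub>R v) + f z) / s\<^sup>2)
    \<longlongrightarrow> f'' v) (at_right 0)"
proof (rule tendstoI)
  fix e :: real assume "e > 0"
  define m where "m = norm u + norm v + 1"
  have m: "m > 0" by (auto simp: m_def add_nonneg_pos)
  interpret D: linear f'' using f' by (rule has_derivative_linear)
  \<comment> \<open>Two linearization errors of size \<open>e' * (s * m)\<close> occur, together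
    \<open>e * s / 2\<close>, which stays below \<open>e\<close> after division by
    \<open>s\<close>.\<close>
  define e' where "e' = e / (4 * m)"
  have e': "e' > 0" using \<open>e > 0\<close> m by (simp add: e'_def)
  obtain d1 where d1: "d1 > 0" "\<And>y. norm (y - z) < d1 \<Longrightarrow>
      norm (f' y u - f' z u - f'' (y - z)) \<le> e' * norm (y - z)"
    using f' e' unfolding has_derivative_at_alt by blast
  obtain d2 where d2: "d2 > 0" "ball z d2 \<subseteq> S" using S openE by blast
  define d where "d = min d1 d2 / m"
  have d: "d > 0" using d1 d2 m by (simp add: d_def)
  have est: "dist ((f (z + s *\<^sub>R u + s *\<^sub>R v) - f (z + s *\<^sub>R u) - f (z + s *\<^sub>R v) + f z) / s\<^sup>2) (f'' v) < e"
    if s: "0 < s" "s < d" for s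
  proof -
    have sm: "s * m < min d1 d2" using s m by (simp add: d_def field_simps)
    have bound: "norm (r *\<^sub>R u + s' *\<^sub>R v) \<le> s * m" if "0 \<le> r" "r \<le> s" "0 \<le> s'" "s' \<le> s" for r s'
    proof -
      have "norm (r *\<^sub>R u + s' *\<^sub>R v) \<le> r * norm u + s' * norm v"
        using that by (intro order.trans[OF norm_triangle_ineq]) simp
      also have "\<dots> \<le> s * norm u + s * norm v"
        using that by (intro add_mono mult_right_mono) auto
      also have "\<dots> \<le> s * m" using s by (simp add: m_def algebra_simps)
      finally show ?thesis .
    qed
    have inS: "z + r *\<^sub>R u + s' *\<^sub>R v \<in> S" if "0 \<le> r" "r \<le> s" "0 \<le> s'" "s' \<le> s" for r s'
    proof -
      have "dist z (z + r *\<^sub>R u + s' *\<^sub>R v) = norm (r *\<^sub>R u + s' *\<^sub>R v)"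
        by (metis add.assoc add_diff_cancel_left' dist_commute dist_norm)
      then show ?thesis using bound[OF that] sm d2(2) by (auto simp: mem_ball)
    qed
    define \<psi> where "\<psi> r = f (z + r *\<^sub>R u + s *\<^sub>R v) - f (z + r *\<^sub>R u)" for r
    have "(\<psi> has_real_derivative f' (z + r *\<^sub>R u + s *\<^sub>R v) u - f' (z + r *\<^sub>R u) u) (at r)"
      if "0 \<le> r" "r \<le> s" for r
    proof -
      have "((\<lambda>r. f (z + r *\<^sub>R u + w)) has_derivative (\<lambda>h. f' (z + r *\<^sub>R u + w) (h *\<^sub>R u))) (at r)"
        if "z + r *\<^sub>R u + w \<in> S" for w
        by (rule has_derivative_compose[where f="\<lambda>r. z + r *\<^sub>R u + w", OF _ f[OF that]])
          (auto intro!: derivative_eq_intros)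
      from this[of "s *\<^sub>R v"] this[of 0] show ?thesis
        using inS[of r s] inS[of r 0] that s
          has_derivative_linear[OF f[of "z + r *\<^sub>R u + s *\<^sub>R v"]] has_derivative_linear[OF f[of "z + r *\<^sub>R u"]]
        unfolding \<psi>_def has_field_derivative_def
        by (auto intro!: derivative_eq_intros simp: linear_scale fun_eq_iff algebra_simps)
    qed
    then obtain r where r: "0 < r" "r < s"
      and "\<psi> s - \<psi> 0 = (s - 0) * (f' (z + r *\<^sub>R u + s *\<^sub>R v) u - f' (z + r *\<^sub>R u) u)"
      using MVT2[OF s(1), of \<psi> "\<lambda>r. f' (z + r *\<^sub>R u + s *\<^sub>R v) u - f' (z + r *\<^sub>R u) u"] by auto
    then have eq: "f (z + s *\<^sub>R u + s *\<^sub>R v) - f (z + s *\<^sub>R u) - f (z + s *\<^sub>R v) + f z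
        = s * (f' (z + r *\<^sub>R u + s *\<^sub>R v) u - f' (z + r *\<^sub>R u) u)"
      by (simp add: \<psi>_def)
    have 1: "norm (f' (z + r *\<^sub>R u + s' *\<^sub>R v) u - f' z u - f'' (r *\<^sub>R u + s' *\<^sub>R v)) \<le> e' * (s * m)"
      if "0 \<le> s'" "s' \<le> s" for s'
    proof -
      have "norm (f' (z + r *\<^sub>R u + s' *\<^sub>R v) u - f' z u - f'' (r *\<^sub>R u + s' *\<^sub>R v)) \<le> e' * norm (r *\<^sub>R u + s' *\<^sub>R v)"
        using d1(2)[of "z + r *\<^sub>R u + s' *\<^sub>R v"] bound[of r s'] r that sm by (simp add: add.assoc)
      also have "\<dots> \<le> e' * (s * m)"
        using bound[of r s'] r that e' by (intro mult_left_mono) auto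
      finally show ?thesis .
    qed
    have "\<bar>f' (z + r *\<^sub>R u + s *\<^sub>R v) u - f' (z + r *\<^sub>R u) u - s * f'' v\<bar> \<le> 2 * (e' * (s * m))"
      using 1[of s] 1[of 0] s by (simp add: D.add D.scale abs_le_iff)
    also have "2 * (e' * (s * m)) < e * s"
      using s \<open>e > 0\<close> m by (simp add: e'_def field_simps)
    finally have "\<bar>f' (z + r *\<^sub>R u + s *\<^sub>R v) u - f' (z + r *\<^sub>R u) u - s * f'' v\<bar> / s < e"
      using s by (simp add: field_simps)
    moreover have "\<bar>f' (z + r *\<^sub>R u + s *\<^sub>R v) u - f' (z + r *\<^sub>R u) u - s * f'' v\<bar> / s
        = \<bar>s * (f' (z + r *\<^sub>R u + s *\<^sub>R v) u - f' (z + r *\<^sub>R u) u) / s\<^sup>2 - f'' v\<bar>"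
    proof -
      have "s * a / s\<^sup>2 - b = (a - s * b) / s" for a b
        using s by (simp add: power2_eq_square field_simps)
      then show ?thesis using s by (simp add: abs_divide)
    qed
    ultimately show ?thesis unfolding eq dist_real_def by simp
  qed
  then show "\<forall>\<^sub>F s in at_right 0. dist ((f (z + s *\<^sub>R u + s *\<^sub>R v) - f (z + s *\<^sub>R u) - f (z + s *\<^sub>R v) + f z) / s\<^sup>2) (f'' v) < e"
    unfolding eventually_at_right_field using d by (intro exI[of _ d]) auto
qed

text \<open>The second difference is symmetric in \<open>u\<close> and \<open>v\<close>, so its two
  limits agree. Differentiability at \<open>z\<close> of the two directional derivatives is all the
  regularity required of them.\<close>

lemma second_derivative_symmetric:
  fixes f :: "'a::real_inner \<Rightarrow> real"
  assumes S: "open S" "z \<in> S"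
    and f: "\<And>y. y \<in> S \<Longrightarrow> (f has_derivative f' y) (at y)"
    and u: "((\<lambda>y. f' y u) has_derivative Du) (at z)"
    and v: "((\<lambda>y. f' y v) has_derivative Dv) (at z)"
  shows "Du v = Dv u"
proof -
  have "((\<lambda>s. (f (z + s *\<^sub>R u + s *\<^sub>R v) - f (z + s *\<^sub>R u) - f (z + s *\<^sub>R v) + f z) / s\<^sup>2) \<longlongrightarrow> Dv u) (at_right 0)"
    using second_difference_limit[OF S f v, of u] by (simp add: algebra_simps)
  then show ?thesis
    using second_difference_limit[OF S f u, of v] tendsto_unique[OF trivial_limit_at_right_real] by blast
qed

lemma halfline_compose_has_derivative:
  fixes f :: "real \<Rightarrow> real"
  assumes f: "(f has_real_derivative d) (at (e z) within {0..})"
    and e: "(e has_derivative e') (at z)"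
    and T: "open T" "z \<in> T" "\<And>y. y \<in> T \<Longrightarrow> e y \<ge> 0"
  shows "((\<lambda>z. f (e z)) has_derivative (\<lambda>v. d * e' v)) (at z)"
proof -
  have "(f has_derivative (*) d) (at (e z) within {0..})"
    using f by (simp add: has_field_derivative_def)
  then have "(f has_derivative (*) d) (at (e z) within e ` T)"
    by (rule has_derivative_subset) (use T(3) in auto)
  from has_derivative_in_compose[OF has_derivative_at_withinI[OF e] this]
  show ?thesis using T by (simp add: at_within_open[of z T])
qed

text \<open>Product rule for a family of linear maps of which only the values on fixed vectors are
  known to be differentiable; expanding the argument in a finite basis reduces it to these.\<close>

lemma linear_family_has_derivative:
  fixes L :: "'a::real_normed_vector \<Rightarrow> 'b::euclidean_space \<Rightarrow> 'c::real_normed_vector"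
  assumes T: "open T" "z \<in> T" and lin: "\<And>y. y \<in> T \<Longrightarrow> linear (L y)"
    and L: "\<And>v. ((\<lambda>y. L y v) has_derivative (\<lambda>d. DL d v)) (at z)"
    and X: "(X has_derivative X') (at z)"
  shows "((\<lambda>y. L y (X y)) has_derivative (\<lambda>d. DL d (X z) + L z (X' d))) (at z)"
proof -
  have expand: "L y v = (\<Sum>b\<in>Basis. (v \<bullet> b) *\<^sub>R L y b)" if "y \<in> T" for y v
    using linear_sum[OF lin[OF that], of "\<lambda>b. (v \<bullet> b) *\<^sub>R b" Basis] linear_scale[OF lin[OF that]]
    by (simp add: euclidean_representation)
  have "((\<lambda>y. \<Sum>b\<in>Basis. (v \<bullet> b) *\<^sub>R L y b) has_derivative (\<lambda>d. \<Sum>b\<in>Basis. (v \<bullet> b) *\<^sub>R DL d b)) (at z)" for v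
    by (intro derivative_intros L)
  then have "((\<lambda>y. L y v) has_derivative (\<lambda>d. \<Sum>b\<in>Basis. (v \<bullet> b) *\<^sub>R DL d b)) (at z)" for v
    by (rule has_derivative_transform_within_open[OF _ T]) (simp add: expand[symmetric])
  from has_derivative_unique[OF L this]
  have DL: "DL d v = (\<Sum>b\<in>Basis. (v \<bullet> b) *\<^sub>R DL d b)" for d v by meson
  have "((\<lambda>y. \<Sum>b\<in>Basis. (X y \<bullet> b) *\<^sub>R L y b) has_derivative
      (\<lambda>d. \<Sum>b\<in>Basis. (X z \<bullet> b) *\<^sub>R DL d b + (X' d \<bullet> b) *\<^sub>R L z b)) (at z)"
    by (rule derivative_eq_intros L X refl)+ simp
  then have "((\<lambda>y. L y (X y)) has_derivative
      (\<lambda>d. \<Sum>b\<in>Basis. (X z \<bullet> b) *\<^sub>R DL d b + (X' d \<bullet> b) *\<^sub>R L z b)) (at z)"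
    by (rule has_derivative_transform_within_open[OF _ T]) (simp add: expand[symmetric])
  then show ?thesis
    by (rule has_derivative_eq_rhs)
      (simp add: fun_eq_iff sum.distrib DL[of _ "X z"] expand[OF T(2), of "X' _"])
qed

lemma linear_family_derivative_linear:
  fixes L :: "'a::real_normed_vector \<Rightarrow> 'b::euclidean_space \<Rightarrow> 'c::real_normed_vector"
  assumes T: "open T" "z \<in> T" and lin: "\<And>y. y \<in> T \<Longrightarrow> linear (L y)"
    and L: "\<And>v. ((\<lambda>y. L y v) has_derivative (\<lambda>d. DL d v)) (at z)"
  shows "linear (DL d)"
proof (rule linearI)
  fix u v and c :: real
  have "((\<lambda>y. L y u + L y v) has_derivative (\<lambda>d. DL d u + DL d v)) (at z)"
    by (intro derivative_intros L)
  then have "((\<lambda>y. L y (u + v)) has_derivative (\<lambda>d. DL d u + DL d v)) (at z)"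
    by (rule has_derivative_transform_within_open[OF _ T]) (simp add: linear_add[OF lin])
  from has_derivative_unique[OF L this] show "DL d (u + v) = DL d u + DL d v" by meson
  have "((\<lambda>y. c *\<^sub>R L y u) has_derivative (\<lambda>d. c *\<^sub>R DL d u)) (at z)"
    by (intro derivative_intros L)
  then have "((\<lambda>y. L y (c *\<^sub>R u)) has_derivative (\<lambda>d. c *\<^sub>R DL d u)) (at z)"
    by (rule has_derivative_transform_within_open[OF _ T]) (simp add: linear_scale[OF lin])
  from has_derivative_unique[OF L this] show "DL d (c *\<^sub>R u) = c *\<^sub>R DL d u" by meson
qed

section \<open>Christoffel symbols and curvature in coordinates\<close>

lemma bounded_bilinear_matrix_vector: "bounded_bilinear ((*v) :: real^'n^'m \<Rightarrow> real^'n \<Rightarrow> real^'m)"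
  by (simp flip: bilinear_conv_bounded_bilinear
      add: bilinear_def linear_iff algebra_simps scaleR_matrix_vector_assoc)

lemmas has_derivative_matrix_vector [derivative_intros] =
  bounded_bilinear.FDERIV[OF bounded_bilinear_matrix_vector]

lemma inner_matrix_symmetric:
  fixes M :: "real^'n^'n"
  assumes "\<And>i j. M $ i $ j = M $ j $ i"
  shows "x \<bullet> (M *v y) = (M *v x) \<bullet> y"
proof -
  have "transpose M = M" using assms by (simp add: transpose_def vec_eq_iff)
  then show ?thesis by (metis dot_lmul_matrix transpose_matrix_vector)
qed

lemma inner_eqI: "(\<And>w. x \<bullet> w = y \<bullet> w) \<Longrightarrow> x = y"
  using vector_eq_rdot[of x y] by blast

lemma uminus_matrix_vector: "(- A) *v x = - (A *v (x::real^'n))"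
  using matrix_vector_mult_diff_rdistrib[of 0 A x] by simp

lemma frechet_derivative_eqI: "(f has_derivative f') (at x) \<Longrightarrow> frechet_derivative f (at x) = f'"
  by (metis frechet_derivative_at)

lemma linear_axis_expand:
  fixes L :: "real^'n \<Rightarrow> real"
  assumes "linear L" shows "L w = (\<Sum>i\<in>UNIV. w $ i * L (axis i 1))"
proof -
  have "L w = L (\<Sum>i\<in>UNIV. (w $ i) *\<^sub>R axis i 1)"
    by (simp add: basis_expansion flip: scalar_mult_eq_scaleR)
  also have "\<dots> = (\<Sum>i\<in>UNIV. w $ i * L (axis i 1))"
    by (simp add: linear_sum[OF assms] linear_scale[OF assms])
  finally show ?thesis .
qed

text \<open>The Riesz vector of a linear form. Vectors defined by components, such as
  \<open>K\<close> and \<open>GamP\<close>, are afterwards handled only through their inner products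
  with arbitrary vectors.\<close>

lemma linear_inner_expand:
  fixes L :: "real^'n \<Rightarrow> real"
  assumes "linear L" shows "(\<chi> l. L (axis l 1)) \<bullet> w = L w"
  using linear_axis_expand[OF assms, of w] by (simp add: inner_vec_def mult.commute)

text \<open>The polarization argument showing that sectional curvatures determine the curvature tensor.\<close>

lemma curvature_like_zero:
  fixes T :: "'a::ab_group_add \<Rightarrow> 'a \<Rightarrow> 'a \<Rightarrow> 'a \<Rightarrow> real"
  assumes add1: "\<And>a b v w x. T (a + b) v w x = T a v w x + T b v w x"
    and add2: "\<And>u a b w x. T u (a + b) w x = T u a w x + T u b w x"
    and anti: "\<And>u v w x. T u v w x = - T v u w x"
    and skew: "\<And>u v w x. T u v w x = - T u v x w"
    and bianchi: "\<And>u v w x. T u v w x + T v w u x + T w u v x = 0"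
    and sec: "\<And>u v. T u v v u = 0"
  shows "T u v w x = 0"
proof -
  \<comment> \<open>The octahedron argument: four instances of the Bianchi identity, combined using
    both antisymmetries.\<close>
  have pair: "T u v w x = T w x u v" for u v w x
    using bianchi[of u v w x] bianchi[of v w x u] bianchi[of w x u v] bianchi[of x u v w]
      skew[of v w x u] skew[of w x v u] anti[of x v w u] anti[of x u w v] skew[of u x w v]
      anti[of u w x v] skew[of w u x v] anti[of x u v w] skew[of u v x w] skew[of v x u w]
    by linarith
  have add3: "T u v (a + b) x = T u v a x + T u v b x" for u v a b x
    using pair[of u v "a + b" x] pair[of u v a x] pair[of u v b x] add1 by simp
  have add4: "T u v w (a + b) = T u v w a + T u v w b" for u v w a b
    using pair[of u v w "a + b"] pair[of u v w a] pair[of u v w b] add2 by simp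
  \<comment> \<open>Polarize \<open>sec\<close> in the outer slots; by pair symmetry the two mixed
    terms are equal, so each of them is zero.\<close>
  have s1: "T u v v x = 0" for u v x
  proof -
    have "T u v v x + T x v v u = 0"
      using sec[of "u + x" v] sec[of u v] sec[of x v] by (simp add: add1 add4)
    moreover have "T x v v u = T u v v x"
      using pair[of x v v u] anti[of v u x v] skew[of u v x v] by simp
    ultimately show ?thesis by simp
  qed
  have s2: "T u v w x = - T u w v x" for u v w x
    using s1[of u "v + w" x] s1[of u v x] s1[of u w x] by (simp add: add2 add3)
  \<comment> \<open>Now \<open>T\<close> is alternating in its first three arguments, so the three
    terms of the Bianchi identity coincide and 3 \<open>T\<close> = 0.\<close>
  show ?thesis
    using bianchi[of u v w x] s2[of v w u x] anti[of v u w x] anti[of w u v x] s2[of u w v x] by simp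
qed

text \<open>Models one coordinate domain with its metric matrix. Curvature involves two derivatives
  of the metric, and exactly this much regularity is recorded.\<close>

locale metric_coords =
  fixes S :: "(real^'n) set" and gm :: "real^'n \<Rightarrow> real^'n^'n"
  assumes open_S: "open S"
    and gm_differentiable: "q \<in> S \<Longrightarrow> gm differentiable (at q)"
    and gm_differentiable2: "q \<in> S \<Longrightarrow> (\<lambda>y. frechet_derivative gm (at y) u) differentiable (at q)"
    and gm_symmetric: "q \<in> S \<Longrightarrow> gm q $ i $ j = gm q $ j $ i"
    and gm_positive: "q \<in> S \<Longrightarrow> x \<noteq> 0 \<Longrightarrow> x \<bullet> (gm q *v x) > 0"
begin

definition Dg :: "real^'n \<Rightarrow> real^'n \<Rightarrow> real^'n^'n" where
  "Dg q u = frechet_derivative gm (at q) u"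

definition D2g :: "real^'n \<Rightarrow> real^'n \<Rightarrow> real^'n \<Rightarrow> real^'n^'n" where
  "D2g q d u = frechet_derivative (\<lambda>y. Dg y u) (at q) d"

definition gi :: "real^'n \<Rightarrow> real^'n^'n" where
  "gi q = matrix_inv (gm q)"

lemma gm_has_derivative: "q \<in> S \<Longrightarrow> (gm has_derivative Dg q) (at q)"
  unfolding Dg_def using gm_differentiable frechet_derivative_works by blast

lemma Dg_has_derivative: "q \<in> S \<Longrightarrow> ((\<lambda>y. Dg y u) has_derivative (\<lambda>d. D2g q d u)) (at q)"
  unfolding Dg_def D2g_def using gm_differentiable2 frechet_derivative_works by blast

lemma linear_Dg: "q \<in> S \<Longrightarrow> linear (Dg q)"
  using gm_has_derivative has_derivative_linear by blast

lemma linear_D2g2: "q \<in> S \<Longrightarrow> linear (D2g q d)"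
  by (rule linear_family_derivative_linear[OF open_S _ linear_Dg Dg_has_derivative])

lemma gm_inner: "q \<in> S \<Longrightarrow> x \<bullet> (gm q *v y) = y \<bullet> (gm q *v x)"
  using inner_matrix_symmetric[of "gm q" x y] gm_symmetric by (simp add: inner_commute)

lemma Dg_inner:
  assumes q: "q \<in> S" shows "x \<bullet> (Dg q u *v y) = y \<bullet> (Dg q u *v x)"
proof -
  have d: "((\<lambda>z. x \<bullet> (gm z *v y)) has_derivative (\<lambda>u. x \<bullet> (Dg q u *v y))) (at q)" for x y
    by (auto intro!: derivative_eq_intros gm_has_derivative q)
  have "((\<lambda>z. x \<bullet> (gm z *v y)) has_derivative (\<lambda>u. y \<bullet> (Dg q u *v x))) (at q)"
    by (rule has_derivative_transform_within_open[OF d open_S q]) (simp add: gm_inner)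
  from has_derivative_unique[OF d this] show ?thesis by metis
qed

lemma D2g_inner:
  assumes q: "q \<in> S" shows "x \<bullet> (D2g q d u *v y) = y \<bullet> (D2g q d u *v x)"
proof -
  have d: "((\<lambda>z. x \<bullet> (Dg z u *v y)) has_derivative (\<lambda>d. x \<bullet> (D2g q d u *v y))) (at q)" for x y
    by (auto intro!: derivative_eq_intros Dg_has_derivative q)
  have "((\<lambda>z. x \<bullet> (Dg z u *v y)) has_derivative (\<lambda>d. y \<bullet> (D2g q d u *v x))) (at q)"
    by (rule has_derivative_transform_within_open[OF d open_S q]) (simp add: Dg_inner)
  from has_derivative_unique[OF d this] show ?thesis by metis
qed

lemma D2g_commute:
  assumes q: "q \<in> S" shows "x \<bullet> (D2g q d u *v y) = x \<bullet> (D2g q u d *v y)"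
proof -
  have d: "((\<lambda>z. x \<bullet> (Dg z u *v y)) has_derivative (\<lambda>d. x \<bullet> (D2g q d u *v y))) (at q)" for u
    by (auto intro!: derivative_eq_intros Dg_has_derivative q)
  have "((\<lambda>z. x \<bullet> (gm z *v y)) has_derivative (\<lambda>u. x \<bullet> (Dg q u *v y))) (at q)" if "q \<in> S" for q
    by (auto intro!: derivative_eq_intros gm_has_derivative that)
  from second_derivative_symmetric[OF open_S q this d d] show ?thesis by metis
qed

section \<open>The inverse metric and its derivative\<close>

lemma gm_invertible:
  assumes "q \<in> S" shows "invertible (gm q)"
proof -
  have "x = 0" if "gm q *v x = 0" for x
    using gm_positive[OF assms, of x] that by force
  then have "\<exists>B. B ** gm q = mat 1"
    by (simp add: matrix_left_invertible_ker)
  then show ?thesis by (simp add: invertible_left_inverse)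
qed

lemma gm_gi: "q \<in> S \<Longrightarrow> gm q *v (gi q *v x) = x"
  and gi_gm: "q \<in> S \<Longrightarrow> gi q *v (gm q *v x) = x"
  using matrix_inv_inverse[OF gm_invertible] by (simp_all add: gi_def matrix_vector_mul_assoc)

lemma gi_inner:
  assumes "q \<in> S" shows "x \<bullet> (gi q *v y) = y \<bullet> (gi q *v x)"
  using gm_inner[OF assms, of "gi q *v x" "gi q *v y"] by (simp add: gm_gi assms inner_commute)

lemma gi_positive: "q \<in> S \<Longrightarrow> x \<noteq> 0 \<Longrightarrow> x \<bullet> (gi q *v x) > 0"
  using gm_positive[of q "gi q *v x"] gm_gi[of q x]
  by (metis inner_commute matrix_vector_mult_0_right)

lemma gi_differentiable: "q \<in> S \<Longrightarrow> gi differentiable (at q)"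
  unfolding gi_def using matrix_inv_differentiable[OF gm_differentiable open_S] gm_invertible
  by blast

text \<open>Once the inverse is known to be differentiable, differentiating
  \<open>gm y *v (gi y *v p) = p\<close> determines its derivative.\<close>

lemma gi_has_derivative:
  assumes q: "q \<in> S"
  shows "(gi has_derivative (\<lambda>d. - (gi q ** Dg q d ** gi q))) (at q)"
proof -
  obtain D where D: "(gi has_derivative D) (at q)"
    using gi_differentiable[OF q] by (auto simp: differentiable_def)
  have "D d *v p = - (gi q ** Dg q d ** gi q) *v p" for d p
  proof -
    have "((\<lambda>y. gm y *v (gi y *v p)) has_derivative
        (\<lambda>d. gm q *v (D d *v p) + Dg q d *v (gi q *v p))) (at q)"
      by (auto intro!: derivative_eq_intros D gm_has_derivative q)
    moreover have "((\<lambda>y. gm y *v (gi y *v p)) has_derivative (\<lambda>d. 0)) (at q)"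
      by (rule has_derivative_transform_within_open[OF has_derivative_const[of p] open_S q])
        (simp add: gm_gi)
    ultimately have "(\<lambda>d. gm q *v (D d *v p) + Dg q d *v (gi q *v p)) = (\<lambda>d. 0)"
      by (rule has_derivative_unique)
    from fun_cong[OF this, of d] have "gm q *v (D d *v p) = - (Dg q d *v (gi q *v p))"
      by (simp add: eq_neg_iff_add_eq_0)
    then have "D d *v p = gi q *v - (Dg q d *v (gi q *v p))"
      using gi_gm[OF q, of "D d *v p"] by simp
    also have "\<dots> = - (gi q *v (Dg q d *v (gi q *v p)))"
      by (rule linear_neg[OF matrix_vector_mul_linear])
    finally show ?thesis
      by (simp add: uminus_matrix_vector flip: matrix_vector_mul_assoc)
  qed
  then have "D = (\<lambda>d. - (gi q ** Dg q d ** gi q))"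
    by (simp add: matrix_eq fun_eq_iff)
  with D show ?thesis by simp
qed

text \<open>\<open>K q u v\<close> and \<open>Gam q u v\<close> are the Christoffel symbols of the first and second kind,
  contracted with \<open>u\<close> and \<open>v\<close>.\<close>

definition K :: "real^'n \<Rightarrow> real^'n \<Rightarrow> real^'n \<Rightarrow> real^'n" where
  "K q u v = (1/2) *\<^sub>R (Dg q u *v v + Dg q v *v u - (\<chi> l. v \<bullet> (Dg q (axis l 1) *v u)))"

definition DK :: "real^'n \<Rightarrow> real^'n \<Rightarrow> real^'n \<Rightarrow> real^'n \<Rightarrow> real^'n" where
  "DK q d u v = (1/2) *\<^sub>R (D2g q d u *v v + D2g q d v *v u - (\<chi> l. v \<bullet> (D2g q d (axis l 1) *v u)))"

definition Gam :: "real^'n \<Rightarrow> real^'n \<Rightarrow> real^'n \<Rightarrow> real^'n" where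
  "Gam q u v = gi q *v K q u v"

text \<open>The formula is what differentiating \<open>gm q *v Gam q u v = K q u v\<close> in
  direction \<open>d\<close>, and solving for the derivative of \<open>Gam\<close>, gives.\<close>

definition DGam :: "real^'n \<Rightarrow> real^'n \<Rightarrow> real^'n \<Rightarrow> real^'n \<Rightarrow> real^'n" where
  "DGam q d u v = gi q *v (DK q d u v - Dg q d *v Gam q u v)"

definition Riem :: "real^'n \<Rightarrow> real^'n \<Rightarrow> real^'n \<Rightarrow> real^'n \<Rightarrow> real^'n" where
  "Riem q u v w = DGam q u v w - DGam q v u w + Gam q u (Gam q v w) - Gam q v (Gam q u w)"

lemma linear_Dg_inner: "q \<in> S \<Longrightarrow> linear (\<lambda>w. v \<bullet> (Dg q w *v u))"
  by (auto intro!: linearI simp: linear_add[OF linear_Dg] linear_scale[OF linear_Dg] algebra_simps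
     simp flip: scaleR_matrix_vector_assoc)

lemma linear_D2g_inner: "q \<in> S \<Longrightarrow> linear (\<lambda>w. v \<bullet> (D2g q d w *v u))"
  by (auto intro!: linearI simp: linear_add[OF linear_D2g2] linear_scale[OF linear_D2g2] algebra_simps
     simp flip: scaleR_matrix_vector_assoc)

lemma K_inner:
  assumes "q \<in> S"
  shows "K q u v \<bullet> w = (1/2) * (w \<bullet> (Dg q u *v v) + w \<bullet> (Dg q v *v u) - v \<bullet> (Dg q w *v u))"
  by (simp add: K_def inner_diff_left inner_add_left
      linear_inner_expand[OF linear_Dg_inner[OF assms]])
    (simp add: inner_commute)

lemma DK_inner:
  assumes "q \<in> S"
  shows "DK q d u v \<bullet> w = (1/2) * (w \<bullet> (D2g q d u *v v) + w \<bullet> (D2g q d v *v u) - v \<bullet> (D2g q d w *v u))"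
  by (simp add: DK_def inner_diff_left inner_add_left
      linear_inner_expand[OF linear_D2g_inner[OF assms]])
    (simp add: inner_commute)

text \<open>Compatibility of the Levi-Civita connection with the metric, with the index of the
  Christoffel symbols lowered.\<close>

lemma K_compat: "q \<in> S \<Longrightarrow> w \<bullet> (Dg q u *v v) = K q u v \<bullet> w + K q u w \<bullet> v"
  using Dg_inner[of q v u w] by (simp add: K_inner field_simps)

lemma K_commute: "q \<in> S \<Longrightarrow> K q u v = K q v u"
  by (simp add: K_def add.commute Dg_inner)

lemma Gam_commute: "q \<in> S \<Longrightarrow> Gam q u v = Gam q v u"
  by (simp add: Gam_def K_commute)

lemma gm_Gam: "q \<in> S \<Longrightarrow> gm q *v Gam q u v = K q u v"
  by (simp add: Gam_def gm_gi)

lemma linear_K: "q \<in> S \<Longrightarrow> linear (K q u)"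
  by (rule linearI; rule inner_eqI)
    (simp_all add: K_inner inner_add_left linear_add[OF linear_Dg] linear_scale[OF linear_Dg] algebra_simps
      inner_add_right flip: scaleR_matrix_vector_assoc)

lemma linear_Gam2: "q \<in> S \<Longrightarrow> linear (Gam q u)"
  unfolding Gam_def using linear_compose[OF linear_K matrix_vector_mul_linear[of "gi q"]]
  by (simp add: o_def)

lemma linear_Gam1:
  assumes "q \<in> S" shows "linear (\<lambda>u. Gam q u v)"
proof -
  have "(\<lambda>u. Gam q u v) = Gam q v" by (rule ext) (rule Gam_commute[OF assms])
  then show ?thesis using linear_Gam2[OF assms] by simp
qed

lemma K_has_derivative:
  assumes "q \<in> S" shows "((\<lambda>y. K y u v) has_derivative (\<lambda>d. DK q d u v)) (at q)"
proof -
  have lam: "((\<lambda>y. \<chi> l. v \<bullet> (Dg y (axis l 1) *v u)) has_derivative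
      (\<lambda>d. \<chi> l. v \<bullet> (D2g q d (axis l 1) *v u))) (at q)"
    unfolding has_derivative_componentwise_within[where f="\<lambda>y. \<chi> l. v \<bullet> (Dg y (axis l 1) *v u)"]
    by (auto simp: Basis_vec_def inner_axis intro!: derivative_eq_intros Dg_has_derivative assms)
  show ?thesis
    unfolding K_def DK_def
    by (rule derivative_eq_intros lam Dg_has_derivative assms refl)+ simp
qed

lemma Gam_has_derivative:
  assumes "q \<in> S" shows "((\<lambda>y. Gam y u v) has_derivative (\<lambda>d. DGam q d u v)) (at q)"
proof -
  have "((\<lambda>y. Gam y u v) has_derivative (\<lambda>d. gi q *v DK q d u v + - (gi q ** Dg q d ** gi q) *v K q u v)) (at q)"
    unfolding Gam_def by (rule derivative_eq_intros gi_has_derivative K_has_derivative assms refl)+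
  then show ?thesis
    by (simp add: DGam_def uminus_matrix_vector matrix_vector_mult_diff_distrib Gam_def flip: matrix_vector_mul_assoc)
qed

lemma gm_DGam: "q \<in> S \<Longrightarrow> gm q *v DGam q d u v = DK q d u v - Dg q d *v Gam q u v"
  by (simp add: DGam_def gm_gi)

lemma DK_commute: "q \<in> S \<Longrightarrow> DK q d u v = DK q d v u"
  by (simp add: DK_def add.commute D2g_inner)

lemma DGam_commute: "q \<in> S \<Longrightarrow> DGam q d u v = DGam q d v u"
  by (simp add: DGam_def DK_commute Gam_commute)

lemma linear_DK: "q \<in> S \<Longrightarrow> linear (DK q d u)"
  by (rule linearI; rule inner_eqI)
    (simp_all add: DK_inner inner_add_left linear_add[OF linear_D2g2] linear_scale[OF linear_D2g2] algebra_simps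
      inner_add_right flip: scaleR_matrix_vector_assoc)

lemma linear_DGam3: "q \<in> S \<Longrightarrow> linear (DGam q d u)"
  unfolding DGam_def
  by (intro linearI)
    (simp_all add: linear_add[OF linear_DK] linear_add[OF linear_Gam2] linear_scale[OF linear_DK]
       linear_scale[OF linear_Gam2] algebra_simps)

lemma linear_DGam2:
  assumes "q \<in> S" shows "linear (\<lambda>u. DGam q d u v)"
proof -
  have "(\<lambda>u. DGam q d u v) = DGam q d v" by (rule ext) (rule DGam_commute[OF assms])
  then show ?thesis using linear_DGam3[OF assms] by simp
qed

lemma linear_DGam1: "q \<in> S \<Longrightarrow> linear (\<lambda>d. DGam q d u v)"
  using Gam_has_derivative has_derivative_linear by blast

lemma linear_Riem1: "q \<in> S \<Longrightarrow> linear (\<lambda>u. Riem q u v w)"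
  unfolding Riem_def
  by (intro linearI) (simp_all add: linear_add[OF linear_DGam1] linear_add[OF linear_DGam2]
      linear_add[OF linear_Gam1] linear_add[OF linear_Gam2] linear_scale[OF linear_DGam1] linear_scale[OF linear_DGam2]
      linear_scale[OF linear_Gam1] linear_scale[OF linear_Gam2] algebra_simps)

lemma linear_Riem3: "q \<in> S \<Longrightarrow> linear (\<lambda>w. Riem q u v w)"
  unfolding Riem_def
  by (intro linearI) (simp_all add: linear_add[OF linear_DGam3]
      linear_add[OF linear_Gam2] linear_scale[OF linear_DGam3] 
      linear_scale[OF linear_Gam2] algebra_simps)

lemma Riem_antisym: "Riem q u v w = - Riem q v u w"
  by (simp add: Riem_def)

lemma linear_Riem2: "q \<in> S \<Longrightarrow> linear (\<lambda>v. Riem q u v w)"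
  using linear_compose_neg[OF linear_Riem1[of q u w]] Riem_antisym[of q u _ w] by presburger

lemma Riem_Bianchi: "q \<in> S \<Longrightarrow> Riem q u v w + Riem q v w u + Riem q w u v = 0"
  unfolding Riem_def
  by (simp add: DGam_commute[of q u w v] DGam_commute[of q v w u] DGam_commute[of q w v u] 
      Gam_commute[of q u w] Gam_commute[of q v w] Gam_commute[of q v u])

text \<open>After lowering the index, metric compatibility turns all quadratic terms into pairings
  of two \<open>K\<close> vectors by the symmetric matrix \<open>gi\<close>, visibly skew under
  exchange of \<open>x\<close> and \<open>w\<close>. In the second-order part the terms symmetric in
  \<open>x\<close> and \<open>w\<close> cancel because second derivatives commute.\<close>

lemma Riem_skew:
  assumes q: "q \<in> S"
  shows "x \<bullet> (gm q *v Riem q u v w) = - (w \<bullet> (gm q *v Riem q u v x))"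
proof -
  have D: "x \<bullet> (gm q *v DGam q u v w) = DK q u v w \<bullet> x - K q u (Gam q v w) \<bullet> x - K q u x \<bullet> Gam q v w"
    for x u v w
    by (simp add: gm_DGam q inner_diff_right K_compat) (simp add: inner_commute)
  have "x \<bullet> (gm q *v Riem q u v w) = DK q u v w \<bullet> x - DK q v u w \<bullet> x
      - K q u x \<bullet> (gi q *v K q v w) + K q v x \<bullet> (gi q *v K q u w)" for x w
    unfolding Riem_def
    by (simp add: matrix_vector_mult_diff_distrib matrix_vector_right_distrib inner_diff_right inner_add_right D
      gm_Gam q Gam_def gm_gi inner_commute[of _ x])
  moreover have "DK q u v w \<bullet> x - DK q v u w \<bullet> x = - (DK q u v x \<bullet> w - DK q v u x \<bullet> w)"
    using D2g_inner[OF q] D2g_commute[OF q] by (simp add: DK_inner q field_simps)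
  ultimately show ?thesis
    using gi_inner[OF q] by simp
qed

text \<open>The lowered curvature minus the model tensor of curvature \<open>c\<close> has all
  curvature symmetries and vanishes on sectional pairs, so \<open>curvature_like_zero\<close>
  applies.\<close>

lemma Riem_constant_curvature:
  assumes q: "q \<in> S"
    and c: "\<And>u v. u \<bullet> (gm q *v Riem q u v v) =
      c * ((u \<bullet> (gm q *v u)) * (v \<bullet> (gm q *v v)) - (u \<bullet> (gm q *v v))\<^sup>2)"
  shows "Riem q u v w = c *\<^sub>R ((w \<bullet> (gm q *v v)) *\<^sub>R u - (w \<bullet> (gm q *v u)) *\<^sub>R v)"
proof -
  define T where "T u v w x = x \<bullet> (gm q *v Riem q u v w)
      - c * ((w \<bullet> (gm q *v v)) * (x \<bullet> (gm q *v u)) - (w \<bullet> (gm q *v u)) * (x \<bullet> (gm q *v v)))" for u v w x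
  note lin = linear_add[OF linear_Riem1[OF q]] linear_add[OF linear_Riem2[OF q]] linear_add[OF linear_Riem3[OF q]]
  have "T u v w x = 0" for u v w x
  proof (rule curvature_like_zero[where T=T])
    show "T (a + b) v w x = T a v w x + T b v w x" for a b v w x
      by (simp add: T_def lin algebra_simps)
    show "T u (a + b) w x = T u a w x + T u b w x" for a b u w x
      by (simp add: T_def lin algebra_simps)
    show "T u v w x = - T v u w x" for u v w x
      using Riem_antisym[of q u v w] by (simp add: T_def algebra_simps vec.neg)
    show "T u v w x = - T u v x w" for u v w x
      using Riem_skew[OF q, of x u v w] by (simp add: T_def algebra_simps)
    show "T u v w x + T v w u x + T w u v x = 0" for u v w x
    proof -
      have "x \<bullet> (gm q *v (Riem q u v w + Riem q v w u + Riem q w u v)) = 0"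
        by (simp add: Riem_Bianchi q)
      then show ?thesis
        using gm_inner[OF q, of u v] gm_inner[OF q, of u w] gm_inner[OF q, of v w]
        by (simp add: T_def algebra_simps)
    qed
    show "T u v v u = 0" for u v
      using gm_inner[OF q, of u v] by (simp add: T_def c power2_eq_square algebra_simps)
  qed
  then have "x \<bullet> (gm q *v Riem q u v w) =
      x \<bullet> (gm q *v (c *\<^sub>R ((w \<bullet> (gm q *v v)) *\<^sub>R u - (w \<bullet> (gm q *v u)) *\<^sub>R v)))" for x
    by (simp add: T_def algebra_simps inner_diff_right)
  then have "gm q *v Riem q u v w =
      gm q *v (c *\<^sub>R ((w \<bullet> (gm q *v v)) *\<^sub>R u - (w \<bullet> (gm q *v u)) *\<^sub>R v))"
    by (rule vector_eq_ldot[THEN iffD1, rule_format])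
  then show ?thesis using gi_gm[OF q] by metis
qed

end

section \<open>The Nijenhuis tensor of a field of complex structures\<close>

locale almost_complex_field =
  fixes T :: "'e::euclidean_space set" and J :: "'e \<Rightarrow> 'e \<Rightarrow> 'e"
  assumes open_T: "open T"
    and linear_J: "z \<in> T \<Longrightarrow> linear (J z)"
    and J_J: "z \<in> T \<Longrightarrow> J z (J z v) = - v"
    and J_differentiable: "z \<in> T \<Longrightarrow> (\<lambda>y. J y v) differentiable (at z)"
begin

definition DJ :: "'e \<Rightarrow> 'e \<Rightarrow> 'e \<Rightarrow> 'e" where
  "DJ z d v = frechet_derivative (\<lambda>y. J y v) (at z) d"

text \<open>The pointwise value of the Nijenhuis tensor: what remains of the bracket expression
  after the derivatives of the two vector fields have cancelled.\<close>

definition Nij :: "'e \<Rightarrow> 'e \<Rightarrow> 'e \<Rightarrow> 'e" where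
  "Nij z U V = DJ z (J z U) V - DJ z (J z V) U + J z (DJ z V U) - J z (DJ z U V)"

lemma DJ_has_derivative: "z \<in> T \<Longrightarrow> ((\<lambda>y. J y v) has_derivative (\<lambda>d. DJ z d v)) (at z)"
  unfolding DJ_def using J_differentiable frechet_derivative_works by blast

lemma J_field_has_derivative:
  "z \<in> T \<Longrightarrow> (X has_derivative X') (at z) \<Longrightarrow>
    ((\<lambda>y. J y (X y)) has_derivative (\<lambda>d. DJ z d (X z) + J z (X' d))) (at z)"
  by (rule linear_family_has_derivative[OF open_T _ linear_J DJ_has_derivative])

lemma linear_DJ1: "z \<in> T \<Longrightarrow> linear (\<lambda>d. DJ z d v)"
  using DJ_has_derivative has_derivative_linear by blast

lemma linear_DJ2: "z \<in> T \<Longrightarrow> linear (DJ z d)"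
  by (rule linear_family_derivative_linear[OF open_T _ linear_J DJ_has_derivative])

text \<open>Differentiate J J v = - v. This anticommutation is the source of conjugate linearity of
  \<open>Nij\<close>.\<close>

lemma DJ_J:
  assumes z: "z \<in> T" shows "DJ z d (J z v) = - J z (DJ z d v)"
proof -
  have "((\<lambda>y. J y (J y v)) has_derivative (\<lambda>d. DJ z d (J z v) + J z (DJ z d v))) (at z)"
    by (rule J_field_has_derivative[OF z DJ_has_derivative[OF z]])
  moreover have "((\<lambda>y. J y (J y v)) has_derivative (\<lambda>d. 0)) (at z)"
    by (rule has_derivative_transform_within_open[OF has_derivative_const[of "- v"] open_T z])
      (simp add: J_J)
  ultimately have "(\<lambda>d. DJ z d (J z v) + J z (DJ z d v)) = (\<lambda>d. 0)"
    by (rule has_derivative_unique)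
  from fun_cong[OF this, of d] show ?thesis by (simp add: eq_neg_iff_add_eq_0)
qed

lemma nijenhuis_eq_Nij:
  assumes z: "z \<in> T" and "X differentiable (at z)" "Y differentiable (at z)"
  shows "nijenhuis J X Y z = Nij z (X z) (Y z)"
proof -
  obtain X' Y' where X: "(X has_derivative X') (at z)" and Y: "(Y has_derivative Y') (at z)"
    using assms by (auto simp: differentiable_def)
  note J = linear_add[OF linear_J[OF z]] linear_diff[OF linear_J[OF z]] J_J[OF z]
  show ?thesis
    unfolding nijenhuis_def lie_bracket_def Nij_def
      frechet_derivative_eqI[OF X] frechet_derivative_eqI[OF Y]
      frechet_derivative_eqI[OF J_field_has_derivative[OF z X]]
      frechet_derivative_eqI[OF J_field_has_derivative[OF z Y]]
    by (simp add: J)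
qed

lemma Nij_antisym: "z \<in> T \<Longrightarrow> Nij z U V = - Nij z V U"
  by (simp add: Nij_def)

lemma Nij_J1: 
  assumes z: "z \<in> T" shows "Nij z (J z U) V = - J z (Nij z U V)"
proof -
  note lin = linear_add[OF linear_J[OF z]] linear_diff[OF linear_J[OF z]] linear_neg[OF linear_J[OF z]]
    linear_neg[OF linear_DJ1[OF z]] J_J[OF z] DJ_J[OF z]
  show ?thesis by (simp add: Nij_def lin)
qed

lemma Nij_J2: "z \<in> T \<Longrightarrow> Nij z U (J z V) = - J z (Nij z U V)"
  using Nij_J1[of z V U] Nij_antisym[of z U V] Nij_antisym[of z U "J z V"]
  by (simp add: linear_neg[OF linear_J])

lemma Nij_add1: "z \<in> T \<Longrightarrow> Nij z (U + U') V = Nij z U V + Nij z U' V"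
  by (simp add: Nij_def linear_add[OF linear_J] linear_add[OF linear_DJ1] linear_add[OF linear_DJ2])

lemma Nij_add2: "z \<in> T \<Longrightarrow> Nij z U (V + V') = Nij z U V + Nij z U V'"
  by (simp add: Nij_def linear_add[OF linear_J] linear_add[OF linear_DJ1] linear_add[OF linear_DJ2])

text \<open>Since \<open>Nij\<close> is conjugate linear, it is enough to test it on vectors that span together
  with their images under \<open>J\<close>.\<close>

lemma Nij_zero:
  assumes z: "z \<in> T" and span: "\<And>U. \<exists>u\<in>B. \<exists>w\<in>B. U = u + J z w"
    and B: "\<And>u v. u \<in> B \<Longrightarrow> v \<in> B \<Longrightarrow> Nij z u v = 0"
  shows "Nij z U V = 0"
proof -
  obtain u w where U: "u \<in> B" "w \<in> B" "U = u + J z w" using span by blast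
  obtain u' w' where V: "u' \<in> B" "w' \<in> B" "V = u' + J z w'" using span by blast
  show ?thesis
    using U V B by (simp add: Nij_add1 Nij_add2 Nij_J1 Nij_J2 z linear_0[OF linear_J])
qed

text \<open>Constant vector fields already realize all pairs of vectors at \<open>z\<close>;
  conversely, tensoriality reduces arbitrary smooth fields to their values there.\<close>

lemma nijenhuis_vanishes_iff:
  assumes z: "z \<in> T"
  shows "(\<forall>X Y. smooth_on T X \<longrightarrow> smooth_on T Y \<longrightarrow> nijenhuis J X Y z = 0) \<longleftrightarrow> (\<forall>U V. Nij z U V = 0)"
    (is "?L \<longleftrightarrow> ?R")
proof
  assume L: ?L
  have "Nij z U V = 0" for U V
    using L nijenhuis_eq_Nij[OF z, of "\<lambda>_. U" "\<lambda>_. V"] by (simp add: smooth_on_const open_T)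
  then show ?R by blast
next
  assume ?R
  then show ?L
    using nijenhuis_eq_Nij[OF z] by (auto dest!: smooth_on_open_differentiable[OF _ open_T z])
qed

end

section \<open>The cotangent bundle in induced coordinates\<close>

context metric_coords
begin

text \<open>Points \<open>z = (q, p)\<close> of the cotangent bundle in an induced chart: \<open>xx z\<close> is the vector
  dual to \<open>p\<close>, \<open>en\<close> the energy density with differential \<open>den\<close>, \<open>GamP z u\<close> the contraction of
  \<open>\<Gamma>\<^sup>0\<^sub>i\<^sub>h\<close> with \<open>u\<close>, and \<open>hor z u\<close> the horizontal lift of \<open>u\<close>.\<close>

abbreviation TS :: "((real^'n) \<times> (real^'n)) set" where
  "TS \<equiv> S \<times> UNIV"

definition xx :: "(real^'n) \<times> (real^'n) \<Rightarrow> real^'n" where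
  "xx z = gi (fst z) *v snd z"

definition en :: "(real^'n) \<times> (real^'n) \<Rightarrow> real" where
  "en z = (1/2) * (snd z \<bullet> xx z)"

definition GamP :: "(real^'n) \<times> (real^'n) \<Rightarrow> real^'n \<Rightarrow> real^'n" where
  "GamP z u = (\<chi> h. snd z \<bullet> Gam (fst z) u (axis h 1))"

definition DGamP :: "(real^'n) \<times> (real^'n) \<Rightarrow> (real^'n) \<times> (real^'n) \<Rightarrow> real^'n \<Rightarrow> real^'n" where
  "DGamP z d u = (\<chi> h. snd d \<bullet> Gam (fst z) u (axis h 1) + snd z \<bullet> DGam (fst z) (fst d) u (axis h 1))"

definition hor :: "(real^'n) \<times> (real^'n) \<Rightarrow> real^'n \<Rightarrow> (real^'n) \<times> (real^'n)" where
  "hor z u = (u, GamP z u)"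

definition den :: "(real^'n) \<times> (real^'n) \<Rightarrow> (real^'n) \<times> (real^'n) \<Rightarrow> real" where
  "den z U = xx z \<bullet> snd U - xx z \<bullet> GamP z (fst U)"

lemma open_TS: "open TS"
  by (simp add: open_Times open_S)

lemma GamP_inner:
  assumes z: "z \<in> TS" shows "GamP z u \<bullet> v = snd z \<bullet> Gam (fst z) u v"
proof -
  have q: "fst z \<in> S" using z by auto
  have "linear (\<lambda>v. snd z \<bullet> Gam (fst z) u v)"
    by (rule linearI)
      (simp_all add: linear_add[OF linear_Gam2[OF q]] linear_scale[OF linear_Gam2[OF q]] inner_add_right)
  then show ?thesis unfolding GamP_def by (rule linear_inner_expand)
qed

lemma DGamP_inner:
  assumes z: "z \<in> TS"
  shows "DGamP z d u \<bullet> v = snd d \<bullet> Gam (fst z) u v + snd z \<bullet> DGam (fst z) (fst d) u v"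
proof -
  have q: "fst z \<in> S" using z by auto
  have "linear (\<lambda>v. snd d \<bullet> Gam (fst z) u v + snd z \<bullet> DGam (fst z) (fst d) u v)"
    by (rule linearI) (simp_all add: linear_add[OF linear_Gam2[OF q]] linear_scale[OF linear_Gam2[OF q]]
        linear_add[OF linear_DGam3[OF q]] linear_scale[OF linear_DGam3[OF q]] inner_add_right algebra_simps)
  then show ?thesis unfolding DGamP_def by (rule linear_inner_expand)
qed

lemma GamP_symmetric: "z \<in> TS \<Longrightarrow> GamP z u \<bullet> v = u \<bullet> GamP z v"
  using Gam_commute[of "fst z" u v] by (auto simp: GamP_inner inner_commute[of u])

lemma linear_GamP: 
  assumes z: "z \<in> TS" shows "linear (GamP z)"
proof -
  have q: "fst z \<in> S" using z by auto
  show ?thesis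
    by (rule linearI; rule inner_eqI) (simp_all add: GamP_inner[OF z] inner_add_left inner_add_right
      linear_add[OF linear_Gam1[OF q]] linear_scale[OF linear_Gam1[OF q]])
qed

lemma linear_hor: "z \<in> TS \<Longrightarrow> linear (hor z)"
  by (rule linearI) (simp_all add: hor_def linear_add[OF linear_GamP] linear_scale[OF linear_GamP])

lemma fst_has_derivative: "(fst has_derivative fst) (at z)"
  and snd_has_derivative: "(snd has_derivative snd) (at z)"
  by (auto intro: bounded_linear_imp_has_derivative bounded_linear_fst bounded_linear_snd)

lemma base_has_derivative:
  assumes "(f has_derivative f') (at (fst z))"
  shows "((\<lambda>y. f (fst y)) has_derivative (\<lambda>d. f' (fst d))) (at z)"
  using has_derivative_compose[OF fst_has_derivative assms] .

lemma GamP_has_derivative: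
  assumes z: "z \<in> TS" shows "((\<lambda>y. GamP y u) has_derivative (\<lambda>d. DGamP z d u)) (at z)"
proof -
  have q: "fst z \<in> S" using z by auto
  have "((\<lambda>y. snd y \<bullet> Gam (fst y) u (axis h 1)) has_derivative
      (\<lambda>d. snd d \<bullet> Gam (fst z) u (axis h 1) + snd z \<bullet> DGam (fst z) (fst d) u (axis h 1))) (at z)" for h
    by (rule derivative_eq_intros base_has_derivative Gam_has_derivative q snd_has_derivative refl)+
      (simp add: fun_eq_iff)
  then show ?thesis
    unfolding GamP_def DGamP_def
      has_derivative_componentwise_within[where f="\<lambda>y. \<chi> h. snd y \<bullet> Gam (fst y) u (axis h 1)"]
    by (auto simp: Basis_vec_def inner_axis)
qed

lemma hor_has_derivative:
  "z \<in> TS \<Longrightarrow> ((\<lambda>y. hor y u) has_derivative (\<lambda>d. (0, DGamP z d u))) (at z)"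
  unfolding hor_def by (intro has_derivative_Pair has_derivative_const GamP_has_derivative)

lemma xx_has_derivative:
  assumes z: "z \<in> TS"
  shows "(xx has_derivative (\<lambda>d. gi (fst z) *v snd d - gi (fst z) *v (Dg (fst z) (fst d) *v xx z))) (at z)"
proof -
  have q: "fst z \<in> S" using z by auto
  have "((\<lambda>y. gi (fst y) *v snd y) has_derivative
      (\<lambda>d. gi (fst z) *v snd d + - (gi (fst z) ** Dg (fst z) (fst d) ** gi (fst z)) *v snd z)) (at z)"
    by (rule derivative_eq_intros base_has_derivative gi_has_derivative q snd_has_derivative refl)+
  then show ?thesis
    by (simp add: xx_def[abs_def] uminus_matrix_vector flip: matrix_vector_mul_assoc)
qed

lemma inner_gi_snd: "z \<in> TS \<Longrightarrow> snd z \<bullet> (gi (fst z) *v v) = xx z \<bullet> v"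
  by (auto simp: xx_def gi_inner inner_commute)

lemma gm_xx: "z \<in> TS \<Longrightarrow> gm (fst z) *v xx z = snd z"
  by (auto simp: xx_def gm_gi)

lemma xx_gm: "z \<in> TS \<Longrightarrow> xx z \<bullet> (gm (fst z) *v u) = snd z \<bullet> u"
  using gm_inner[of "fst z" "xx z" u] gm_xx[of z] by (auto simp: inner_commute)

text \<open>Bridges two descriptions of dt: differentiating the inverse metric produces
  \<open>Dg\<close>, while \<open>den\<close> is written with the connection so that it visibly
  vanishes on horizontal lifts. Metric compatibility on the pair \<open>xx z\<close>,
  \<open>xx z\<close> equates them.\<close>

lemma den_alt:
  assumes z: "z \<in> TS"
  shows "den z U = xx z \<bullet> snd U - (1/2) * (xx z \<bullet> (Dg (fst z) (fst U) *v xx z))"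
proof -
  have q: "fst z \<in> S" using z by auto
  have "xx z \<bullet> (Dg (fst z) (fst U) *v xx z) = 2 * (xx z \<bullet> (gm (fst z) *v Gam (fst z) (fst U) (xx z)))"
    by (simp add: K_compat q gm_Gam inner_commute)
  also have "\<dots> = 2 * (GamP z (fst U) \<bullet> xx z)"
    by (simp only: xx_gm[OF z] GamP_inner[OF z])
  finally show ?thesis by (simp add: den_def inner_commute)
qed

lemma en_has_derivative:
  assumes z: "z \<in> TS" shows "(en has_derivative den z) (at z)"
proof -
  have "((\<lambda>y. (1/2) * (snd y \<bullet> xx y)) has_derivative (\<lambda>d. (1/2) * (snd d \<bullet> xx z + snd z \<bullet>
      (gi (fst z) *v snd d - gi (fst z) *v (Dg (fst z) (fst d) *v xx z))))) (at z)"
    by (rule derivative_eq_intros xx_has_derivative z snd_has_derivative refl)+ (simp add: fun_eq_iff)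
  then show ?thesis
    unfolding en_def[abs_def]
    by (rule has_derivative_eq_rhs)
      (auto simp: den_alt[OF z] inner_diff_right inner_gi_snd[OF z] inner_commute fun_eq_iff algebra_simps)
qed

text \<open>The second derivative of the energy is left implicit; it enters the exterior derivative
  only through its symmetry \<open>D2en_commute\<close>.\<close>

definition D2en :: "(real^'n) \<times> (real^'n) \<Rightarrow> (real^'n) \<times> (real^'n) \<Rightarrow> (real^'n) \<times> (real^'n) \<Rightarrow> real" where
  "D2en z d U = frechet_derivative (\<lambda>y. den y U) (at z) d"

lemma den_has_derivative:
  assumes z: "z \<in> TS" shows "((\<lambda>y. den y U) has_derivative (\<lambda>d. D2en z d U)) (at z)"
proof -
  have q: "fst z \<in> S" using z by auto
  have "\<exists>D. ((\<lambda>y. xx y \<bullet> snd U - (1/2) * (xx y \<bullet> (Dg (fst y) (fst U) *v xx y))) has_derivative D) (at z)"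
    by (rule exI) (rule derivative_eq_intros base_has_derivative Dg_has_derivative q xx_has_derivative z refl)+
  then obtain D where "((\<lambda>y. den y U) has_derivative D) (at z)"
    using has_derivative_transform_within_open[OF _ open_TS z] den_alt by (metis (no_types, lifting))
  then show ?thesis unfolding D2en_def
    using frechet_derivative_works differentiable_def by blast
qed

lemma D2en_commute:
  assumes z: "z \<in> TS" shows "D2en z U V = D2en z V U"
  using second_derivative_symmetric[OF open_TS z en_has_derivative den_has_derivative den_has_derivative] z
  by blast

lemma den_hor: "den z (hor z u) = 0"
  by (simp add: den_def hor_def)

lemma den_vertical: "z \<in> TS \<Longrightarrow> den z (0, w) = xx z \<bullet> w"
  by (simp add: den_def linear_0[OF linear_GamP])

lemma en_nonneg: 
  assumes "z \<in> TS" shows "en z \<ge> 0"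
proof -
  have "fst z \<in> S" using assms by auto
  then show ?thesis
    using gi_positive[of "fst z" "snd z"] by (cases "snd z = 0") (auto simp: en_def xx_def)
qed

lemma snd_xx: "snd z \<bullet> xx z = 2 * en z"
  by (simp add: en_def)

end

section \<open>The natural structure in induced coordinates\<close>

text \<open>\<open>GG\<close> and \<open>HH\<close> are the matrices \<open>a\<^sub>1 g\<^sub>i\<^sub>j + b\<^sub>1 p\<^sub>i p\<^sub>j\<close> and \<open>a\<^sub>2 g\<^sup>i\<^sup>j + b\<^sub>2 g\<^sup>0\<^sup>i g\<^sup>0\<^sup>j\<close>, which are inverse
  to each other; \<open>JJ\<close> and \<open>ph\<close> are \<open>J\<close> and \<open>\<phi>\<close> in an induced chart.\<close>

locale natural_structure = metric_coords S gm
  for S :: "(real^'n) set" and gm :: "real^'n \<Rightarrow> real^'n^'n" +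
  fixes a1 b1 lam mu a1' b1' lam' mu' :: "real \<Rightarrow> real"
  assumes a1_deriv: "t \<ge> 0 \<Longrightarrow> (a1 has_real_derivative a1' t) (at t within {0..})"
    and b1_deriv: "t \<ge> 0 \<Longrightarrow> (b1 has_real_derivative b1' t) (at t within {0..})"
    and lam_deriv: "t \<ge> 0 \<Longrightarrow> (lam has_real_derivative lam' t) (at t within {0..})"
    and mu_deriv: "t \<ge> 0 \<Longrightarrow> (mu has_real_derivative mu' t) (at t within {0..})"
    and a1_pos: "t \<ge> 0 \<Longrightarrow> a1 t > 0"
    and a1_b1_pos: "t \<ge> 0 \<Longrightarrow> a1 t + 2 * t * b1 t > 0"
begin

definition b2 :: "real \<Rightarrow> real" where
  "b2 t = - b1 t / (a1 t * (a1 t + 2 * t * b1 t))"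

definition FF :: "real \<Rightarrow> real" where
  "FF t = (a1 t + 2 * t * b1 t) * a1' t - a1 t * b1 t"

definition GG :: "(real^'n) \<times> (real^'n) \<Rightarrow> real^'n \<Rightarrow> real^'n" where
  "GG z u = a1 (en z) *\<^sub>R (gm (fst z) *v u) + (b1 (en z) * (snd z \<bullet> u)) *\<^sub>R snd z"

definition HH :: "(real^'n) \<times> (real^'n) \<Rightarrow> real^'n \<Rightarrow> real^'n" where
  "HH z w = (1 / a1 (en z)) *\<^sub>R (gi (fst z) *v w) + (b2 (en z) * (xx z \<bullet> w)) *\<^sub>R xx z"

definition JJ :: "(real^'n) \<times> (real^'n) \<Rightarrow> (real^'n) \<times> (real^'n) \<Rightarrow> (real^'n) \<times> (real^'n)" where
  "JJ z U = (0, GG z (fst U)) - hor z (HH z (snd U - GamP z (fst U)))"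

text \<open>The canonical symplectic form \<open>dp\<^sub>i \<and> dq\<^sup>i\<close>.\<close>

definition Om :: "(real^'n) \<times> (real^'n) \<Rightarrow> (real^'n) \<times> (real^'n) \<Rightarrow> real" where
  "Om U V = snd U \<bullet> fst V - fst U \<bullet> snd V"

definition ph :: "(real^'n) \<times> (real^'n) \<Rightarrow> (real^'n) \<times> (real^'n) \<Rightarrow> (real^'n) \<times> (real^'n) \<Rightarrow> real" where
  "ph z U V = lam (en z) * Om U V + mu (en z) * (den z U * (snd z \<bullet> fst V) - den z V * (snd z \<bullet> fst U))"

text \<open>This sum is the coefficient of the rank-one term in both products of \<open>GG\<close>
  and \<open>HH\<close>; the value of \<open>b2\<close> is the one that makes it vanish.\<close>

lemma b2_mult: "t \<ge> 0 \<Longrightarrow> a1 t * b2 t + b1 t / a1 t + 2 * t * b1 t * b2 t = 0"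
proof -
  assume t: "t \<ge> 0"
  have "b2 t * (a1 t + 2 * t * b1 t) = - b1 t / a1 t"
    using a1_pos[OF t] a1_b1_pos[OF t] by (simp add: b2_def)
  then show ?thesis by (simp add: algebra_simps)
qed

lemma GG_HH:
  assumes z: "z \<in> TS" shows "GG z (HH z w) = w"
proof -
  have q: "fst z \<in> S" using z by auto
  have t: "en z \<ge> 0" using en_nonneg[OF z] .
  have "GG z (HH z w) = w + ((a1 (en z) * b2 (en z) + b1 (en z) / a1 (en z) + 2 * en z * b1 (en z) * b2 (en z))
      * (xx z \<bullet> w)) *\<^sub>R snd z"
    using a1_pos[OF t]
    by (simp add: GG_def HH_def matrix_vector_right_distrib matrix_vector_mult_scaleR gm_gi q gm_xx z
        inner_add_right inner_gi_snd snd_xx algebra_simps)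
  then show ?thesis using b2_mult[OF t] by simp
qed

lemma HH_GG:
  assumes z: "z \<in> TS" shows "HH z (GG z u) = u"
proof -
  have q: "fst z \<in> S" using z by auto
  have t: "en z \<ge> 0" using en_nonneg[OF z] .
  have "HH z (GG z u) = u + ((a1 (en z) * b2 (en z) + b1 (en z) / a1 (en z) + 2 * en z * b1 (en z) * b2 (en z))
      * (snd z \<bullet> u)) *\<^sub>R xx z"
    using a1_pos[OF t]
    by (simp add: GG_def HH_def matrix_vector_right_distrib matrix_vector_mult_scaleR gi_gm q xx_gm z
        inner_add_right inner_commute[of "xx z" "snd z"] snd_xx xx_def[symmetric] algebra_simps)
  then show ?thesis using b2_mult[OF t] by simp
qed

lemma linear_GG: "linear (GG z)"
  by (rule linearI) (simp_all add: GG_def algebra_simps)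

lemma linear_HH: "linear (HH z)"
  by (rule linearI) (simp_all add: HH_def algebra_simps)

lemma linear_JJ:
  assumes z: "z \<in> TS" shows "linear (JJ z)"
  unfolding JJ_def
  by (rule linearI)
    (simp_all add: linear_add[OF linear_GG] linear_add[OF linear_GamP[OF z]] linear_diff[OF linear_HH]
      linear_diff[OF linear_hor[OF z]] linear_add[OF linear_HH] linear_add[OF linear_hor[OF z]]
      linear_scale[OF linear_GG] linear_scale[OF linear_GamP[OF z]] linear_scale[OF linear_HH]
      linear_scale[OF linear_hor[OF z]] algebra_simps)

lemma JJ_hor: "z \<in> TS \<Longrightarrow> JJ z (hor z u) = (0, GG z u)"
  using linear_0[OF linear_HH, of z] linear_0[OF linear_hor, of z]
  by (simp add: JJ_def hor_def)

lemma JJ_vertical: "z \<in> TS \<Longrightarrow> JJ z (0, w) = - hor z (HH z w)"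
  using linear_0[OF linear_GG, of z] linear_0[OF linear_GamP, of z]
  by (simp add: JJ_def flip: zero_prod_def)

lemma hor_vertical_split: "U = hor z (fst U) + (0, snd U - GamP z (fst U))"
  by (simp add: hor_def prod_eq_iff)

lemma JJ_JJ: 
  assumes z: "z \<in> TS" shows "JJ z (JJ z U) = - U"
proof -
  have "JJ z (JJ z U) = JJ z (0, GG z (fst U)) - JJ z (hor z (HH z (snd U - GamP z (fst U))))"
    unfolding JJ_def[of z U] by (rule linear_diff[OF linear_JJ[OF z]])
  also have "\<dots> = - (hor z (fst U) + (0, snd U - GamP z (fst U)))"
    by (simp add: JJ_vertical JJ_hor z HH_GG GG_HH)
  finally show ?thesis using hor_vertical_split[of U z] by simp
qed

lemma coefficient_has_derivative:
  assumes "z \<in> TS" "\<And>t. t \<ge> 0 \<Longrightarrow> (f has_real_derivative f' t) (at t within {0..})"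
  shows "((\<lambda>y. f (en y)) has_derivative (\<lambda>v. f' (en z) * den z v)) (at z)"
  by (rule halfline_compose_has_derivative[OF assms(2) en_has_derivative open_TS])
    (use assms(1) en_nonneg in auto)

definition DGG :: "(real^'n) \<times> (real^'n) \<Rightarrow> (real^'n) \<times> (real^'n) \<Rightarrow> real^'n \<Rightarrow> real^'n" where
  "DGG z d u = (a1' (en z) * den z d) *\<^sub>R (gm (fst z) *v u) + a1 (en z) *\<^sub>R (Dg (fst z) (fst d) *v u)
    + (b1' (en z) * den z d * (snd z \<bullet> u) + b1 (en z) * (snd d \<bullet> u)) *\<^sub>R snd z
    + (b1 (en z) * (snd z \<bullet> u)) *\<^sub>R snd d"

lemma GG_has_derivative:
  assumes z: "z \<in> TS" shows "((\<lambda>y. GG y u) has_derivative (\<lambda>d. DGG z d u)) (at z)"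
proof -
  have q: "fst z \<in> S" using z by auto
  show ?thesis
    unfolding GG_def[abs_def]
    by (rule derivative_eq_intros base_has_derivative gm_has_derivative q snd_has_derivative
        coefficient_has_derivative z a1_deriv b1_deriv refl | assumption)+
      (simp add: DGG_def fun_eq_iff algebra_simps)
qed

text \<open>Mere existence of the derivative suffices: the brackets computed below involve
  \<open>JJ\<close> on horizontal lifts, where it is given by \<open>GG\<close>.\<close>

lemma HH_differentiable:
  assumes z: "z \<in> TS" shows "(\<lambda>y. HH y w) differentiable (at z)"
proof -
  have q: "fst z \<in> S" using z by auto
  have t: "en z \<ge> 0" using en_nonneg[OF z] .
  note nz = a1_pos[OF t] a1_b1_pos[OF t]
  have "(\<lambda>y. a1 (en y)) differentiable (at z)" "(\<lambda>y. b1 (en y)) differentiable (at z)"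
    "en differentiable (at z)" "xx differentiable (at z)" "(\<lambda>y. gi (fst y) *v w) differentiable (at z)"
    unfolding differentiable_def
    using coefficient_has_derivative[OF z a1_deriv] coefficient_has_derivative[OF z b1_deriv]
      en_has_derivative[OF z] xx_has_derivative[OF z]
      base_has_derivative[OF has_derivative_matrix_vector[OF gi_has_derivative[OF q] has_derivative_const]]
    by blast+
  then show ?thesis
    unfolding HH_def[abs_def] b2_def
    by (intro differentiable_add differentiable_scaleR differentiable_mult differentiable_divide
        differentiable_minus differentiable_inner differentiable_const) (use nz in auto)
qed

lemma JJ_differentiable:
  assumes z: "z \<in> TS" shows "(\<lambda>y. JJ y U) differentiable (at z)"
proof -
  have W: "((\<lambda>y. snd U - GamP y (fst U)) has_derivative (\<lambda>d. 0 - DGamP z d (fst U))) (at z)"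
    by (intro derivative_intros GamP_has_derivative z)
  have HH: "((\<lambda>y. HH y v) has_derivative (\<lambda>d. frechet_derivative (\<lambda>y. HH y v) (at z) d)) (at z)" for v
    using HH_differentiable[OF z] frechet_derivative_works by blast
  obtain D where "((\<lambda>y. HH y (snd U - GamP y (fst U))) has_derivative D) (at z)"
    using linear_family_has_derivative[where L=HH, OF open_TS z linear_HH HH W] by blast
  from linear_family_has_derivative[where L=hor, OF open_TS z linear_hor hor_has_derivative[OF z] this]
  obtain D' where D': "((\<lambda>y. hor y (HH y (snd U - GamP y (fst U)))) has_derivative D') (at z)"
    by blast
  have "((\<lambda>y. (0::real^'n, GG y (fst U)) - hor y (HH y (snd U - GamP y (fst U)))) has_derivative
      (\<lambda>d. (0, DGG z d (fst U)) - D' d)) (at z)"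
    by (intro derivative_intros has_derivative_Pair has_derivative_const GG_has_derivative z D')
  then show ?thesis unfolding JJ_def differentiable_def by blast
qed

sublocale J: almost_complex_field TS JJ
  by (rule almost_complex_field.intro) (fact open_TS linear_JJ JJ_JJ JJ_differentiable)+

lemma JJ_hor_has_derivative:
  assumes z: "z \<in> TS" shows "((\<lambda>y. JJ y (hor y u)) has_derivative (\<lambda>d. (0, DGG z d u))) (at z)"
proof -
  have "((\<lambda>y. (0::real^'n, GG y u)) has_derivative (\<lambda>d. (0, DGG z d u))) (at z)"
    by (intro has_derivative_Pair has_derivative_const GG_has_derivative z)
  then show ?thesis
    by (rule has_derivative_transform_within_open[OF _ open_TS z]) (simp add: JJ_hor)
qed

text \<open>Horizontal lifts annihilate \<open>t\<close>, and \<open>g\<close> and the tautological covector are parallel; hence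
  the horizontal part of the Nijenhuis tensor vanishes without any assumption.\<close>

lemma Nij_horizontal_part:
  assumes z: "z \<in> TS"
  shows "DGamP z (0, GG z u) v - DGG z (hor z v) u + (DGG z (hor z u) v - DGamP z (0, GG z v) u) = 0"
proof (rule inner_eqI)
  fix w
  have q: "fst z \<in> S" using z by auto
  have dGG: "DGG z (hor z v) u \<bullet> w = a1 (en z) * (w \<bullet> (Dg (fst z) v *v u))
      + b1 (en z) * (GamP z v \<bullet> u) * (snd z \<bullet> w) + b1 (en z) * (snd z \<bullet> u) * (GamP z v \<bullet> w)" for u v
    using den_hor[of z v] by (simp add: DGG_def hor_def inner_add_left) (simp add: inner_commute)
  have gK: "(gm (fst z) *v u) \<bullet> Gam (fst z) v w = K (fst z) v w \<bullet> u" for u v w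
    using gm_inner[OF q, of "Gam (fst z) v w" u] gm_Gam[OF q, of v w] by (simp add: inner_commute)
  have dGam: "DGamP z (0, GG z u) v \<bullet> w = a1 (en z) * (K (fst z) v w \<bullet> u)
      + b1 (en z) * (snd z \<bullet> u) * (GamP z v \<bullet> w)" for u v
    using gK[of u v w]
    by (simp add: DGamP_inner[OF z] GG_def inner_add_left GamP_inner[OF z] linear_0[OF linear_DGam1[OF q]])
  have "GamP z v \<bullet> u = GamP z u \<bullet> v"
    using GamP_symmetric[OF z, of v u] by (simp add: inner_commute)
  moreover have "w \<bullet> (Dg (fst z) v *v u) = K (fst z) v u \<bullet> w + K (fst z) v w \<bullet> u" for u v
    by (rule K_compat[OF q])
  moreover have "K (fst z) v u = K (fst z) u v" by (rule K_commute[OF q])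
  ultimately show "(DGamP z (0, GG z u) v - DGG z (hor z v) u + (DGG z (hor z u) v - DGamP z (0, GG z v) u)) \<bullet> w = 0 \<bullet> w"
    by (simp add: inner_add_left inner_diff_left dGG dGam algebra_simps)
qed

text \<open>The bracket of two horizontal lifts of constant vectors is vertical; its component is
  the curvature of the horizontal distribution, that is, the curvature of M contracted with
  p.\<close>

lemma bracket_hor:
  assumes z: "z \<in> TS"
  shows "(DGamP z (hor z u) v - DGamP z (hor z v) u) \<bullet> w = snd z \<bullet> Riem (fst z) u v w"
proof -
  have "GamP z u \<bullet> y = snd z \<bullet> Gam (fst z) u y" for u y by (rule GamP_inner[OF z])
  then show ?thesis
    by (simp add: inner_diff_left DGamP_inner[OF z] Riem_def inner_diff_right inner_add_right)
      (simp add: hor_def)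
qed

lemma xx_GG: "z \<in> TS \<Longrightarrow> xx z \<bullet> GG z u = (a1 (en z) + 2 * en z * b1 (en z)) * (snd z \<bullet> u)"
  by (simp add: GG_def inner_add_right xx_gm inner_commute[of "xx z" "snd z"] snd_xx algebra_simps
     )

text \<open>Since dt takes the value (a1 + 2 t b1) (p, u) on the vertical vector
  \<open>(0, GG z u)\<close>, the term with \<open>a1'\<close> gives the first half of
  \<open>FF\<close>; differentiating the product \<open>p\<^sub>i p\<^sub>j\<close> gives - a1 b1.
  The contributions of \<open>b1'\<close> and of the square of b1 are symmetric in \<open>u\<close>
  and \<open>v\<close> and cancel.\<close>

lemma bracket_JJ_hor:
  assumes z: "z \<in> TS"
  shows "DGG z (0, GG z u) v - DGG z (0, GG z v) u =
    FF (en z) *\<^sub>R ((snd z \<bullet> u) *\<^sub>R (gm (fst z) *v v) - (snd z \<bullet> v) *\<^sub>R (gm (fst z) *v u))"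
proof -
  have q: "fst z \<in> S" using z by auto
  have "(gm (fst z) *v u) \<bullet> v = (gm (fst z) *v v) \<bullet> u"
    using gm_inner[OF q, of u v] by (simp add: inner_commute)
  then have sym: "GG z u \<bullet> v = GG z v \<bullet> u"
    by (simp add: GG_def inner_add_left)
  show ?thesis
    unfolding DGG_def den_vertical[OF z] xx_GG[OF z]
    by (simp add: sym linear_0[OF linear_Dg[OF q]]) (simp add: GG_def FF_def algebra_simps)
qed

lemma Nij_hor:
  assumes z: "z \<in> TS"
  shows "J.Nij z (hor z u) (hor z v) =
    (0, FF (en z) *\<^sub>R ((snd z \<bullet> u) *\<^sub>R (gm (fst z) *v v) - (snd z \<bullet> v) *\<^sub>R (gm (fst z) *v u))
        - (DGamP z (hor z u) v - DGamP z (hor z v) u))"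
proof -
  have d: "(\<lambda>y. hor y u) differentiable (at z)" for u
    using hor_has_derivative[OF z] by (auto simp: differentiable_def)
  have Dh: "frechet_derivative (\<lambda>y. hor y u) (at z) = (\<lambda>d. (0, DGamP z d u))" for u
    by (rule frechet_derivative_eqI[OF hor_has_derivative[OF z]])
  have DJ: "frechet_derivative (\<lambda>y. JJ y (hor y u)) (at z) = (\<lambda>d. (0, DGG z d u))" for u
    by (rule frechet_derivative_eqI[OF JJ_hor_has_derivative[OF z]])
  let ?A = "(0::real^'n, DGamP z (0, GG z u) v - DGG z (hor z v) u)"
  let ?B = "(0::real^'n, DGG z (hor z u) v - DGamP z (0, GG z v) u)"
  \<comment> \<open>\<open>?A\<close> and \<open>?B\<close> are the brackets [J X, Y] and [X, J Y]
    of horizontal lifts X, Y. They enter the Nijenhuis tensor under \<open>JJ\<close>, so they make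
    up its horizontal part.\<close>
  have 0: "?A + ?B = 0" using Nij_horizontal_part[OF z, of u v] by (simp add: prod_eq_iff)
  have AB: "JJ z ?A + JJ z ?B = 0"
    unfolding linear_add[OF linear_JJ[OF z], symmetric] 0 by (rule linear_0[OF linear_JJ[OF z]])
  have "J.Nij z (hor z u) (hor z v) = nijenhuis JJ (\<lambda>y. hor y u) (\<lambda>y. hor y v) z"
    using J.nijenhuis_eq_Nij[OF z d d, of u v] by simp
  also have "\<dots> = (0, DGG z (0, GG z u) v - DGG z (0, GG z v) u) - (JJ z ?A + JJ z ?B)
      - (0, DGamP z (hor z u) v - DGamP z (hor z v) u)"
    unfolding nijenhuis_def lie_bracket_def Dh DJ JJ_hor[OF z] by simp
  finally show ?thesis
    unfolding AB bracket_JJ_hor[OF z] by simp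
qed

lemma Nij_vanishes_iff:
  assumes z: "z \<in> TS"
  shows "(\<forall>U V. J.Nij z U V = 0) \<longleftrightarrow>
    (\<forall>u v w. FF (en z) * ((snd z \<bullet> u) * (w \<bullet> (gm (fst z) *v v)) - (snd z \<bullet> v) * (w \<bullet> (gm (fst z) *v u)))
       = snd z \<bullet> Riem (fst z) u v w)" (is "?L \<longleftrightarrow> ?R")
proof -
  have "?R \<longleftrightarrow> (\<forall>u v. J.Nij z (hor z u) (hor z v) = 0)"
  proof -
    have "x = 0 \<longleftrightarrow> (\<forall>w. x \<bullet> w = 0)" for x :: "real^'n"
      by (metis inner_eq_zero_iff inner_zero_left)
    then have "J.Nij z (hor z u) (hor z v) = 0 \<longleftrightarrow> (\<forall>w. (FF (en z) *\<^sub>R ((snd z \<bullet> u) *\<^sub>R (gm (fst z) *v v)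
        - (snd z \<bullet> v) *\<^sub>R (gm (fst z) *v u)) - (DGamP z (hor z u) v - DGamP z (hor z v) u)) \<bullet> w = 0)" for u v
      unfolding Nij_hor[OF z] by (simp add: prod_eq_iff)
    then show ?thesis
      unfolding inner_diff_left[of "FF (en z) *\<^sub>R _"] bracket_hor[OF z]
      by (simp add: inner_diff_left inner_diff_right inner_commute)
  qed
  moreover have "?L" if "\<forall>u v. J.Nij z (hor z u) (hor z v) = 0"
  proof (rule allI, rule allI, rule J.Nij_zero[OF z, of "range (hor z)"])
    fix U
    \<comment> \<open>Because \<open>GG\<close> is onto, every vertical vector is the image under
      \<open>JJ\<close> of a horizontal one.\<close>
    have "U = hor z (fst U) + JJ z (hor z (HH z (snd U - GamP z (fst U))))"
      unfolding JJ_hor[OF z] GG_HH[OF z] by (rule hor_vertical_split)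
    then show "\<exists>u\<in>range (hor z). \<exists>w\<in>range (hor z). U = u + JJ z w" by blast
  qed (use that in auto)
  ultimately show ?thesis by blast
qed

section \<open>The exterior derivative of the fundamental form\<close>

lemma ph_has_derivative:
  assumes z: "z \<in> TS"
  shows "((\<lambda>y. ph y V W) has_derivative (\<lambda>U. lam' (en z) * den z U * Om V W
    + mu' (en z) * den z U * (den z V * (snd z \<bullet> fst W) - den z W * (snd z \<bullet> fst V))
    + mu (en z) * (D2en z U V * (snd z \<bullet> fst W) + den z V * (snd U \<bullet> fst W)
        - D2en z U W * (snd z \<bullet> fst V) - den z W * (snd U \<bullet> fst V)))) (at z)"
  unfolding ph_def[abs_def]
  by (rule derivative_eq_intros den_has_derivative z snd_has_derivative
        coefficient_has_derivative lam_deriv mu_deriv refl | assumption)+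
    (simp add: fun_eq_iff algebra_simps)

text \<open>In the alternating sum the terms with \<open>mu'\<close> cancel as in dt \<and> dt = 0,
  and the second derivatives of t cancel by symmetry. Agreement of \<omega> with \<open>ph\<close>
  on the open set \<open>TS\<close> is enough, since only derivatives at points of it are
  taken.\<close>

lemma exterior_deriv2_ph:
  assumes z: "z \<in> TS" and \<omega>: "\<And>y U V. y \<in> TS \<Longrightarrow> \<omega> y U V = ph y U V"
  shows "exterior_deriv2 \<omega> z U V W =
    (lam' (en z) - mu (en z)) * (den z U * Om V W - den z V * Om U W + den z W * Om U V)"
proof -
  have "frechet_derivative (\<lambda>y. \<omega> y V W) (at z) = (\<lambda>U. lam' (en z) * den z U * Om V W
    + mu' (en z) * den z U * (den z V * (snd z \<bullet> fst W) - den z W * (snd z \<bullet> fst V))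
    + mu (en z) * (D2en z U V * (snd z \<bullet> fst W) + den z V * (snd U \<bullet> fst W)
        - D2en z U W * (snd z \<bullet> fst V) - den z W * (snd U \<bullet> fst V)))" for V W
    by (rule frechet_derivative_eqI[OF has_derivative_transform_within_open[OF ph_has_derivative[OF z] open_TS z]])
      (simp add: \<omega>)
  then show ?thesis
    unfolding exterior_deriv2_def
    using D2en_commute[OF z, of U V] D2en_commute[OF z, of U W] D2en_commute[OF z, of V W]
    by (simp add: Om_def algebra_simps inner_commute)
qed

lemma closed_iff:
  assumes z: "z \<in> TS" and \<omega>: "\<And>y U V. y \<in> TS \<Longrightarrow> \<omega> y U V = ph y U V" and n: "CARD('n) > 1"
    and p: "snd z \<noteq> 0"
  shows "(\<forall>U V W. exterior_deriv2 \<omega> z U V W = 0) \<longleftrightarrow> mu (en z) = lam' (en z)"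
proof
  assume L: "\<forall>U V W. exterior_deriv2 \<omega> z U V W = 0"
  have x: "xx z \<noteq> 0" using gm_xx[OF z] p by (metis matrix_vector_mult_0_right)
  \<comment> \<open>Here n > 1 enters. On the test vectors \<open>(0, xx z)\<close>,
    \<open>(0, w)\<close>, \<open>hor z w\<close> the form dt is nonzero only on the first, and
    \<open>Om\<close> pairs the other two to the square of the norm of \<open>w\<close>.\<close>
  obtain w where w: "w \<noteq> 0" "orthogonal (xx z) w"
    using orthogonal_to_vector_exists[of "xx z"] n by auto
  have "den z (0, xx z) * Om (0, w) (hor z w) - den z (0, w) * Om (0, xx z) (hor z w)
      + den z (hor z w) * Om (0, xx z) (0, w) = (xx z \<bullet> xx z) * (w \<bullet> w)"
    unfolding den_vertical[OF z] den_hor using w(2) by (simp add: orthogonal_def Om_def hor_def)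
  moreover have "(xx z \<bullet> xx z) * (w \<bullet> w) \<noteq> 0" using x w by simp
  moreover have "exterior_deriv2 \<omega> z (0, xx z) (0, w) (hor z w) = 0" using L by blast
  ultimately show "mu (en z) = lam' (en z)"
    using exterior_deriv2_ph[OF z \<omega>, of "(0, xx z)" "(0, w)" "hor z w"] by simp
qed (simp add: exterior_deriv2_ph[OF z \<omega>])

end

context natural_structure
begin

text \<open>\<open>Gb\<close> pairs horizontal with horizontal and vertical with vertical vectors,
  and \<open>JJ\<close> exchanges the two kinds; so only the vertical part of \<open>U\<close>
  against \<open>GG z (fst V)\<close> and its horizontal part against the lift of
  \<open>HH z w'\<close> contribute.\<close>

lemma form_eq_ph:
  assumes z: "z \<in> TS" and Gb: "bilinear Gb"
    and hh: "\<And>u v. Gb (hor z u) (hor z v) = lam (en z) * a1 (en z) * (u \<bullet> (gm (fst z) *v v))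
      + (lam (en z) * b1 (en z) + mu (en z) * (a1 (en z) + 2 * en z * b1 (en z))) * (snd z \<bullet> u) * (snd z \<bullet> v)"
    and vv: "\<And>u v. Gb (0, u) (0, v) = lam (en z) * (1 / a1 (en z)) * (u \<bullet> (gi (fst z) *v v))
      + (lam (en z) * b2 (en z) + mu (en z) * (1 / a1 (en z) + 2 * en z * b2 (en z))) * (xx z \<bullet> u) * (xx z \<bullet> v)"
    and vh: "\<And>u v. Gb (0, u) (hor z v) = 0" and hv: "\<And>u v. Gb (hor z u) (0, v) = 0"
  shows "Gb U (JJ z V) = ph z U V"
proof -
  define t where "t = en z"
  define e where "e = a1 t + 2 * t * b1 t"
  have t: "t \<ge> 0" using en_nonneg[OF z] by (simp add: t_def)
  have a: "a1 t > 0" and e: "e > 0" using a1_pos[OF t] a1_b1_pos[OF t] by (simp_all add: e_def)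
  have q: "fst z \<in> S" using z by auto
  have b2: "b2 t = - b1 t / (a1 t * e)" by (simp add: b2_def e_def)
  \<comment> \<open>In the radial direction \<open>GG\<close> scales by \<open>e\<close> relative to
    the metric and its inverse \<open>HH\<close> by 1 / \<open>e\<close>.\<close>
  have inv: "1 / a1 t + 2 * t * b2 t = 1 / e"
    using a e unfolding b2 by (simp add: divide_simps) (simp add: e_def algebra_simps)
  \<comment> \<open>The prescribed coefficients d1 and d2 are such that both radial corrections
    collapse to \<open>mu t\<close>, with \<open>lam t\<close> dropping out.\<close>
  have D2: "lam t * (1 / a1 t) * b1 t + (lam t * b2 t + mu t * (1 / e)) * e = mu t"
    using a e unfolding b2 by (simp add: field_simps)
  have D1: "lam t * a1 t * b2 t + (lam t * b1 t + mu t * e) * (1 / e) = mu t"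
    using a e unfolding b2 by (simp add: field_simps)
  define w where "w = snd U - GamP z (fst U)"
  define w' where "w' = snd V - GamP z (fst V)"
  have U: "U = hor z (fst U) + (0, w)" unfolding w_def by (rule hor_vertical_split)
  have J: "JJ z V = (0, GG z (fst V)) - hor z (HH z w')" by (simp add: JJ_def w'_def)
  have 1: "w \<bullet> (gi (fst z) *v GG z v) = a1 t * (w \<bullet> v) + b1 t * (snd z \<bullet> v) * (xx z \<bullet> w)" for v
    by (simp add: GG_def t_def matrix_vector_right_distrib matrix_vector_mult_scaleR gi_gm q
        xx_def[symmetric] inner_add_right inner_commute[of w "xx z"])
  have 2: "xx z \<bullet> GG z v = e * (snd z \<bullet> v)" for v
    using xx_GG[OF z] by (simp add: e_def t_def)
  have 3: "u \<bullet> (gm (fst z) *v HH z w') = (1 / a1 t) * (u \<bullet> w') + b2 t * (xx z \<bullet> w') * (snd z \<bullet> u)" for u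
    by (simp add: HH_def t_def matrix_vector_right_distrib matrix_vector_mult_scaleR gm_gi q
        gm_xx[OF z] inner_add_right inner_commute[of u "snd z"])
  have 4: "snd z \<bullet> HH z w' = (1 / e) * (xx z \<bullet> w')"
    unfolding inv[symmetric]
    by (simp add: HH_def t_def inner_add_right inner_gi_snd[OF z] snd_xx algebra_simps)
  have "Gb U (JJ z V) = Gb (0, w) (0, GG z (fst V)) - Gb (hor z (fst U)) (hor z (HH z w'))"
    unfolding J by (subst U) (simp add: bilinear_ladd[OF Gb] bilinear_rsub[OF Gb] vh hv)
  also have "\<dots> = lam t * (1 / a1 t) * (a1 t * (w \<bullet> fst V) + b1 t * (snd z \<bullet> fst V) * (xx z \<bullet> w))
      + (lam t * b2 t + mu t * (1 / e)) * (xx z \<bullet> w) * (e * (snd z \<bullet> fst V))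
      - (lam t * a1 t * ((1 / a1 t) * (fst U \<bullet> w') + b2 t * (xx z \<bullet> w') * (snd z \<bullet> fst U))
      + (lam t * b1 t + mu t * e) * (snd z \<bullet> fst U) * ((1 / e) * (xx z \<bullet> w')))"
    unfolding vv hh t_def[symmetric] e_def[symmetric] inv 1 2 3 4 by simp
  also have "\<dots> = lam t * (w \<bullet> fst V) + (lam t * (1 / a1 t) * b1 t + (lam t * b2 t + mu t * (1 / e)) * e)
        * ((xx z \<bullet> w) * (snd z \<bullet> fst V))
      - (lam t * (fst U \<bullet> w') + (lam t * a1 t * b2 t + (lam t * b1 t + mu t * e) * (1 / e))
        * ((xx z \<bullet> w') * (snd z \<bullet> fst U)))"
    using a by (simp add: algebra_simps)
  also have "\<dots> = lam t * (w \<bullet> fst V - fst U \<bullet> w') + mu t * ((xx z \<bullet> w) * (snd z \<bullet> fst V) - (xx z \<bullet> w') * (snd z \<bullet> fst U))"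
    unfolding D1 D2 by (simp add: algebra_simps)
  \<comment> \<open>Replacing dp by its vertical part leaves the symplectic form unchanged: the
    Christoffel terms cancel because the connection is torsion-free.\<close>
  also have "w \<bullet> fst V - fst U \<bullet> w' = Om U V"
    using GamP_symmetric[OF z, of "fst U" "fst V"] by (simp add: w_def w'_def Om_def inner_diff_left inner_diff_right)
  also have "xx z \<bullet> w = den z U" by (simp add: w_def den_def inner_diff_right)
  also have "xx z \<bullet> w' = den z V" by (simp add: w'_def den_def inner_diff_right)
  finally show ?thesis by (simp add: ph_def t_def)
qed

text \<open>Rescaling the covector \<open>p\<close> changes \<open>t\<close> but neither the curvature nor the direction of
  \<open>p\<close>, so \<open>FF\<close> is constant.\<close>

lemma FF_constant_curvature:
  assumes n: "CARD('n) > 1" and q: "q \<in> S" and cont: "continuous_on {0..} FF"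
    and eq: "\<And>p u v w. FF (en (q, p)) * ((p \<bullet> u) * (w \<bullet> (gm q *v v)) - (p \<bullet> v) * (w \<bullet> (gm q *v u)))
       = p \<bullet> Riem q u v w"
  shows "t \<ge> 0 \<Longrightarrow> FF t = FF 0"
    and "Riem q u v w = FF 0 *\<^sub>R ((w \<bullet> (gm q *v v)) *\<^sub>R u - (w \<bullet> (gm q *v u)) *\<^sub>R v)"
proof -
  obtain p :: "real^'n" where p: "p \<noteq> 0" using vector_choose_size[of 1] by force
  obtain v\<^sub>0 where v: "v\<^sub>0 \<noteq> 0" "orthogonal p v\<^sub>0"
    using orthogonal_to_vector_exists[of p] n by auto
  define e where "e = en (q, p)"
  have e: "e > 0" using gi_positive[OF q p] by (simp add: e_def en_def xx_def)
  \<comment> \<open>With u = p and v = w = \<open>v\<^sub>0\<close>, orthogonality removes the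
    second product, and the first one is \<open>FF\<close> times the positive number
    \<open>K\<close>.\<close>
  define K where "K = (p \<bullet> p) * (v\<^sub>0 \<bullet> (gm q *v v\<^sub>0))"
  have K: "K > 0" using p gm_positive[OF q v(1)] by (simp add: K_def)
  have pos: "FF t = p \<bullet> Riem q p v\<^sub>0 v\<^sub>0 / K" if "t > 0" for t
  proof -
    \<comment> \<open>The energy is quadratic in the covector, so \<open>s *\<^sub>R p\<close> has
      energy exactly \<open>t\<close>.\<close>
    define s where "s = sqrt (t / e)"
    have s: "s > 0" using that e by (simp add: s_def)
    have "en (q, s *\<^sub>R p) = s\<^sup>2 * e"
      by (simp add: e_def en_def xx_def matrix_vector_mult_scaleR power2_eq_square)
    also have "\<dots> = t" using that e by (simp add: s_def)
    finally have "FF t * (s * K) = s * (p \<bullet> Riem q p v\<^sub>0 v\<^sub>0)"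
      using eq[of "s *\<^sub>R p" p v\<^sub>0 v\<^sub>0] v by (simp add: K_def orthogonal_def mult.assoc)
    then show ?thesis using s K by (simp add: field_simps)
  qed
  have cl: "closure {0<..} = {0::real..}" by simp
  \<comment> \<open>Only p = 0 has energy 0, where the identity is void; the value at 0 is therefore
    a limit from positive \<open>t\<close>.\<close>
  have const: "FF t = p \<bullet> Riem q p v\<^sub>0 v\<^sub>0 / K" if "t \<ge> 0" for t
    by (rule continuous_constant_on_closure[of "{0<..}" FF]) (use cont pos that in \<open>simp_all add: cl\<close>)
  then show *: "FF t = FF 0" if "t \<ge> 0" for t using that by simp
  have "p \<bullet> Riem q u v w = p \<bullet> (FF 0 *\<^sub>R ((w \<bullet> (gm q *v v)) *\<^sub>R u - (w \<bullet> (gm q *v u)) *\<^sub>R v))" for p u v w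
    using eq[of p u w v] *[OF en_nonneg[of "(q, p)"]] q by (simp add: inner_diff_right mult.commute)
  then show "Riem q u v w = FF 0 *\<^sub>R ((w \<bullet> (gm q *v v)) *\<^sub>R u - (w \<bullet> (gm q *v u)) *\<^sub>R v)"
    by (rule vector_eq_ldot[THEN iffD1, rule_format])
qed

text \<open>If \<open>FF\<close> is the constant \<open>c\<close>, then \<open>h = a\<^sub>1\<^sup>2 - 2 t c\<close> satisfies \<open>h' = k h\<close> with
  \<open>k = 2 b\<^sub>1 / (a\<^sub>1 + 2 t b\<^sub>1)\<close>, and \<open>h = (a\<^sub>1 - 2 t a\<^sub>1') (a\<^sub>1 + 2 t b\<^sub>1)\<close>; so the denominator
  of the formula for \<open>b\<^sub>1\<close> cannot vanish.\<close>

lemma FF_constant_denominator: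
  assumes FF: "\<And>t. t \<ge> 0 \<Longrightarrow> FF t = c" and t: "t \<ge> 0"
  shows "a1 t - 2 * t * a1' t > 0"
proof -
  define h where "h s = (a1 s)\<^sup>2 - 2 * s * c" for s
  have h: "h s = (a1 s - 2 * s * a1' s) * (a1 s + 2 * s * b1 s)" if "s \<ge> 0" for s
    unfolding h_def FF[OF that, symmetric] FF_def by (simp add: power2_eq_square algebra_simps)
  have "h t > 0"
  proof (rule linear_ode_positive[of h "\<lambda>s. 2 * b1 s / (a1 s + 2 * s * b1 s)"])
    fix s :: real assume s: "s \<ge> 0"
    have "(h has_real_derivative 2 * a1 s * a1' s - 2 * c) (at s within {0..})"
      unfolding h_def[abs_def] by (auto intro!: derivative_eq_intros a1_deriv s)
    moreover have "2 * a1 s * a1' s - 2 * c = 2 * b1 s * (a1 s - 2 * s * a1' s)"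
      unfolding FF[OF s, symmetric] FF_def by (simp add: algebra_simps)
    moreover have "2 * b1 s / (a1 s + 2 * s * b1 s) * h s = 2 * b1 s * (a1 s - 2 * s * a1' s)"
      unfolding h[OF s] using a1_b1_pos[OF s] by simp
    ultimately show "(h has_real_derivative 2 * b1 s / (a1 s + 2 * s * b1 s) * h s) (at s within {0..})"
      by simp
  next
    have "continuous_on {0..} a1" "continuous_on {0..} b1"
      using a1_deriv b1_deriv by (auto intro!: DERIV_continuous_on)
    then show "continuous_on {0..} (\<lambda>s. 2 * b1 s / (a1 s + 2 * s * b1 s))"
      using a1_b1_pos by (force intro!: continuous_intros)
    show "h 0 > 0" using a1_pos[of 0] by (simp add: h_def)
  qed (rule t)
  then show ?thesis
    unfolding h[OF t] using a1_b1_pos[OF t] by (simp add: zero_less_mult_iff)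
qed

text \<open>\<open>FF t = c\<close> is the linear equation b1 (a1 - 2 t a1') = a1 a1' - c for b1.
  Solving it needs a nonzero denominator, which the right-hand side states and
  \<open>FF_constant_denominator\<close> derives from the left-hand side.\<close>

lemma FF_constant_iff:
  "(\<forall>t\<ge>0. FF t = c) \<longleftrightarrow>
    (\<forall>t\<ge>0. a1 t - 2 * t * a1' t \<noteq> 0 \<and> b1 t = (a1 t * a1' t - c) / (a1 t - 2 * t * a1' t))"
proof -
  have "FF t = c \<longleftrightarrow> b1 t = (a1 t * a1' t - c) / (a1 t - 2 * t * a1' t)"
    if "a1 t - 2 * t * a1' t \<noteq> 0" for t
  proof -
    have "FF t = c \<longleftrightarrow> b1 t * (a1 t - 2 * t * a1' t) = a1 t * a1' t - c"
      by (auto simp: FF_def algebra_simps)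
    then show ?thesis using that by (simp add: eq_divide_eq)
  qed
  moreover have "a1 t - 2 * t * a1' t \<noteq> 0" if "\<forall>t\<ge>0. FF t = c" "t \<ge> 0" for t
    using FF_constant_denominator[of c t] that by auto
  ultimately show ?thesis by meson
qed

end

section \<open>Tangent vectors and the induced atlas\<close>

text \<open>The part of the manifold structure used for tangent vectors; it is shared by an atlas of
  \<open>M\<close> and the induced atlas of its cotangent bundle.\<close>

locale diff_atlas =
  fixes B :: "('m, 'e::euclidean_space) chart set"
  assumes chart_inj: "\<kappa> \<in> B \<Longrightarrow> inj_on (chart_map \<kappa>) (chart_dom \<kappa>)"
    and open_chart_image: "\<kappa> \<in> B \<Longrightarrow> open (chart_image \<kappa>)"
    and open_overlap: "\<kappa> \<in> B \<Longrightarrow> \<kappa>' \<in> B \<Longrightarrow> open (chart_map \<kappa> ` (chart_dom \<kappa> \<inter> chart_dom \<kappa>'))"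
    and transition_differentiable: "\<kappa> \<in> B \<Longrightarrow> \<kappa>' \<in> B \<Longrightarrow> x \<in> chart_dom \<kappa> \<Longrightarrow> x \<in> chart_dom \<kappa>' \<Longrightarrow>
      (chart_map \<kappa>' \<circ> chart_inv \<kappa>) differentiable (at (chart_map \<kappa> x))"
begin

lemma chart_inv_map: "\<kappa> \<in> B \<Longrightarrow> x \<in> chart_dom \<kappa> \<Longrightarrow> chart_inv \<kappa> (chart_map \<kappa> x) = x"
  by (simp add: chart_inv_def chart_inj)

lemma chart_map_inv: "z \<in> chart_image \<kappa> \<Longrightarrow> chart_map \<kappa> (chart_inv \<kappa> z) = z"
  and chart_inv_dom: "z \<in> chart_image \<kappa> \<Longrightarrow> chart_inv \<kappa> z \<in> chart_dom \<kappa>"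
  by (simp_all add: chart_inv_def chart_image_def f_inv_into_f inv_into_into)

lemma chart_map_image: "x \<in> chart_dom \<kappa> \<Longrightarrow> chart_map \<kappa> x \<in> chart_image \<kappa>"
  by (simp add: chart_image_def)

lemma change_of_chart:
  assumes \<kappa>: "\<kappa> \<in> B" "x \<in> chart_dom \<kappa>" and \<kappa>': "\<kappa>' \<in> B" "x \<in> chart_dom \<kappa>'"
    and f: "((f \<circ> chart_inv \<kappa>') has_derivative f') (at (chart_map \<kappa>' x))"
  shows "((f \<circ> chart_inv \<kappa>) has_derivative
    (\<lambda>w. f' (frechet_derivative (chart_map \<kappa>' \<circ> chart_inv \<kappa>) (at (chart_map \<kappa> x)) w))) (at (chart_map \<kappa> x))"
proof -
  have D: "((chart_map \<kappa>' \<circ> chart_inv \<kappa>) has_derivative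
      frechet_derivative (chart_map \<kappa>' \<circ> chart_inv \<kappa>) (at (chart_map \<kappa> x))) (at (chart_map \<kappa> x))"
    using transition_differentiable[OF \<kappa>(1) \<kappa>'(1) \<kappa>(2) \<kappa>'(2)] frechet_derivative_works by blast
  have eq: "(chart_map \<kappa>' \<circ> chart_inv \<kappa>) (chart_map \<kappa> x) = chart_map \<kappa>' x"
    by (simp add: chart_inv_map[OF \<kappa>])
  have "((\<lambda>z. (f \<circ> chart_inv \<kappa>') ((chart_map \<kappa>' \<circ> chart_inv \<kappa>) z)) has_derivative
    (\<lambda>w. f' (frechet_derivative (chart_map \<kappa>' \<circ> chart_inv \<kappa>) (at (chart_map \<kappa> x)) w))) (at (chart_map \<kappa> x))"
    by (rule has_derivative_compose[OF D]) (unfold eq, rule f)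
  then show ?thesis
  proof (rule has_derivative_transform_within_open[OF _ open_overlap[OF \<kappa>(1) \<kappa>'(1)]])
    show "chart_map \<kappa> x \<in> chart_map \<kappa> ` (chart_dom \<kappa> \<inter> chart_dom \<kappa>')" using \<kappa> \<kappa>' by blast
  qed (auto simp: chart_inv_map \<kappa> \<kappa>')
qed

text \<open>\<open>smooth_near\<close> provides smoothness in some chart only; the transition map
  carries differentiability over to the given one.\<close>

lemma smooth_near_has_derivative:
  assumes f: "smooth_near B x f" and \<kappa>: "\<kappa> \<in> B" "x \<in> chart_dom \<kappa>"
  shows "((f \<circ> chart_inv \<kappa>) has_derivative frechet_derivative (f \<circ> chart_inv \<kappa>) (at (chart_map \<kappa> x)))
    (at (chart_map \<kappa> x))"
proof -
  obtain \<kappa>' W where \<kappa>': "\<kappa>' \<in> B" "x \<in> chart_dom \<kappa>'" and W: "open W" "chart_map \<kappa>' x \<in> W"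
      "smooth_on W (f \<circ> chart_inv \<kappa>')"
    using f unfolding smooth_near_def by blast
  obtain f' where "((f \<circ> chart_inv \<kappa>') has_derivative f') (at (chart_map \<kappa>' x))"
    using smooth_on_open_differentiable[OF W(3,1,2)] by (auto simp: differentiable_def)
  from change_of_chart[OF \<kappa> \<kappa>' this] show ?thesis
    using frechet_derivative_works differentiable_def by blast
qed

lemma linear_coord_vec:
  assumes "\<kappa> \<in> B" "x \<in> chart_dom \<kappa>" shows "linear (\<lambda>w. coord_vec B \<kappa> x w f)"
proof (cases "smooth_near B x f")
  case True
  show ?thesis
    unfolding coord_vec_def if_P[OF True]
    by (rule has_derivative_linear[OF smooth_near_has_derivative[OF True assms]])
next
  case False
  show ?thesis unfolding coord_vec_def if_not_P[OF False] by (rule linear_zero)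
qed

lemma coord_vec_combination:
  assumes "\<kappa> \<in> B" "x \<in> chart_dom \<kappa>"
  shows "(\<lambda>f. r * coord_vec B \<kappa> x u f + s * coord_vec B \<kappa> x v f) = coord_vec B \<kappa> x (r *\<^sub>R u + s *\<^sub>R v)"
  using linear_add[OF linear_coord_vec[OF assms]] linear_scale[OF linear_coord_vec[OF assms]]
  by (simp add: fun_eq_iff)

lemma coord_vec_change:
  assumes \<kappa>: "\<kappa> \<in> B" "x \<in> chart_dom \<kappa>" and \<kappa>': "\<kappa>' \<in> B" "x \<in> chart_dom \<kappa>'"
  shows "coord_vec B \<kappa> x w =
    coord_vec B \<kappa>' x (frechet_derivative (chart_map \<kappa>' \<circ> chart_inv \<kappa>) (at (chart_map \<kappa> x)) w)"
proof (rule ext)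
  fix f
  show "coord_vec B \<kappa> x w f =
    coord_vec B \<kappa>' x (frechet_derivative (chart_map \<kappa>' \<circ> chart_inv \<kappa>) (at (chart_map \<kappa> x)) w) f"
    using frechet_derivative_eqI[OF change_of_chart[OF \<kappa> \<kappa>' smooth_near_has_derivative[OF _ \<kappa>']]]
    by (simp add: coord_vec_def)
qed

lemma tangent_space_eq:
  assumes \<kappa>: "\<kappa> \<in> B" "x \<in> chart_dom \<kappa>" shows "tangent_space B x = range (coord_vec B \<kappa> x)"
  using coord_vec_change[OF _ _ \<kappa>] \<kappa> unfolding tangent_space_def by blast

text \<open>\<open>coord_vec\<close> returns 0 on functions not smooth near the point, so this is
  what lets \<open>tvec_coords\<close> recover the coordinates of a vector.\<close>

lemma coordinate_smooth_near:
  assumes \<kappa>: "\<kappa> \<in> B" "x \<in> chart_dom \<kappa>" shows "smooth_near B x (\<lambda>y. chart_map \<kappa> y \<bullet> b)"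
proof -
  have "smooth_on (chart_image \<kappa>) (\<lambda>z. z \<bullet> b)"
    by (intro smooth_on_bounded_linear open_chart_image \<kappa> bounded_linear_inner_left)
  then have "smooth_on (chart_image \<kappa>) ((\<lambda>y. chart_map \<kappa> y \<bullet> b) \<circ> chart_inv \<kappa>)"
    by (subst smooth_on_cong[of _ _ "\<lambda>z. z \<bullet> b"]) (simp_all add: chart_map_inv)
  then show ?thesis
    unfolding smooth_near_def
    by (intro bexI[of _ \<kappa>] conjI exI[of _ "chart_image \<kappa>"] \<kappa> open_chart_image chart_map_image subset_refl)
qed

lemma tvec_coords_coord_vec:
  assumes \<kappa>: "\<kappa> \<in> B" "x \<in> chart_dom \<kappa>" shows "tvec_coords \<kappa> (coord_vec B \<kappa> x w) = w"
proof -
  have "coord_vec B \<kappa> x w (\<lambda>y. chart_map \<kappa> y \<bullet> b) = w \<bullet> b" for b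
  proof -
    have "((\<lambda>z. z \<bullet> b) has_derivative (\<lambda>z. z \<bullet> b)) (at (chart_map \<kappa> x))"
      by (intro bounded_linear_imp_has_derivative bounded_linear_inner_left)
    then have "((\<lambda>y. chart_map \<kappa> y \<bullet> b) \<circ> chart_inv \<kappa> has_derivative (\<lambda>z. z \<bullet> b)) (at (chart_map \<kappa> x))"
      by (rule has_derivative_transform_within_open[OF _ open_chart_image[OF \<kappa>(1)] chart_map_image[OF \<kappa>(2)]])
        (simp add: chart_map_inv)
    from frechet_derivative_eqI[OF this] show ?thesis
      by (simp add: coord_vec_def coordinate_smooth_near[OF \<kappa>])
  qed
  then show ?thesis by (simp add: tvec_coords_def euclidean_representation)
qed

lemma coord_vec_tvec_coords:
  "\<kappa> \<in> B \<Longrightarrow> x \<in> chart_dom \<kappa> \<Longrightarrow> v \<in> tangent_space B x \<Longrightarrow> coord_vec B \<kappa> x (tvec_coords \<kappa> v) = v"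
  by (auto simp: tangent_space_eq tvec_coords_coord_vec)

lemma coord_vec_in_tangent_space:
  "\<kappa> \<in> B \<Longrightarrow> x \<in> chart_dom \<kappa> \<Longrightarrow> coord_vec B \<kappa> x w \<in> tangent_space B x"
  by (simp add: tangent_space_eq)

lemma linear_functional:
  assumes \<kappa>: "\<kappa> \<in> B" "x \<in> chart_dom \<kappa>" and p: "functional_on (tangent_space B x) p"
  shows "linear (\<lambda>w. p (coord_vec B \<kappa> x w))"
proof -
  have p': "p (coord_vec B \<kappa> x (r *\<^sub>R u + s *\<^sub>R v)) = r * p (coord_vec B \<kappa> x u) + s * p (coord_vec B \<kappa> x v)"
    for r s u v
    using p coord_vec_in_tangent_space[OF \<kappa>] unfolding functional_on_def coord_vec_combination[OF \<kappa>, symmetric]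
    by blast
  show ?thesis
    using p'[of 1 _ 1] p'[of _ _ 0] by (auto intro!: linearI)
qed

lemma bilinear_bilinear_form:
  assumes \<kappa>: "\<kappa> \<in> B" "x \<in> chart_dom \<kappa>" and F: "bilinear_form_on (tangent_space B x) F"
  shows "bilinear (\<lambda>u v. F (coord_vec B \<kappa> x u) (coord_vec B \<kappa> x v))"
  unfolding bilinear_def
proof (intro conjI allI)
  fix u
  have "functional_on (tangent_space B x) (\<lambda>v. F (coord_vec B \<kappa> x u) v)"
      "functional_on (tangent_space B x) (\<lambda>v. F v (coord_vec B \<kappa> x u))"
    using F coord_vec_in_tangent_space[OF \<kappa>] unfolding bilinear_form_on_def by blast+
  from this[THEN linear_functional[OF \<kappa>]]
  show "linear (\<lambda>v. F (coord_vec B \<kappa> x u) (coord_vec B \<kappa> x v))"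
    "linear (\<lambda>v. F (coord_vec B \<kappa> x v) (coord_vec B \<kappa> x u))" .
qed

lemma linear_tvec_coords_endomorphism:
  assumes \<kappa>: "\<kappa> \<in> B" "x \<in> chart_dom \<kappa>" and L: "endomorphism_on (tangent_space B x) L"
  shows "linear (\<lambda>w. tvec_coords \<kappa> (L (coord_vec B \<kappa> x w)))"
proof -
  have L': "L (coord_vec B \<kappa> x (r *\<^sub>R u + s *\<^sub>R v)) =
      (\<lambda>f. r * L (coord_vec B \<kappa> x u) f + s * L (coord_vec B \<kappa> x v) f)" for r s u v
    using L coord_vec_in_tangent_space[OF \<kappa>] unfolding endomorphism_on_def coord_vec_combination[OF \<kappa>, symmetric]
    by blast
  have "tvec_coords \<kappa> (\<lambda>f. r * u f + s * v f) = r *\<^sub>R tvec_coords \<kappa> u + s *\<^sub>R tvec_coords \<kappa> v" for r s u v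
    by (simp add: tvec_coords_def sum.distrib scaleR_sum_right scaleR_add_left)
  then have *: "tvec_coords \<kappa> (L (coord_vec B \<kappa> x (r *\<^sub>R u + s *\<^sub>R v))) =
     r *\<^sub>R tvec_coords \<kappa> (L (coord_vec B \<kappa> x u)) + s *\<^sub>R tvec_coords \<kappa> (L (coord_vec B \<kappa> x v))" for r s u v
    unfolding L' by simp
  show ?thesis
    using *[of 1 _ 1] *[of _ _ 0] by (auto intro!: linearI)
qed

end

lemma smooth_manifold_diff_atlas:
  assumes "smooth_manifold X A" shows "diff_atlas A"
proof
  fix \<kappa> assume \<kappa>: "\<kappa> \<in> A"
  have open_dom: "openin X (chart_dom \<kappa>)" if "\<kappa> \<in> A" for \<kappa>
    using assms that by (simp add: smooth_manifold_def)
  have hom: "homeomorphic_map (subtopology X (chart_dom \<kappa>)) (top_of_set (chart_image \<kappa>)) (chart_map \<kappa>)"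
    and op: "open (chart_image \<kappa>)"
    using assms \<kappa> by (simp_all add: smooth_manifold_def)
  have ts: "topspace (subtopology X (chart_dom \<kappa>)) = chart_dom \<kappa>"
    using openin_subset[OF open_dom[OF \<kappa>]] by auto
  show "inj_on (chart_map \<kappa>) (chart_dom \<kappa>)"
    using homeomorphic_imp_injective_map[OF hom] ts by simp
  show "open (chart_image \<kappa>)" by (rule op)
  fix \<kappa>' assume \<kappa>': "\<kappa>' \<in> A"
  have "openin (subtopology X (chart_dom \<kappa>)) (chart_dom \<kappa> \<inter> chart_dom \<kappa>')"
    using openin_subtopology_Int2 open_dom[OF \<kappa>'] by blast
  then have "openin (top_of_set (chart_image \<kappa>)) (chart_map \<kappa> ` (chart_dom \<kappa> \<inter> chart_dom \<kappa>'))"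
    using homeomorphic_imp_open_map[OF hom] by (simp add: open_map_def)
  then show op2: "open (chart_map \<kappa> ` (chart_dom \<kappa> \<inter> chart_dom \<kappa>'))"
    using op openin_open_trans by blast
  fix x assume x: "x \<in> chart_dom \<kappa>" "x \<in> chart_dom \<kappa>'"
  have "smooth_on (chart_map \<kappa> ` (chart_dom \<kappa> \<inter> chart_dom \<kappa>')) (chart_map \<kappa>' \<circ> chart_inv \<kappa>)"
    using assms \<kappa> \<kappa>' by (simp add: smooth_manifold_def)
  then show "(chart_map \<kappa>' \<circ> chart_inv \<kappa>) differentiable at (chart_map \<kappa> x)"
    by (rule smooth_on_open_differentiable[OF _ op2]) (use x in blast)
qed

text \<open>Transition maps of the cotangent bundle contain first derivatives of those of M, so
  their differentiability calls for more than the differentiable transitions of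
  \<open>diff_atlas\<close>.\<close>

locale manifold_atlas = diff_atlas A for A :: "('m, real^'n) chart set" +
  assumes transition_smooth: "\<kappa> \<in> A \<Longrightarrow> \<kappa>' \<in> A \<Longrightarrow>
    smooth_on (chart_map \<kappa> ` (chart_dom \<kappa> \<inter> chart_dom \<kappa>')) (chart_map \<kappa>' \<circ> chart_inv \<kappa>)"
begin

text \<open>The covector \<open>p\<^sub>i dx\<^sup>i\<close>, extended by zero as
  \<open>cotangent_space\<close> demands; it serves as the explicit inverse of the induced
  chart.\<close>

definition covector :: "('m, real^'n) chart \<Rightarrow> real^'n \<Rightarrow> real^'n \<Rightarrow> 'm covec" where
  "covector \<kappa> q p = (chart_inv \<kappa> q,
    \<lambda>v. if v \<in> tangent_space A (chart_inv \<kappa> q) then p \<bullet> tvec_coords \<kappa> v else 0)"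

lemma covector_in_dom:
  assumes \<kappa>: "\<kappa> \<in> A" and q: "q \<in> chart_image \<kappa>"
  shows "covector \<kappa> q p \<in> chart_dom (induced_chart A \<kappa>)"
proof -
  let ?x = "chart_inv \<kappa> q"
  have x: "?x \<in> chart_dom \<kappa>" by (rule chart_inv_dom[OF q])
  have "functional_on (tangent_space A ?x) (snd (covector \<kappa> q p))"
    unfolding functional_on_def covector_def snd_conv tangent_space_eq[OF \<kappa> x]
    by (auto simp: coord_vec_combination[OF \<kappa> x] tvec_coords_coord_vec[OF \<kappa> x] inner_add_right)
  then show ?thesis
    using x \<kappa> by (auto simp: induced_chart_def cotangent_bundle_def carrier_of_def cotangent_space_def
        covector_def)
qed

lemma induced_chart_covector:
  assumes \<kappa>: "\<kappa> \<in> A" and q: "q \<in> chart_image \<kappa>"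
  shows "chart_map (induced_chart A \<kappa>) (covector \<kappa> q p) = (q, p)"
proof -
  have x: "chart_inv \<kappa> q \<in> chart_dom \<kappa>" by (rule chart_inv_dom[OF q])
  show ?thesis
    by (simp add: induced_chart_def covector_def fibre_coords_def chart_map_inv[OF q] vec_eq_iff
        coord_vec_in_tangent_space[OF \<kappa> x] tvec_coords_coord_vec[OF \<kappa> x] inner_axis)
qed

lemma covector_apply:
  assumes \<kappa>: "\<kappa> \<in> A" and P: "P \<in> chart_dom (induced_chart A \<kappa>)"
  shows "snd P (coord_vec A \<kappa> (fst P) w) = fibre_coords A \<kappa> P \<bullet> w"
proof -
  have x: "fst P \<in> chart_dom \<kappa>" and f: "functional_on (tangent_space A (fst P)) (snd P)"
    using P by (auto simp: induced_chart_def cotangent_bundle_def cotangent_space_def)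
  show ?thesis
    using linear_inner_expand[OF linear_functional[OF \<kappa> x f], of w] by (simp add: fibre_coords_def)
qed

text \<open>Coordinates determine a covector on tangent vectors; the zero extension settles its
  remaining values, so equality holds as functions.\<close>

lemma induced_chart_inj:
  assumes \<kappa>: "\<kappa> \<in> A"
  shows "inj_on (chart_map (induced_chart A \<kappa>)) (chart_dom (induced_chart A \<kappa>))"
proof (rule inj_onI)
  fix P Q assume P: "P \<in> chart_dom (induced_chart A \<kappa>)" and Q: "Q \<in> chart_dom (induced_chart A \<kappa>)"
    and eq: "chart_map (induced_chart A \<kappa>) P = chart_map (induced_chart A \<kappa>) Q"
  have x: "fst P \<in> chart_dom \<kappa>" "fst Q \<in> chart_dom \<kappa>"
    and z: "v \<notin> tangent_space A (fst P) \<Longrightarrow> snd P v = 0" "v \<notin> tangent_space A (fst Q) \<Longrightarrow> snd Q v = 0" for v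
    using P Q by (auto simp: induced_chart_def cotangent_bundle_def cotangent_space_def)
  have fst: "fst P = fst Q"
    using eq chart_inj[OF \<kappa>] x by (simp add: induced_chart_def inj_on_def)
  have "snd P v = snd Q v" for v
  proof (cases "v \<in> tangent_space A (fst P)")
    case True
    then obtain w where "v = coord_vec A \<kappa> (fst P) w" using tangent_space_eq[OF \<kappa> x(1)] by blast
    then show ?thesis
      using covector_apply[OF \<kappa> P, of w] covector_apply[OF \<kappa> Q, of w] eq fst by (simp add: induced_chart_def)
  qed (use z fst in simp)
  then show "P = Q" using fst by (simp add: prod_eq_iff fun_eq_iff)
qed

section \<open>Overlaps and transition maps of the induced atlas\<close>

lemma induced_overlap:
  assumes \<kappa>: "\<kappa> \<in> A"
  shows "chart_map (induced_chart A \<kappa>) ` (chart_dom (induced_chart A \<kappa>) \<inter> chart_dom (induced_chart A \<kappa>'))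
    = chart_map \<kappa> ` (chart_dom \<kappa> \<inter> chart_dom \<kappa>') \<times> UNIV" (is "?L = ?R")
proof
  show "?L \<subseteq> ?R" by (auto simp: induced_chart_def)
  show "?R \<subseteq> ?L"
  proof
    fix z assume "z \<in> ?R"
    then obtain x p where z: "z = (chart_map \<kappa> x, p)" and x: "x \<in> chart_dom \<kappa>" "x \<in> chart_dom \<kappa>'" by auto
    let ?P = "covector \<kappa> (chart_map \<kappa> x) p"
    have q: "chart_map \<kappa> x \<in> chart_image \<kappa>" by (rule chart_map_image[OF x(1)])
    have "fst ?P = x" by (simp add: covector_def chart_inv_map[OF \<kappa> x(1)])
    then have "?P \<in> chart_dom (induced_chart A \<kappa>) \<inter> chart_dom (induced_chart A \<kappa>')"
      using covector_in_dom[OF \<kappa> q, of p] x by (auto simp: induced_chart_def)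
    moreover have "z = chart_map (induced_chart A \<kappa>) ?P" by (simp add: z induced_chart_covector[OF \<kappa> q])
    ultimately show "z \<in> ?L" by blast
  qed
qed

lemma induced_chart_image: "\<kappa> \<in> A \<Longrightarrow> chart_image (induced_chart A \<kappa>) = chart_image \<kappa> \<times> UNIV"
  using induced_overlap[of \<kappa> \<kappa>] by (simp add: chart_image_def)

lemma induced_chart_inv:
  assumes \<kappa>: "\<kappa> \<in> A" and q: "q \<in> chart_image \<kappa>"
  shows "chart_inv (induced_chart A \<kappa>) (q, p) = covector \<kappa> q p"
  unfolding chart_inv_def
  using inv_into_f_f[OF induced_chart_inj[OF \<kappa>] covector_in_dom[OF \<kappa> q]] induced_chart_covector[OF \<kappa> q] by simp

lemma induced_transition_differentiable:
  assumes \<kappa>: "\<kappa> \<in> A" and \<kappa>': "\<kappa>' \<in> A" and P: "P \<in> chart_dom (induced_chart A \<kappa>)" "P \<in> chart_dom (induced_chart A \<kappa>')"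
  shows "(chart_map (induced_chart A \<kappa>') \<circ> chart_inv (induced_chart A \<kappa>)) differentiable
    at (chart_map (induced_chart A \<kappa>) P)"
proof -
  define \<tau> where "\<tau> = chart_map \<kappa>' \<circ> chart_inv \<kappa>"
  define \<sigma> where "\<sigma> = chart_map \<kappa> \<circ> chart_inv \<kappa>'"
  define O1 where "O1 = chart_map \<kappa> ` (chart_dom \<kappa> \<inter> chart_dom \<kappa>')"
  \<comment> \<open>The change of induced coordinates: the base point moves by \<tau>, while the
    components of a covector transform by the derivative of the inverse transition \<sigma>, taken
    at the new base point.\<close>
  define T where "T z = (\<tau> (fst z), \<chi> i. snd z \<bullet> frechet_derivative \<sigma> (at (\<tau> (fst z))) (axis i 1))"
    for z :: "(real^'n) \<times> (real^'n)"
  define z where "z = chart_map (induced_chart A \<kappa>) P"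
  have x: "fst P \<in> chart_dom \<kappa>" "fst P \<in> chart_dom \<kappa>'" using P by (auto simp: induced_chart_def)
  have z: "fst z = chart_map \<kappa> (fst P)" by (simp add: z_def induced_chart_def)
  have zO: "z \<in> O1 \<times> UNIV" using x by (simp add: mem_Times_iff O1_def z)
  have eq: "T y = (chart_map (induced_chart A \<kappa>') \<circ> chart_inv (induced_chart A \<kappa>)) y" if y: "y \<in> O1 \<times> UNIV" for y
  proof -
    obtain x p where y': "y = (chart_map \<kappa> x, p)" and x: "x \<in> chart_dom \<kappa>" "x \<in> chart_dom \<kappa>'"
      using y by (auto simp: O1_def)
    have q: "chart_map \<kappa> x \<in> chart_image \<kappa>" by (rule chart_map_image[OF x(1)])
    let ?P = "covector \<kappa> (chart_map \<kappa> x) p"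
    have fP: "fst ?P = x" by (simp add: covector_def chart_inv_map[OF \<kappa> x(1)])
    have fc: "fibre_coords A \<kappa> ?P = p"
      using induced_chart_covector[OF \<kappa> q, of p] by (simp add: induced_chart_def)
    have \<tau>: "\<tau> (chart_map \<kappa> x) = chart_map \<kappa>' x" by (simp add: \<tau>_def chart_inv_map[OF \<kappa> x(1)])
    have "fibre_coords A \<kappa>' ?P $ i = p \<bullet> frechet_derivative \<sigma> (at (chart_map \<kappa>' x)) (axis i 1)" for i
      using coord_vec_change[OF \<kappa>' x(2) \<kappa> x(1), of "axis i 1"] covector_apply[OF \<kappa> covector_in_dom[OF \<kappa> q], of p]
      by (simp add: fibre_coords_def[of A \<kappa>'] fP fc \<sigma>_def)
    then show ?thesis
      by (simp add: y' T_def induced_chart_inv[OF \<kappa> q] \<tau> vec_eq_iff) (simp add: induced_chart_def fP vec_eq_iff)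
  qed
  obtain D\<tau> where D\<tau>: "(\<tau> has_derivative D\<tau>) (at (fst z))"
    using transition_differentiable[OF \<kappa> \<kappa>' x] z by (auto simp: \<tau>_def differentiable_def)
  have "((\<lambda>y. \<tau> (fst y)) has_derivative (\<lambda>d. D\<tau> (fst d))) (at z)"
    by (rule has_derivative_compose[where f=fst and g=\<tau>, OF _ D\<tau>]) (auto intro: bounded_linear_imp_has_derivative bounded_linear_fst)
  note \<tau> = this
  have 1: "(\<lambda>y. snd y \<bullet> frechet_derivative \<sigma> (at (\<tau> (fst y))) (axis i 1)) differentiable (at z)" for i
  proof -
    have "\<tau> (fst z) = chart_map \<kappa>' (fst P)" by (simp add: z \<tau>_def chart_inv_map[OF \<kappa> x(1)])
    then have "\<tau> (fst z) \<in> chart_map \<kappa>' ` (chart_dom \<kappa>' \<inter> chart_dom \<kappa>)" using x by blast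
    from smooth_on_open_differentiable2[OF transition_smooth[OF \<kappa>' \<kappa>] open_overlap[OF \<kappa>' \<kappa>] this]
    obtain D where "((\<lambda>y. frechet_derivative \<sigma> (at y) (axis i 1)) has_derivative D) (at (\<tau> (fst z)))"
      unfolding \<sigma>_def differentiable_def by blast
    from has_derivative_compose[where f="\<lambda>y. \<tau> (fst y)", OF \<tau> this]
    have "((\<lambda>y. snd y \<bullet> frechet_derivative \<sigma> (at (\<tau> (fst y))) (axis i 1)) has_derivative
      (\<lambda>d. snd z \<bullet> D (D\<tau> (fst d)) + snd d \<bullet> frechet_derivative \<sigma> (at (\<tau> (fst z))) (axis i 1))) (at z)"
      by (intro has_derivative_inner) (auto intro: bounded_linear_imp_has_derivative bounded_linear_snd)
    then show ?thesis by (auto simp: differentiable_def)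
  qed
  obtain D where "((\<lambda>y. \<chi> i. snd y \<bullet> frechet_derivative \<sigma> (at (\<tau> (fst y))) (axis i 1)) has_derivative D) (at z)"
    using vec_lambda_differentiable[of "\<lambda>y i. snd y \<bullet> frechet_derivative \<sigma> (at (\<tau> (fst y))) (axis i 1)", OF 1]
    unfolding differentiable_def by blast
  from has_derivative_Pair[OF \<tau> this]
  have T: "(T has_derivative (\<lambda>d. (D\<tau> (fst d), D d))) (at z)" by (simp add: T_def[abs_def])
  have op: "open (O1 \<times> UNIV :: ((real^'n) \<times> (real^'n)) set)"
    unfolding O1_def by (intro open_Times open_overlap \<kappa> \<kappa>' open_UNIV)
  have "((chart_map (induced_chart A \<kappa>') \<circ> chart_inv (induced_chart A \<kappa>)) has_derivative
      (\<lambda>d. (D\<tau> (fst d), D d))) (at z)"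
    by (rule has_derivative_transform_within_open[OF T op zO]) (rule eq)
  then show ?thesis by (auto simp: differentiable_def z_def)
qed

sublocale cotangent: diff_atlas "cotangent_atlas A"
proof
  fix \<kappa>1 \<kappa>2 x assume "\<kappa>1 \<in> cotangent_atlas A"
  then obtain \<kappa> where \<kappa>: "\<kappa> \<in> A" "\<kappa>1 = induced_chart A \<kappa>" by (auto simp: cotangent_atlas_def)
  show "inj_on (chart_map \<kappa>1) (chart_dom \<kappa>1)" using induced_chart_inj \<kappa> by simp
  show "open (chart_image \<kappa>1)" using \<kappa> by (simp add: induced_chart_image open_Times open_chart_image)
  assume "\<kappa>2 \<in> cotangent_atlas A"
  then obtain \<kappa>' where \<kappa>': "\<kappa>' \<in> A" "\<kappa>2 = induced_chart A \<kappa>'" by (auto simp: cotangent_atlas_def)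
  show "open (chart_map \<kappa>1 ` (chart_dom \<kappa>1 \<inter> chart_dom \<kappa>2))"
    unfolding \<kappa> \<kappa>' induced_overlap[OF \<kappa>(1)] by (intro open_Times open_overlap \<kappa> \<kappa>' open_UNIV)
  assume "x \<in> chart_dom \<kappa>1" "x \<in> chart_dom \<kappa>2"
  then show "(chart_map \<kappa>2 \<circ> chart_inv \<kappa>1) differentiable at (chart_map \<kappa>1 x)"
    unfolding \<kappa>(2) \<kappa>'(2) by (rule induced_transition_differentiable[OF \<kappa>(1) \<kappa>'(1)])
qed

end

lemma smooth_manifold_atlas: "smooth_manifold X A \<Longrightarrow> manifold_atlas A"
  unfolding manifold_atlas_def manifold_atlas_axioms_def
  using smooth_manifold_diff_atlas[of X A] unfolding smooth_manifold_def by blast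

section \<open>Riemannian charts\<close>

lemma axis_matrix_inner: "axis l 1 \<bullet> ((M::real^'n^'m) *v axis j 1) = M $ l $ j"
  by (simp add: inner_axis' matrix_vector_mult_basis column_def)

lemma matrix_vector_axis: "((M::real^'n^'m) *v axis j 1) $ l = M $ l $ j"
  by (simp add: matrix_vector_mult_basis column_def)

lemma linear_nth_expand:
  fixes L :: "real^'n \<Rightarrow> real^'m"
  assumes "linear L" shows "L w $ l = (\<Sum>i\<in>UNIV. w $ i * L (axis i 1) $ l)"
  using linear_axis_expand[of "\<lambda>w. L w $ l" w] assms by (simp add: linear_iff)

locale riemannian_chart = manifold_atlas A for A :: "('m, real^'n) chart set" +
  fixes g :: "'m metric_field" and \<kappa> :: "('m, real^'n) chart"
  assumes metric: "riemannian_metric A g" and \<kappa>: "\<kappa> \<in> A"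
begin

lemma metric_matrix_inner:
  assumes q: "q \<in> chart_image \<kappa>"
  shows "u \<bullet> (metric_matrix A g \<kappa> q *v v) =
    g (chart_inv \<kappa> q) (coord_vec A \<kappa> (chart_inv \<kappa> q) u) (coord_vec A \<kappa> (chart_inv \<kappa> q) v)"
proof -
  let ?x = "chart_inv \<kappa> q"
  have x: "?x \<in> chart_dom \<kappa>" by (rule chart_inv_dom[OF q])
  then have "bilinear_form_on (tangent_space A ?x) (g ?x)"
    using metric \<kappa> by (auto simp: riemannian_metric_def carrier_of_def)
  from bilinear_bilinear_form[OF \<kappa> x this]
  have B: "linear (\<lambda>v. g ?x (coord_vec A \<kappa> ?x u) (coord_vec A \<kappa> ?x v))"
    "linear (\<lambda>u. g ?x (coord_vec A \<kappa> ?x u) (coord_vec A \<kappa> ?x v))" for u v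
    by (simp_all add: bilinear_def)
  have "(metric_matrix A g \<kappa> q *v v) $ i = g ?x (coord_vec A \<kappa> ?x (axis i 1)) (coord_vec A \<kappa> ?x v)" for i
    using linear_axis_expand[OF B(1), of "axis i 1" v]
    by (simp add: matrix_vector_mult_def metric_matrix_def mult.commute)
  then show ?thesis
    using linear_axis_expand[OF B(2), of u v] by (simp add: inner_vec_def)
qed

lemma metric_matrix_smooth: "smooth_on (chart_image \<kappa>) (metric_matrix A g \<kappa>)"
  using metric \<kappa> by (simp add: riemannian_metric_def)

sublocale metric_coords "chart_image \<kappa>" "metric_matrix A g \<kappa>"
proof
  show "open (chart_image \<kappa>)" by (rule open_chart_image[OF \<kappa>])
  fix q assume q: "q \<in> chart_image \<kappa>"
  let ?x = "chart_inv \<kappa> q"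
  have x: "?x \<in> chart_dom \<kappa>" by (rule chart_inv_dom[OF q])
  then have c: "?x \<in> carrier_of A" using \<kappa> by (auto simp: carrier_of_def)
  note T = coord_vec_in_tangent_space[OF \<kappa> x]
  show "metric_matrix A g \<kappa> differentiable (at q)"
    by (rule smooth_on_open_differentiable[OF metric_matrix_smooth open_chart_image[OF \<kappa>] q])
  show "(\<lambda>y. frechet_derivative (metric_matrix A g \<kappa>) (at y) u) differentiable (at q)" for u
    by (rule smooth_on_open_differentiable2[OF metric_matrix_smooth open_chart_image[OF \<kappa>] q])
  show "metric_matrix A g \<kappa> q $ i $ j = metric_matrix A g \<kappa> q $ j $ i" for i j
    using metric c T[of "axis i 1"] T[of "axis j 1"] by (simp add: riemannian_metric_def metric_matrix_def)
  show "w \<bullet> (metric_matrix A g \<kappa> q *v w) > 0" if w: "w \<noteq> 0" for w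
  proof -
    have "coord_vec A \<kappa> ?x w \<noteq> (\<lambda>f. 0)"
    proof
      assume "coord_vec A \<kappa> ?x w = (\<lambda>f. 0)"
      then have "tvec_coords \<kappa> (coord_vec A \<kappa> ?x w) = 0" by (simp add: tvec_coords_def)
      then show False using w tvec_coords_coord_vec[OF \<kappa> x] by simp
    qed
    then show ?thesis
      using metric c T[of w] by (simp add: riemannian_metric_def metric_matrix_inner[OF q])
  qed
qed

lemma inverse_metric_matrix_eq: "inverse_metric_matrix A g \<kappa> q = gi q"
  by (simp add: inverse_metric_matrix_def gi_def)

lemma partial_deriv_metric:
  assumes q: "q \<in> chart_image \<kappa>"
  shows "partial_deriv i (\<lambda>y. metric_matrix A g \<kappa> y $ j $ l) q = Dg q (axis i 1) $ j $ l"
proof -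
  have "((\<lambda>y. metric_matrix A g \<kappa> y $ j $ l) has_derivative (\<lambda>d. Dg q d $ j $ l)) (at q)"
    by (intro bounded_linear.has_derivative[OF bounded_linear_vec_nth] gm_has_derivative q)
  from frechet_derivative_eqI[OF this] show ?thesis by (simp add: partial_deriv_def)
qed

lemma christoffel_eq:
  assumes q: "q \<in> chart_image \<kappa>"
  shows "christoffel A g \<kappa> q k i j = Gam q (axis i 1) (axis j 1) $ k"
proof -
  have sym: "Dg q u $ a $ b = Dg q u $ b $ a" for u a b
    using Dg_inner[OF q, of "axis a 1" u "axis b 1"] by (simp add: axis_matrix_inner)
  have K: "K q (axis i 1) (axis j 1) $ l = (1/2) * (Dg q (axis i 1) $ j $ l + Dg q (axis j 1) $ i $ l - Dg q (axis l 1) $ i $ j)" for l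
    using K_inner[OF q, of "axis i 1" "axis j 1" "axis l 1"]
    by (simp add: axis_matrix_inner inner_axis sym[of _ l] sym[of _ j i])
  show ?thesis
    unfolding christoffel_def Gam_def matrix_vector_mult_def partial_deriv_metric[OF q]
      inverse_metric_matrix_eq K
    by (simp add: sum_distrib_left mult.left_commute)
qed

lemma riemann_tensor_eq:
  assumes q: "q \<in> chart_image \<kappa>"
  shows "riemann_tensor A g \<kappa> q l k i j = Riem q (axis i 1) (axis j 1) (axis k 1) $ l"
proof -
  have D: "partial_deriv i (\<lambda>y. christoffel A g \<kappa> y l j k) q = DGam q (axis i 1) (axis j 1) (axis k 1) $ l" for i j
  proof -
    have "((\<lambda>y. Gam y (axis j 1) (axis k 1) $ l) has_derivative (\<lambda>d. DGam q d (axis j 1) (axis k 1) $ l)) (at q)"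
      by (intro bounded_linear.has_derivative[OF bounded_linear_vec_nth] Gam_has_derivative q)
    then have "((\<lambda>y. christoffel A g \<kappa> y l j k) has_derivative (\<lambda>d. DGam q d (axis j 1) (axis k 1) $ l)) (at q)"
      by (rule has_derivative_transform_within_open[OF _ open_S q]) (simp add: christoffel_eq)
    from frechet_derivative_eqI[OF this] show ?thesis by (simp add: partial_deriv_def)
  qed
  have G: "(\<Sum>m\<in>UNIV. christoffel A g \<kappa> q l i m * christoffel A g \<kappa> q m j k) =
      Gam q (axis i 1) (Gam q (axis j 1) (axis k 1)) $ l" for i j
    using linear_nth_expand[OF linear_Gam2[OF q], where w="Gam q (axis j 1) (axis k 1)"]
    by (simp add: christoffel_eq[OF q] mult.commute)
  show ?thesis by (simp add: riemann_tensor_def D G Riem_def)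
qed

lemma curvature_vec_eq:
  assumes x: "x \<in> chart_dom \<kappa>"
  shows "curvature_vec A g \<kappa> x (coord_vec A \<kappa> x u) (coord_vec A \<kappa> x v) (coord_vec A \<kappa> x w)
    = coord_vec A \<kappa> x (Riem (chart_map \<kappa> x) u v w)"
proof -
  let ?q = "chart_map \<kappa> x"
  have q: "?q \<in> chart_image \<kappa>" by (rule chart_map_image[OF x])
  have "(\<Sum>k\<in>UNIV. \<Sum>i\<in>UNIV. \<Sum>j\<in>UNIV. riemann_tensor A g \<kappa> ?q l k i j * u $ i * v $ j * w $ k)
      = Riem ?q u v w $ l" for l
  proof -
    have "Riem ?q u v w $ l = (\<Sum>k\<in>UNIV. w $ k * Riem ?q u v (axis k 1) $ l)"
      by (rule linear_nth_expand[OF linear_Riem3[OF q]])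
    also have "\<dots> = (\<Sum>k\<in>UNIV. w $ k * (\<Sum>i\<in>UNIV. u $ i * Riem ?q (axis i 1) v (axis k 1) $ l))"
      using linear_nth_expand[OF linear_Riem1[OF q], where w=u] by simp
    also have "\<dots> = (\<Sum>k\<in>UNIV. w $ k * (\<Sum>i\<in>UNIV. u $ i *
        (\<Sum>j\<in>UNIV. v $ j * Riem ?q (axis i 1) (axis j 1) (axis k 1) $ l)))"
      using linear_nth_expand[OF linear_Riem2[OF q], where w=v] by simp
    finally show ?thesis
      by (simp add: riemann_tensor_eq[OF q] sum_distrib_left mult_ac)
  qed
  then show ?thesis
    by (simp add: curvature_vec_def tvec_coords_coord_vec[OF \<kappa> x])
qed

lemma sectional_curvature_eq:
  assumes q: "q \<in> chart_image \<kappa>"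
  shows "sectional_curvature A g \<kappa> (chart_inv \<kappa> q) (coord_vec A \<kappa> (chart_inv \<kappa> q) u) (coord_vec A \<kappa> (chart_inv \<kappa> q) v)
    = (u \<bullet> (metric_matrix A g \<kappa> q *v Riem q u v v)) /
      ((u \<bullet> (metric_matrix A g \<kappa> q *v u)) * (v \<bullet> (metric_matrix A g \<kappa> q *v v)) - (u \<bullet> (metric_matrix A g \<kappa> q *v v))\<^sup>2)"
  using curvature_vec_eq[OF chart_inv_dom[OF q], of u v v] gm_inner[OF q, of u "Riem q u v v"]
  by (simp add: sectional_curvature_def chart_map_inv[OF q] metric_matrix_inner[OF q])

lemma linearly_independent_coord_vec:
  assumes x: "x \<in> chart_dom \<kappa>"
  shows "linearly_independent (coord_vec A \<kappa> x u) (coord_vec A \<kappa> x v) \<longleftrightarrow>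
    (\<forall>r s. r *\<^sub>R u + s *\<^sub>R v = 0 \<longrightarrow> r = 0 \<and> s = 0)"
proof -
  have "coord_vec A \<kappa> x w = (\<lambda>f. 0) \<longleftrightarrow> w = 0" for w
  proof
    assume "coord_vec A \<kappa> x w = (\<lambda>f. 0)"
    then have "tvec_coords \<kappa> (coord_vec A \<kappa> x w) = 0" by (simp add: tvec_coords_def)
    then show "w = 0" by (simp add: tvec_coords_coord_vec[OF \<kappa> x])
  next
    assume "w = 0"
    then show "coord_vec A \<kappa> x w = (\<lambda>f. 0)"
      using linear_0[OF linear_coord_vec[OF \<kappa> x]] by (simp add: fun_eq_iff)
  qed
  then show ?thesis
    by (simp add: linearly_independent_def coord_vec_combination[OF \<kappa> x])
qed

lemma gram_pos:
  assumes q: "q \<in> chart_image \<kappa>" and ind: "\<And>r s. r *\<^sub>R u + s *\<^sub>R v = 0 \<Longrightarrow> r = 0 \<and> s = 0"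
  shows "(u \<bullet> (metric_matrix A g \<kappa> q *v u)) * (v \<bullet> (metric_matrix A g \<kappa> q *v v)) - (u \<bullet> (metric_matrix A g \<kappa> q *v v))\<^sup>2 > 0"
proof -
  define uu uv vv where "uu = u \<bullet> (metric_matrix A g \<kappa> q *v u)" and "uv = u \<bullet> (metric_matrix A g \<kappa> q *v v)"
    and "vv = v \<bullet> (metric_matrix A g \<kappa> q *v v)"
  have "v \<noteq> 0" using ind[of 0 1] by auto
  then have vv: "vv > 0" using gm_positive[OF q] by (simp add: vv_def)
  \<comment> \<open>A multiple of the part of \<open>u\<close> orthogonal to \<open>v\<close>; its
    squared length is the Gram determinant times \<open>vv\<close>, as in the proof of the
    Cauchy-Schwarz inequality.\<close>
  let ?y = "vv *\<^sub>R u + (- uv) *\<^sub>R v"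
  have "?y \<noteq> 0" using ind[of vv "- uv"] vv by auto
  then have "?y \<bullet> (metric_matrix A g \<kappa> q *v ?y) > 0" by (rule gm_positive[OF q])
  also have "?y \<bullet> (metric_matrix A g \<kappa> q *v ?y) = vv * (uu * vv - uv\<^sup>2)"
    using gm_inner[OF q, of v u]
    by (simp add: matrix_vector_right_distrib matrix_vector_mult_diff_distrib matrix_vector_mult_scaleR
        inner_add_left inner_diff_left inner_diff_right flip: uu_def uv_def vv_def)
      (simp add: power2_eq_square algebra_simps)
  finally show ?thesis using vv by (simp add: zero_less_mult_iff uu_def uv_def vv_def)
qed

lemma constant_sectional_curvature_chart:
  "(\<forall>x\<in>chart_dom \<kappa>. \<forall>u\<in>tangent_space A x. \<forall>v\<in>tangent_space A x.
      linearly_independent u v \<longrightarrow> sectional_curvature A g \<kappa> x u v = c) \<longleftrightarrow>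
   (\<forall>q\<in>chart_image \<kappa>. \<forall>u v w. Riem q u v w =
      c *\<^sub>R ((w \<bullet> (metric_matrix A g \<kappa> q *v v)) *\<^sub>R u - (w \<bullet> (metric_matrix A g \<kappa> q *v u)) *\<^sub>R v))"
  (is "?L \<longleftrightarrow> ?R")
proof
  assume L: ?L
  show ?R
  proof (intro ballI allI)
    fix q u v w assume q: "q \<in> chart_image \<kappa>"
    let ?x = "chart_inv \<kappa> q"
    have x: "?x \<in> chart_dom \<kappa>" by (rule chart_inv_dom[OF q])
    note T = coord_vec_in_tangent_space[OF \<kappa> x]
    show "Riem q u v w =
      c *\<^sub>R ((w \<bullet> (metric_matrix A g \<kappa> q *v v)) *\<^sub>R u - (w \<bullet> (metric_matrix A g \<kappa> q *v u)) *\<^sub>R v)"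
    proof (rule Riem_constant_curvature[OF q])
      fix u v
      show "u \<bullet> (metric_matrix A g \<kappa> q *v Riem q u v v) = c * ((u \<bullet> (metric_matrix A g \<kappa> q *v u)) *
        (v \<bullet> (metric_matrix A g \<kappa> q *v v)) - (u \<bullet> (metric_matrix A g \<kappa> q *v v))\<^sup>2)"
      proof (cases "\<forall>r s. r *\<^sub>R u + s *\<^sub>R v = 0 \<longrightarrow> r = 0 \<and> s = 0")
        case True
        then have "sectional_curvature A g \<kappa> ?x (coord_vec A \<kappa> ?x u) (coord_vec A \<kappa> ?x v) = c"
          using L x T linearly_independent_coord_vec[OF x] by blast
        then show ?thesis
          using gram_pos[OF q, of u v] True by (simp add: sectional_curvature_eq[OF q] divide_eq_eq)
      next
        case False
        then obtain r s where rs: "r *\<^sub>R u + s *\<^sub>R v = 0" "r \<noteq> 0 \<or> s \<noteq> 0" by blast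
        \<comment> \<open>Sectional curvature is silent about dependent pairs; there both sides of
          the required equation are zero.\<close>
        have "(\<exists>a. u = a *\<^sub>R v) \<or> v = 0"
        proof (cases "r = 0")
          case False
          then have "u = (1 / r) *\<^sub>R (r *\<^sub>R u)" by simp
          also have "r *\<^sub>R u = (- s) *\<^sub>R v" using rs(1) by (simp add: eq_neg_iff_add_eq_0)
          finally show ?thesis by (metis scaleR_scaleR)
        qed (use rs in simp)
        moreover have "Riem q v v w = 0" for w by (simp add: Riem_def)
        ultimately show ?thesis
          by (auto simp: linear_scale[OF linear_Riem1[OF q]] linear_0[OF linear_Riem2[OF q]]
              matrix_vector_mult_scaleR power2_eq_square)
      qed
    qed
  qed
next
  assume R: ?R
  show ?L
  proof (intro ballI impI)
    fix x U V assume x: "x \<in> chart_dom \<kappa>" and "U \<in> tangent_space A x" "V \<in> tangent_space A x"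
      and ind: "linearly_independent U V"
    then obtain u v where U: "U = coord_vec A \<kappa> x u" and V: "V = coord_vec A \<kappa> x v"
      using tangent_space_eq[OF \<kappa> x] by blast
    define q where "q = chart_map \<kappa> x"
    have q: "q \<in> chart_image \<kappa>" and xq: "x = chart_inv \<kappa> q"
      using chart_map_image[OF x] chart_inv_map[OF \<kappa> x] by (simp_all add: q_def)
    have "\<forall>r s. r *\<^sub>R u + s *\<^sub>R v = 0 \<longrightarrow> r = 0 \<and> s = 0"
      using ind unfolding U V linearly_independent_coord_vec[OF x] .
    then have "(u \<bullet> (metric_matrix A g \<kappa> q *v u)) * (v \<bullet> (metric_matrix A g \<kappa> q *v v)) - (u \<bullet> (metric_matrix A g \<kappa> q *v v))\<^sup>2 > 0"
      using gram_pos[OF q, of u v] by blast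
    moreover have R': "Riem q u v v = c *\<^sub>R ((v \<bullet> (metric_matrix A g \<kappa> q *v v)) *\<^sub>R u - (v \<bullet> (metric_matrix A g \<kappa> q *v u)) *\<^sub>R v)"
      using R q by blast
    moreover have "u \<bullet> (metric_matrix A g \<kappa> q *v Riem q u v v) = c * ((u \<bullet> (metric_matrix A g \<kappa> q *v u)) *
        (v \<bullet> (metric_matrix A g \<kappa> q *v v)) - (u \<bullet> (metric_matrix A g \<kappa> q *v v))\<^sup>2)"
      unfolding R' using gm_inner[OF q, of v u]
      by (simp add: matrix_vector_mult_scaleR matrix_vector_mult_diff_distrib inner_diff_right power2_eq_square algebra_simps)
    ultimately show "sectional_curvature A g \<kappa> x U V = c"
      unfolding U V xq sectional_curvature_eq[OF q] by (simp add: divide_eq_eq)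
  qed
qed

end

section \<open>The natural structure in an induced chart\<close>

lemma vec_sum_axis: "(\<Sum>j\<in>UNIV. (w $ j) *\<^sub>R axis j 1) = (w :: real^'n)"
  using basis_expansion[of w] by (simp flip: scalar_mult_eq_scaleR)

lemma linear_axis_eqI:
  fixes L M :: "real^'n \<Rightarrow> 'a::real_vector"
  assumes "linear L" "linear M" "\<And>i. L (axis i 1) = M (axis i 1)"
  shows "L w = M w"
proof -
  have "L (\<Sum>j\<in>UNIV. (w $ j) *\<^sub>R axis j 1) = M (\<Sum>j\<in>UNIV. (w $ j) *\<^sub>R axis j 1)"
    by (simp only: linear_sum[OF assms(1)] linear_sum[OF assms(2)] linear_scale[OF assms(1)]
        linear_scale[OF assms(2)] assms(3))
  then show ?thesis by (simp only: vec_sum_axis)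
qed

lemma bilinear_axis_eqI:
  fixes L M :: "real^'n \<Rightarrow> real^'m \<Rightarrow> 'a::real_vector"
  assumes L: "bilinear L" and M: "bilinear M" and eq: "\<And>i j. L (axis i 1) (axis j 1) = M (axis i 1) (axis j 1)"
  shows "L u v = M u v"
proof -
  have "L u (axis j 1) = M u (axis j 1)" for j
    by (rule linear_axis_eqI[of "\<lambda>u. L u (axis j 1)" "\<lambda>u. M u (axis j 1)"])
      (use L M eq in \<open>simp_all add: bilinear_def\<close>)
  then show ?thesis
    by (rule linear_axis_eqI[of "L u" "M u", rotated 2]) (use L M in \<open>simp_all add: bilinear_def\<close>)
qed

locale natural_chart = riemannian_chart A g \<kappa>
  for A :: "('m, real^'n) chart set" and g :: "'m metric_field" and \<kappa> :: "('m, real^'n) chart" +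
  fixes a1 b1 lam mu :: "real \<Rightarrow> real"
    and G :: "'m covec metric_field" and J :: "'m covec \<Rightarrow> 'm covec tvec \<Rightarrow> 'm covec tvec"
  assumes a1_smooth: "smooth_on {0..} a1" and b1_smooth: "smooth_on {0..} b1"
    and lam_smooth: "smooth_on {0..} lam" and mu_smooth: "smooth_on {0..} mu"
    and pos_a1: "t \<ge> 0 \<Longrightarrow> a1 t > 0" and pos_a1_b1: "t \<ge> 0 \<Longrightarrow> a1 t + 2 * t * b1 t > 0"
    and natural: "natural_diagonal_structure A g a1 b1 lam mu G J"
begin

sublocale natural_structure "chart_image \<kappa>" "metric_matrix A g \<kappa>" a1 b1 lam mu
  "halfline_deriv a1" "halfline_deriv b1" "halfline_deriv lam" "halfline_deriv mu"
  by unfold_locales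
    (simp_all add: smooth_on_halfline(1) a1_smooth b1_smooth lam_smooth mu_smooth pos_a1 pos_a1_b1)

abbreviation "\<kappa>c \<equiv> induced_chart A \<kappa>"

definition pt :: "(real^'n) \<times> (real^'n) \<Rightarrow> 'm covec" where
  "pt z = covector \<kappa> (fst z) (snd z)"

definition cv :: "(real^'n) \<times> (real^'n) \<Rightarrow> (real^'n) \<times> (real^'n) \<Rightarrow> 'm covec tvec" where
  "cv z = coord_vec (cotangent_atlas A) \<kappa>c (pt z)"

lemma \<kappa>c: "\<kappa>c \<in> cotangent_atlas A"
  using \<kappa> by (simp add: cotangent_atlas_def)

lemma chart_image_\<kappa>c: "chart_image \<kappa>c = TS"
  by (rule induced_chart_image[OF \<kappa>])

lemma pt:
  assumes z: "z \<in> TS"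
  shows "pt z \<in> chart_dom \<kappa>c" "chart_map \<kappa> (fst (pt z)) = fst z" "fibre_coords A \<kappa> (pt z) = snd z"
    "chart_inv \<kappa>c z = pt z"
proof -
  have q: "fst z \<in> chart_image \<kappa>" using z by auto
  show "pt z \<in> chart_dom \<kappa>c" unfolding pt_def by (rule covector_in_dom[OF \<kappa> q])
  show "chart_map \<kappa> (fst (pt z)) = fst z" "fibre_coords A \<kappa> (pt z) = snd z"
    using arg_cong[OF induced_chart_covector[OF \<kappa> q, of "snd z"], of fst]
      arg_cong[OF induced_chart_covector[OF \<kappa> q, of "snd z"], of snd]
    by (simp_all add: pt_def induced_chart_def)
  show "chart_inv \<kappa>c z = pt z"
    using induced_chart_inv[OF \<kappa> q, of "snd z"] by (simp add: pt_def)
qed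

lemma linear_cv: "z \<in> TS \<Longrightarrow> linear (\<lambda>w. cv z w f)"
  unfolding cv_def by (rule cotangent.linear_coord_vec[OF \<kappa>c pt(1)])

lemma cv_sum:
  assumes z: "z \<in> TS" and L: "linear L"
  shows "(\<lambda>f. \<Sum>j\<in>UNIV. (w $ j) * cv z (L (axis j 1)) f) = cv z (L w)"
proof
  fix f
  have "cv z (L w) f = (\<Sum>j\<in>UNIV. w $ j * cv z (L (axis j 1)) f)"
    using linear_axis_expand[OF linear_compose[OF L linear_cv[OF z, of f]], of w] by (simp add: o_def)
  then show "(\<Sum>j\<in>UNIV. (w $ j) * cv z (L (axis j 1)) f) = cv z (L w) f" by simp
qed

lemma linear_vertical: "linear (\<lambda>w. (0 :: real^'n, w :: real^'n))"
  by (simp add: linear_iff)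

lemma d_p_eq: "d_p A \<kappa> (pt z) i = cv z (0, axis i 1)"
  by (simp add: d_p_def cv_def)

lemma Gamma0_eq: "z \<in> TS \<Longrightarrow> Gamma0 A g \<kappa> (pt z) i h = GamP z (axis i 1) $ h"
  by (simp add: Gamma0_def pt christoffel_eq GamP_def inner_vec_def mem_Times_iff)

lemma delta_eq:
  assumes z: "z \<in> TS" shows "delta A g \<kappa> (pt z) i = cv z (hor z (axis i 1))"
proof
  fix f
  have "delta A g \<kappa> (pt z) i f = cv z (axis i 1, 0) f + cv z (0, GamP z (axis i 1)) f"
    using fun_cong[OF cv_sum[OF z linear_vertical, of "GamP z (axis i 1)"], of f]
    by (simp add: delta_def Gamma0_eq[OF z] d_p_eq d_q_def flip: cv_def)
  also have "\<dots> = cv z (hor z (axis i 1)) f"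
    by (simp add: hor_def flip: linear_add[OF linear_cv[OF z]])
  finally show "delta A g \<kappa> (pt z) i f = cv z (hor z (axis i 1)) f" .
qed

lemma energy_density_eq:
  assumes z: "z \<in> TS" shows "energy_density A g \<kappa> (pt z) = en z"
  by (simp add: energy_density_def pt[OF z] inverse_metric_matrix_eq en_def xx_def inner_vec_def
      matrix_vector_mult_def sum_distrib_left mult_ac)

lemma xx_component:
  assumes z: "z \<in> TS" shows "(\<Sum>h\<in>UNIV. snd z $ h * gi (fst z) $ h $ i) = xx z $ i"
proof -
  have "gi (fst z) $ h $ i = gi (fst z) $ i $ h" for h
    using gi_inner[of "fst z" "axis h 1" "axis i 1"] z by (auto simp: axis_matrix_inner)
  then show ?thesis by (simp add: xx_def matrix_vector_mult_def mult.commute)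
qed

text \<open>Translates the indexed frame values into \<open>GG\<close> and \<open>HH\<close>;
  symmetry of the matrices lets their rows be read as columns.\<close>

lemma natural_values:
  assumes z: "z \<in> TS"
  shows "J (pt z) (cv z (hor z (axis i 1))) = cv z (0, GG z (axis i 1))"
    and "J (pt z) (cv z (0, axis i 1)) = cv z (- hor z (HH z (axis i 1)))"
    and "G (pt z) (cv z (hor z (axis i 1))) (cv z (hor z (axis j 1))) =
      lam (en z) * a1 (en z) * metric_matrix A g \<kappa> (fst z) $ i $ j +
      (lam (en z) * b1 (en z) + mu (en z) * (a1 (en z) + 2 * en z * b1 (en z))) * snd z $ i * snd z $ j"
    and "G (pt z) (cv z (0, axis i 1)) (cv z (0, axis j 1)) =
      lam (en z) * (1 / a1 (en z)) * gi (fst z) $ i $ j +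
      (lam (en z) * b2 (en z) + mu (en z) * (1 / a1 (en z) + 2 * en z * b2 (en z))) * xx z $ i * xx z $ j"
    and "G (pt z) (cv z (0, axis i 1)) (cv z (hor z (axis j 1))) = 0"
    and "G (pt z) (cv z (hor z (axis j 1))) (cv z (0, axis i 1)) = 0"
proof -
  note nat = natural[unfolded natural_diagonal_structure_def, THEN conjunct2, rule_format, OF \<kappa> pt(1)[OF z],
      unfolded Let_def pt[OF z] energy_density_eq[OF z] inverse_metric_matrix_eq delta_eq[OF z] d_p_eq
        xx_component[OF z] b2_def[symmetric]]
  have q: "fst z \<in> chart_image \<kappa>" using z by auto
  have sym: "metric_matrix A g \<kappa> (fst z) $ i $ j = metric_matrix A g \<kappa> (fst z) $ j $ i"
    "gi (fst z) $ i $ j = gi (fst z) $ j $ i" for i j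
    using gm_symmetric[OF q] gi_inner[OF q, of "axis i 1" "axis j 1"] by (auto simp: axis_matrix_inner)
  have J1: "J (pt z) (cv z (hor z (axis i 1))) = (\<lambda>f. \<Sum>j\<in>UNIV. (GG z (axis i 1) $ j) * cv z (0, axis j 1) f)"
    using nat[rule_format, of i] by (simp add: GG_def matrix_vector_axis sym(1)[of _ i] inner_axis mult_ac)
  show "J (pt z) (cv z (hor z (axis i 1))) = cv z (0, GG z (axis i 1))"
    unfolding J1 by (rule cv_sum[OF z linear_vertical])
  have J2: "J (pt z) (cv z (0, axis i 1)) = (\<lambda>f. \<Sum>j\<in>UNIV. ((- HH z (axis i 1)) $ j) * cv z (hor z (axis j 1)) f)"
    using nat[rule_format, of i] by (simp add: HH_def b2_def matrix_vector_axis sym(2)[of _ i] inner_axis mult_ac)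
  show "J (pt z) (cv z (0, axis i 1)) = cv z (- hor z (HH z (axis i 1)))"
    unfolding J2 cv_sum[OF z linear_hor[OF z]] by (simp add: linear_neg[OF linear_hor[OF z]])
  show "G (pt z) (cv z (hor z (axis i 1))) (cv z (hor z (axis j 1))) =
      lam (en z) * a1 (en z) * metric_matrix A g \<kappa> (fst z) $ i $ j +
      (lam (en z) * b1 (en z) + mu (en z) * (a1 (en z) + 2 * en z * b1 (en z))) * snd z $ i * snd z $ j"
   "G (pt z) (cv z (0, axis i 1)) (cv z (0, axis j 1)) =
      lam (en z) * (1 / a1 (en z)) * gi (fst z) $ i $ j +
      (lam (en z) * b2 (en z) + mu (en z) * (1 / a1 (en z) + 2 * en z * b2 (en z))) * xx z $ i * xx z $ j"
    "G (pt z) (cv z (0, axis i 1)) (cv z (hor z (axis j 1))) = 0"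
    "G (pt z) (cv z (hor z (axis j 1))) (cv z (0, axis i 1)) = 0"
    using nat[rule_format, of i] by blast+
qed

lemma pt_bundle: "z \<in> TS \<Longrightarrow> pt z \<in> cotangent_bundle A"
  using pt(1) by (simp add: induced_chart_def)

section \<open>\<open>J\<close> and the fundamental form in the induced chart\<close>

lemma J_cv:
  assumes z: "z \<in> TS" shows "J (pt z) (cv z U) = cv z (JJ z U)"
proof -
  have endo: "endomorphism_on (tangent_space (cotangent_atlas A) (pt z)) (J (pt z))"
    using natural pt_bundle[OF z] by (simp add: natural_diagonal_structure_def)
  define L where "L U = tvec_coords \<kappa>c (J (pt z) (cv z U))" for U
  have L: "linear L"
    unfolding L_def[abs_def] cv_def by (rule cotangent.linear_tvec_coords_endomorphism[OF \<kappa>c pt(1)[OF z] endo])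
  have tc: "tvec_coords \<kappa>c (cv z w) = w" for w
    unfolding cv_def by (rule cotangent.tvec_coords_coord_vec[OF \<kappa>c pt(1)[OF z]])
  have h: "L (hor z u) = JJ z (hor z u)" for u
  proof (rule linear_axis_eqI[of "\<lambda>u. L (hor z u)" "\<lambda>u. JJ z (hor z u)"])
    show "linear (\<lambda>u. L (hor z u))" "linear (\<lambda>u. JJ z (hor z u))"
      using linear_compose[OF linear_hor[OF z] L] linear_compose[OF linear_hor[OF z] linear_JJ[OF z]]
      by (simp_all add: o_def)
  qed (simp add: L_def natural_values[OF z] tc JJ_hor[OF z])
  have v: "L (0, u) = JJ z (0, u)" for u
  proof (rule linear_axis_eqI[of "\<lambda>u. L (0, u)" "\<lambda>u. JJ z (0, u)"])
    show "linear (\<lambda>u. L (0, u))" "linear (\<lambda>u. JJ z (0, u))"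
      using linear_compose[OF linear_vertical L] linear_compose[OF linear_vertical linear_JJ[OF z]]
      by (simp_all add: o_def)
  qed (simp add: L_def natural_values[OF z] tc JJ_vertical[OF z])
  have "L U = L (hor z (fst U)) + L (0, snd U - GamP z (fst U))"
    by (subst hor_vertical_split[of U z]) (rule linear_add[OF L])
  also have "\<dots> = JJ z (hor z (fst U) + (0, snd U - GamP z (fst U)))"
    unfolding h v by (rule linear_add[OF linear_JJ[OF z], symmetric])
  also have "\<dots> = JJ z U" by (simp only: hor_vertical_split[of U z, symmetric])
  finally have "L U = JJ z U" .
  \<comment> \<open>Equality of coordinates gives equality of vectors only inside the tangent space,
    which \<open>J\<close> preserves.\<close>
  moreover have "J (pt z) (cv z U) \<in> tangent_space (cotangent_atlas A) (pt z)"
    using endo cotangent.coord_vec_in_tangent_space[OF \<kappa>c pt(1)[OF z]]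
    unfolding endomorphism_on_def cv_def by blast
  then have "cv z (L U) = J (pt z) (cv z U)"
    unfolding L_def cv_def by (rule cotangent.coord_vec_tvec_coords[OF \<kappa>c pt(1)[OF z]])
  ultimately show ?thesis by simp
qed

lemma endo_in_chart_eq:
  assumes z: "z \<in> TS" shows "endo_in_chart (cotangent_atlas A) J \<kappa>c z U = JJ z U"
proof -
  have "tvec_coords \<kappa>c (cv z w) = w" for w
    unfolding cv_def by (rule cotangent.tvec_coords_coord_vec[OF \<kappa>c pt(1)[OF z]])
  then show ?thesis
    using J_cv[OF z, of U] by (simp add: endo_in_chart_def pt(4)[OF z] cv_def)
qed

lemma form_in_chart_eq:
  assumes z: "z \<in> TS"
  shows "form_in_chart (cotangent_atlas A) (fundamental_form G J) \<kappa>c z U V = ph z U V"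
proof -
  have "bilinear_form_on (tangent_space (cotangent_atlas A) (pt z)) (G (pt z))"
    using natural pt_bundle[OF z] by (simp add: natural_diagonal_structure_def)
  then have bil: "bilinear (\<lambda>U V. G (pt z) (cv z U) (cv z V))"
    unfolding cv_def by (rule cotangent.bilinear_bilinear_form[OF \<kappa>c pt(1)[OF z]])
  then have bil_lin: "linear (\<lambda>V. G (pt z) (cv z U) (cv z V))" "linear (\<lambda>V. G (pt z) (cv z V) (cv z U))" for U
    unfolding bilinear_def by blast+
  have bil_comp: "bilinear (\<lambda>u v. G (pt z) (cv z (L u)) (cv z (M v)))" if "linear L" "linear M"
    for L M :: "real^'n \<Rightarrow> (real^'n) \<times> (real^'n)"
    unfolding bilinear_def
  proof (intro conjI allI)
    fix u
    show "linear (\<lambda>v. G (pt z) (cv z (L u)) (cv z (M v)))"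
      using linear_compose[OF that(2) bil_lin(1)[of "L u"]] by (simp add: o_def)
    show "linear (\<lambda>v. G (pt z) (cv z (L v)) (cv z (M u)))"
      using linear_compose[OF that(1) bil_lin(2)[of "M u"]] by (simp add: o_def)
  qed
  note lin = linear_hor[OF z] linear_vertical
  note vals = natural_values[OF z]
  have bil_q: "bilinear (\<lambda>u v. r * (u \<bullet> ((M :: real^'n^'n) *v v)) + s * (y \<bullet> u) * (y \<bullet> v))" for r s M y
    by (simp add: bilinear_def linear_iff algebra_simps)
  have "G (pt z) (cv z U) (cv z (JJ z V)) = ph z U V"
  proof (rule form_eq_ph[OF z bil])
    fix u v
    show "G (pt z) (cv z (hor z u)) (cv z (hor z v)) = lam (en z) * a1 (en z) * (u \<bullet> (metric_matrix A g \<kappa> (fst z) *v v))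
      + (lam (en z) * b1 (en z) + mu (en z) * (a1 (en z) + 2 * en z * b1 (en z))) * (snd z \<bullet> u) * (snd z \<bullet> v)"
      by (rule bilinear_axis_eqI[OF bil_comp[OF lin(1) lin(1)] bil_q])
        (simp add: vals axis_matrix_inner inner_axis)
    show "G (pt z) (cv z (0, u)) (cv z (0, v)) = lam (en z) * (1 / a1 (en z)) * (u \<bullet> (gi (fst z) *v v))
      + (lam (en z) * b2 (en z) + mu (en z) * (1 / a1 (en z) + 2 * en z * b2 (en z))) * (xx z \<bullet> u) * (xx z \<bullet> v)"
      by (rule bilinear_axis_eqI[OF bil_comp[OF lin(2) lin(2)] bil_q])
        (simp add: vals axis_matrix_inner inner_axis)
    show "G (pt z) (cv z (0, u)) (cv z (hor z v)) = 0"
      using bilinear_axis_eqI[OF bil_comp[OF lin(2) lin(1)] bil_q[of 0 0 0 0], of u v] by (simp add: vals)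
    show "G (pt z) (cv z (hor z u)) (cv z (0, v)) = 0"
      using bilinear_axis_eqI[OF bil_comp[OF lin(1) lin(2)] bil_q[of 0 0 0 0], of u v] by (simp add: vals)
  qed
  then show ?thesis
    unfolding form_in_chart_def fundamental_form_def pt(4)[OF z] cv_def[symmetric] J_cv[OF z] .
qed

text \<open>The chart expression of \<open>J\<close> equals \<open>JJ\<close> on \<open>TS\<close>
  only; as this set is open, derivatives at its points are the same.\<close>

lemma nijenhuis_cong:
  assumes z: "z \<in> TS"
  shows "nijenhuis (endo_in_chart (cotangent_atlas A) J \<kappa>c) X Y z = nijenhuis JJ X Y z"
proof -
  have "frechet_derivative (\<lambda>y. endo_in_chart (cotangent_atlas A) J \<kappa>c y (X y)) (at z) =
      frechet_derivative (\<lambda>y. JJ y (X y)) (at z)" for X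
  proof -
    have "((\<lambda>y. endo_in_chart (cotangent_atlas A) J \<kappa>c y (X y)) has_derivative D) (at z)"
      if "((\<lambda>y. JJ y (X y)) has_derivative D) (at z)" for D
      by (rule has_derivative_transform_within_open[OF that open_TS z]) (simp add: endo_in_chart_eq)
    moreover have "((\<lambda>y. JJ y (X y)) has_derivative D) (at z)"
      if "((\<lambda>y. endo_in_chart (cotangent_atlas A) J \<kappa>c y (X y)) has_derivative D) (at z)" for D
      by (rule has_derivative_transform_within_open[OF that open_TS z]) (simp add: endo_in_chart_eq)
    ultimately have "((\<lambda>y. endo_in_chart (cotangent_atlas A) J \<kappa>c y (X y)) has_derivative D) (at z) \<longleftrightarrow>
        ((\<lambda>y. JJ y (X y)) has_derivative D) (at z)" for D
      by blast
    then show ?thesis by (simp add: frechet_derivative_def)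
  qed
  then show ?thesis by (simp add: nijenhuis_def lie_bracket_def endo_in_chart_eq[OF z])
qed

section \<open>Integrability and closedness tested in one induced chart\<close>

lemma integrable_chart_iff:
  "(\<forall>X Y. smooth_on (chart_image \<kappa>c) X \<longrightarrow> smooth_on (chart_image \<kappa>c) Y \<longrightarrow>
      (\<forall>z\<in>chart_image \<kappa>c. nijenhuis (endo_in_chart (cotangent_atlas A) J \<kappa>c) X Y z = 0)) \<longleftrightarrow>
   (\<forall>q\<in>chart_image \<kappa>. \<forall>p u v w. FF (en (q, p)) * ((p \<bullet> u) * (w \<bullet> (metric_matrix A g \<kappa> q *v v))
      - (p \<bullet> v) * (w \<bullet> (metric_matrix A g \<kappa> q *v u))) = p \<bullet> Riem q u v w)"
  (is "?L \<longleftrightarrow> ?R")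
proof -
  have "?L \<longleftrightarrow> (\<forall>z\<in>TS. \<forall>X Y. smooth_on TS X \<longrightarrow> smooth_on TS Y \<longrightarrow> nijenhuis JJ X Y z = 0)"
    unfolding chart_image_\<kappa>c using nijenhuis_cong by metis
  also have "\<dots> \<longleftrightarrow> (\<forall>z\<in>TS. \<forall>u v w. FF (en z) * ((snd z \<bullet> u) * (w \<bullet> (metric_matrix A g \<kappa> (fst z) *v v))
      - (snd z \<bullet> v) * (w \<bullet> (metric_matrix A g \<kappa> (fst z) *v u))) = snd z \<bullet> Riem (fst z) u v w)"
    using J.nijenhuis_vanishes_iff Nij_vanishes_iff by (intro ball_cong refl) metis
  also have "\<dots> \<longleftrightarrow> ?R" by auto
  finally show ?thesis .
qed

text \<open>Rescaling one nonzero covector over a single point of M reaches every t > 0, where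
  \<open>closed_iff\<close> applies; t = 0 follows by continuity of \<open>mu\<close> and of the
  derivative of \<open>lam\<close>.\<close>

lemma closed_chart_iff:
  assumes n: "CARD('n) > 1" and ne: "chart_image \<kappa> \<noteq> {}"
  shows "(\<forall>z\<in>chart_image \<kappa>c. \<forall>u v w.
      exterior_deriv2 (form_in_chart (cotangent_atlas A) (fundamental_form G J) \<kappa>c) z u v w = 0) \<longleftrightarrow>
    (\<forall>t\<ge>0. mu t = halfline_deriv lam t)"
  (is "?L \<longleftrightarrow> ?R")
proof
  assume ?R
  then show ?L
    unfolding chart_image_\<kappa>c using exterior_deriv2_ph[OF _ form_in_chart_eq] en_nonneg by simp
next
  assume L: ?L
  obtain q where q: "q \<in> chart_image \<kappa>" using ne by blast
  obtain p :: "real^'n" where p: "p \<noteq> 0" using vector_choose_size[of 1] by force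
  have e: "en (q, p) > 0" using gi_positive[OF q p] by (simp add: en_def xx_def)
  have pos: "mu t - halfline_deriv lam t = 0" if t: "t > 0" for t
  proof -
    define s where "s = sqrt (t / en (q, p))"
    have s: "s > 0" using t e by (simp add: s_def)
    let ?z = "(q, s *\<^sub>R p)"
    have z: "?z \<in> TS" using q by simp
    have "en ?z = s\<^sup>2 * en (q, p)"
      by (simp add: en_def xx_def matrix_vector_mult_scaleR power2_eq_square)
    also have "\<dots> = t" using t e by (simp add: s_def)
    finally have "en ?z = t" .
    moreover have "mu (en ?z) = halfline_deriv lam (en ?z)"
      using closed_iff[OF z form_in_chart_eq n] L z s p unfolding chart_image_\<kappa>c by simp
    ultimately show ?thesis by simp
  qed
  have cont: "continuous_on {0..} (\<lambda>t. mu t - halfline_deriv lam t)"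
    by (intro continuous_on_diff smooth_on_halfline(2)[OF lam_smooth] DERIV_continuous_on[of _ mu "halfline_deriv mu"])
      (auto intro: mu_deriv)
  have cl: "closure {0<..} = {0::real..}" by simp
  have "mu t - halfline_deriv lam t = 0" if "t \<ge> 0" for t
    by (rule continuous_constant_on_closure[of "{0<..}" "\<lambda>t. mu t - halfline_deriv lam t"])
      (use cont pos that in \<open>simp_all add: cl\<close>)
  then show ?R by simp
qed

lemma FF_continuous: "continuous_on {0..} FF"
  unfolding FF_def[abs_def]
  by (intro continuous_intros smooth_on_halfline(2)[OF a1_smooth] DERIV_continuous_on[of _ a1 "halfline_deriv a1"]
      DERIV_continuous_on[of _ b1 "halfline_deriv b1"]) (auto intro: a1_deriv b1_deriv)

lemma integrable_chart_constant_curvature: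
  assumes n: "CARD('n) > 1" and ne: "chart_image \<kappa> \<noteq> {}"
    and "\<forall>X Y. smooth_on (chart_image \<kappa>c) X \<longrightarrow> smooth_on (chart_image \<kappa>c) Y \<longrightarrow>
      (\<forall>z\<in>chart_image \<kappa>c. nijenhuis (endo_in_chart (cotangent_atlas A) J \<kappa>c) X Y z = 0)"
  shows "\<forall>t\<ge>0. FF t = FF 0"
    and "\<forall>x\<in>chart_dom \<kappa>. \<forall>u\<in>tangent_space A x. \<forall>v\<in>tangent_space A x.
      linearly_independent u v \<longrightarrow> sectional_curvature A g \<kappa> x u v = FF 0"
proof -
  have eq: "\<And>q p u v w. q \<in> chart_image \<kappa> \<Longrightarrow> FF (en (q, p)) * ((p \<bullet> u) * (w \<bullet> (metric_matrix A g \<kappa> q *v v))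
      - (p \<bullet> v) * (w \<bullet> (metric_matrix A g \<kappa> q *v u))) = p \<bullet> Riem q u v w"
    using assms(3) unfolding integrable_chart_iff by blast
  obtain q where "q \<in> chart_image \<kappa>" using ne by blast
  from FF_constant_curvature(1)[OF n this FF_continuous eq[OF this]]
  show "\<forall>t\<ge>0. FF t = FF 0" by blast
  show "\<forall>x\<in>chart_dom \<kappa>. \<forall>u\<in>tangent_space A x. \<forall>v\<in>tangent_space A x.
      linearly_independent u v \<longrightarrow> sectional_curvature A g \<kappa> x u v = FF 0"
    unfolding constant_sectional_curvature_chart
    using FF_constant_curvature(2)[OF n _ FF_continuous eq] by blast
qed

lemma constant_curvature_integrable_chart:
  assumes "\<forall>t\<ge>0. FF t = c"
    and "\<forall>x\<in>chart_dom \<kappa>. \<forall>u\<in>tangent_space A x. \<forall>v\<in>tangent_space A x.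
      linearly_independent u v \<longrightarrow> sectional_curvature A g \<kappa> x u v = c"
  shows "\<forall>X Y. smooth_on (chart_image \<kappa>c) X \<longrightarrow> smooth_on (chart_image \<kappa>c) Y \<longrightarrow>
      (\<forall>z\<in>chart_image \<kappa>c. nijenhuis (endo_in_chart (cotangent_atlas A) J \<kappa>c) X Y z = 0)"
  unfolding integrable_chart_iff
proof (intro ballI allI)
  fix q p u v w assume q: "q \<in> chart_image \<kappa>"
  have "FF (en (q, p)) = c" using assms(1) en_nonneg[of "(q, p)"] q by simp
  moreover have "Riem q u v w = c *\<^sub>R ((w \<bullet> (metric_matrix A g \<kappa> q *v v)) *\<^sub>R u - (w \<bullet> (metric_matrix A g \<kappa> q *v u)) *\<^sub>R v)"
    using assms(2) q unfolding constant_sectional_curvature_chart by blast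
  ultimately show "FF (en (q, p)) * ((p \<bullet> u) * (w \<bullet> (metric_matrix A g \<kappa> q *v v))
      - (p \<bullet> v) * (w \<bullet> (metric_matrix A g \<kappa> q *v u))) = p \<bullet> Riem q u v w"
    by (simp add: inner_diff_right mult.commute)
qed

end

theorem theorem7:
  fixes X :: "'m topology" and A :: "('m, real^'n) chart set" and g :: "'m metric_field"
    and a1 b1 lam mu :: "real \<Rightarrow> real"
    and G :: "'m covec metric_field" and J :: "'m covec \<Rightarrow> 'm covec tvec \<Rightarrow> 'm covec tvec"
  assumes "smooth_manifold X A" and "riemannian_metric A g" and "CARD('n) > 1"
    and "smooth_on {0..} a1" and "smooth_on {0..} b1"
    and "smooth_on {0..} lam" and "smooth_on {0..} mu"
    and "\<And>t. t \<ge> 0 \<Longrightarrow> a1 t > 0" and "\<And>t. t \<ge> 0 \<Longrightarrow> a1 t + 2 * t * b1 t > 0"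
    and "\<And>t. t \<ge> 0 \<Longrightarrow> lam t > 0" and "\<And>t. t \<ge> 0 \<Longrightarrow> lam t + 2 * t * mu t > 0"
    and "natural_diagonal_structure A g a1 b1 lam mu G J"
  shows "kaehlerian (cotangent_atlas A) G J \<longleftrightarrow>
    (\<exists>c. constant_sectional_curvature A g c \<and>
       (\<forall>t\<ge>0. a1 t - 2 * t * halfline_deriv a1 t \<noteq> 0 \<and>
          b1 t = (a1 t * halfline_deriv a1 t - c) / (a1 t - 2 * t * halfline_deriv a1 t)) \<and>
       (\<forall>t\<ge>0. mu t = halfline_deriv lam t))"
proof -
  interpret manifold_atlas A by (rule smooth_manifold_atlas[OF assms(1)])
  have chart: "natural_chart A g \<kappa> a1 b1 lam mu G J" if "\<kappa> \<in> A" for \<kappa>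
    using assms(2,4-9,12) that manifold_atlas_axioms
    by (intro natural_chart.intro riemannian_chart.intro riemannian_chart_axioms.intro natural_chart_axioms.intro)
  have nonempty: "chart_image \<kappa> \<noteq> {} \<longleftrightarrow> chart_dom \<kappa> \<noteq> {}" for \<kappa> :: "('m, real^'n) chart"
    by (simp add: chart_image_def)
  \<comment> \<open>An atlas may contain empty charts, which say nothing about the coefficient
    functions; a nonempty one exists because M is nonempty.\<close>
  obtain \<kappa>0 where \<kappa>0: "\<kappa>0 \<in> A" "chart_image \<kappa>0 \<noteq> {}"
    using assms(1) unfolding smooth_manifold_def nonempty by blast
  interpret C0: natural_chart A g \<kappa>0 a1 b1 lam mu G J by (rule chart[OF \<kappa>0(1)])
  \<comment> \<open>No chart occurs in this expression, so the curvature constants found in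
    different charts are all equal to \<open>F 0\<close>.\<close>
  define F where "F t = (a1 t + 2 * t * b1 t) * halfline_deriv a1 t - a1 t * b1 t" for t
  have F: "C0.FF = F" by (simp add: fun_eq_iff C0.FF_def F_def)
  have chart_integrable: "(\<forall>X Y. smooth_on (chart_image (induced_chart A \<kappa>)) X \<longrightarrow>
      smooth_on (chart_image (induced_chart A \<kappa>)) Y \<longrightarrow> (\<forall>z\<in>chart_image (induced_chart A \<kappa>).
        nijenhuis (endo_in_chart (cotangent_atlas A) J (induced_chart A \<kappa>)) X Y z = 0)) \<longleftrightarrow>
    (\<forall>x\<in>chart_dom \<kappa>. \<forall>u\<in>tangent_space A x. \<forall>v\<in>tangent_space A x.
      linearly_independent u v \<longrightarrow> sectional_curvature A g \<kappa> x u v = F 0)"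
    if "\<kappa> \<in> A" "\<forall>t\<ge>0. F t = F 0" for \<kappa>
  proof (cases "chart_image \<kappa> = {}")
    case True
    then show ?thesis using nonempty[of \<kappa>] by (simp add: induced_chart_image[OF that(1)])
  next
    case False
    interpret C: natural_chart A g \<kappa> a1 b1 lam mu G J by (rule chart[OF that(1)])
    have "C.FF = F" by (simp add: fun_eq_iff C.FF_def F_def)
    then show ?thesis
      using C.integrable_chart_constant_curvature(2)[OF assms(3) False]
        C.constant_curvature_integrable_chart[of "F 0"] that(2) by metis
  qed
  have F_const: "\<forall>t\<ge>0. F t = F 0" if "integrable_acs (cotangent_atlas A) J"
    using C0.integrable_chart_constant_curvature(1)[OF assms(3) \<kappa>0(2)] that C0.\<kappa>c
    unfolding integrable_acs_def F by blast
  have "integrable_acs (cotangent_atlas A) J \<longleftrightarrow>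
      (\<forall>t\<ge>0. F t = F 0) \<and> constant_sectional_curvature A g (F 0)"
    using F_const chart_integrable
    unfolding integrable_acs_def constant_sectional_curvature_def cotangent_atlas_def ball_simps by blast
  \<comment> \<open>Evaluation at t = 0 shows that \<open>F 0\<close> is the only candidate for
    \<open>c\<close>.\<close>
  also have "\<dots> \<longleftrightarrow> (\<exists>c. constant_sectional_curvature A g c \<and> (\<forall>t\<ge>0. F t = c))"
    by auto
  finally have integrable: "integrable_acs (cotangent_atlas A) J \<longleftrightarrow>
    (\<exists>c. constant_sectional_curvature A g c \<and>
       (\<forall>t\<ge>0. a1 t - 2 * t * halfline_deriv a1 t \<noteq> 0 \<and>
          b1 t = (a1 t * halfline_deriv a1 t - c) / (a1 t - 2 * t * halfline_deriv a1 t)))"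
    using C0.FF_constant_iff unfolding F by simp
  have closed_chart: "(\<forall>z\<in>chart_image (induced_chart A \<kappa>). \<forall>u v w. exterior_deriv2
      (form_in_chart (cotangent_atlas A) (fundamental_form G J) (induced_chart A \<kappa>)) z u v w = 0) \<longleftrightarrow>
    (\<forall>t\<ge>0. mu t = halfline_deriv lam t)" if "\<kappa> \<in> A" "chart_image \<kappa> \<noteq> {}" for \<kappa>
  proof -
    interpret C: natural_chart A g \<kappa> a1 b1 lam mu G J by (rule chart[OF that(1)])
    show ?thesis by (rule C.closed_chart_iff[OF assms(3) that(2)])
  qed
  have "closed_2form (cotangent_atlas A) (fundamental_form G J) \<longleftrightarrow> (\<forall>t\<ge>0. mu t = halfline_deriv lam t)"
  proof
    assume "closed_2form (cotangent_atlas A) (fundamental_form G J)"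
    then show "\<forall>t\<ge>0. mu t = halfline_deriv lam t"
      using closed_chart[OF \<kappa>0] C0.\<kappa>c unfolding closed_2form_def by blast
  next
    assume R: "\<forall>t\<ge>0. mu t = halfline_deriv lam t"
    show "closed_2form (cotangent_atlas A) (fundamental_form G J)"
      unfolding closed_2form_def
    proof
      fix \<kappa>' assume "\<kappa>' \<in> cotangent_atlas A"
      then obtain \<kappa> where \<kappa>: "\<kappa> \<in> A" "\<kappa>' = induced_chart A \<kappa>" by (auto simp: cotangent_atlas_def)
      show "\<forall>z\<in>chart_image \<kappa>'. \<forall>u v w.
          exterior_deriv2 (form_in_chart (cotangent_atlas A) (fundamental_form G J) \<kappa>') z u v w = 0"
      proof (cases "chart_image \<kappa> = {}")
        case True
        then show ?thesis by (simp add: \<kappa>(2) induced_chart_image[OF \<kappa>(1)])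
      next
        case False
        then show ?thesis using closed_chart[OF \<kappa>(1)] R unfolding \<kappa>(2) by blast
      qed
    qed
  qed
  with integrable show ?thesis unfolding kaehlerian_def by blast
qed

end
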